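(* Consider the symmetric random walk Metropolis (SRWM) Markov chain on $\mathsf{X}=\mathbb{R}^d$ with target distribution $\pi\in\mathcal{P}$ and increment density $q$ having a finite moment of order $p>1$ and of the form $q(x)=\det(\Sigma)^{-1/2}q_0(\Sigma^{-1/2}x)$, where $\Sigma$ is a positive definite matrix and $q_0$ is a rotationally invariant probability density ($q_0(Ux)=q_0(x)$ for every unitary matrix $U$) with $\int_{\mathsf{X}} y_1^2q_0(y)\,dy<\infty$. Then, for any $1\le u\le p$, the SRWM Markov chain is $(f_u,r_u)$-ergodic with $$f_u(x)=1+|x|^{p-u},\qquad r_u(t)\sim t^{u-1}.$$
   Context: SRWM chain: given a target probability density $\pi$ and a symmetric increment density $q$ on $\mathbb{R}^d$ (w.r.t. Lebesgue measure), it is the Markov chain with transition kernel $$P(x,A)=\int_{A-x}\Big(1\wedge\tfrac{\pi(x+y)}{\pi(x)}\Big)q(y)\,dy+\mathbf{1}_A(x)\int_{\mathbb{R}^d}\Big\{1-\Big(1\wedge\tfrac{\pi(x+y)}{\pi(x)}\Big)\Big\}q(y)\,dy ,\qquad A-x=\{y:x+y\in A\}.$$ Class $\mathcal{P}$: everywhere positive probability densities $\pi$ with continuous second derivatives such that $\pi(x)\propto g(x)\exp\{-p(x)\}$, where (in this definition $p(\cdot)$ denotes a polynomial, not the moment order) - $g$ is a positive function slowly varying at infinity: for any $K>0$, $\limsup_{|x|\to\infty}\inf_{|y|\le K}\frac{g(x+y)}{g(x)}=\limsup_{|x|\to\infty}\sup_{|y|\le K}\frac{g(x+y)}{g(x)}=1$;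 - $p(\cdot)$ is a positive polynomial on $\mathbb{R}^d$ of even order $m$ with $\lim_{|x|\to\infty}p_m(x)=+\infty$, $p_m$ being the polynomial consisting only of the $m$th order terms of $p(\cdot)$. $(f,r)$-ergodicity: for $f:\mathsf{X}\to[1,\infty)$ let $\|\nu\|_f=\sup_{|g|\le f}|\nu(g)|$ for finite signed measures $\nu$; an aperiodic, phi-irreducible, positive Harris chain with stationary distribution $\pi$ is $(f,r)$-ergodic if $\lim_{n\to\infty}r(n)\|P^n(x,\cdot)-\pi\|_f=0$ for all $x\in\mathsf{X}$. *)

theory Defs
  imports
    "HOL-Probability.Probability"
    "HOL-Library.Landau_Symbols"
begin

section \<open>General state space Markov chains\<close>

text \<open>
  A transition kernel is a map \<open>P\<close> with \<open>P x\<close> the law of the next state; the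
  definitions are meaningful for \<open>P \<in> borel \<rightarrow>\<^sub>M prob_algebra borel\<close>. Terminology is that of
  Meyn and Tweedie, Markov Chains and Stochastic Stability.
\<close>

primrec kernel_pow :: "('a::topological_space \<Rightarrow> 'a measure) \<Rightarrow> nat \<Rightarrow> 'a \<Rightarrow> 'a measure" where
  "kernel_pow P 0 x = return borel x"
| "kernel_pow P (Suc n) x = P x \<bind> kernel_pow P n"

text \<open>
  The law on path space of the chain started in \<open>x\<close> (so \<open>\<omega> 0 = x\<close> almost surely), given by the
  Ionescu-Tulcea theorem. The \<open>n\<close>-th argument kernel depends on the past only through its last
  coordinate.
\<close>

definition chain_step :: "('a::topological_space \<Rightarrow> 'a measure) \<Rightarrow> 'a \<Rightarrow> nat \<Rightarrow> (nat \<Rightarrow> 'a) \<Rightarrow> 'a measure" where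
  "chain_step P x n \<omega> = (case n of 0 \<Rightarrow> return borel x | Suc k \<Rightarrow> P (\<omega> k))"

definition path_law :: "('a::topological_space \<Rightarrow> 'a measure) \<Rightarrow> 'a \<Rightarrow> (nat \<Rightarrow> 'a) measure" where
  "path_law P x =
     projective_family.lim UNIV (Ionescu_Tulcea.CI (chain_step P x) (\<lambda>_. borel)) (\<lambda>_. borel)"

lemma Ionescu_Tulcea_chain_step:
  assumes P: "P \<in> borel \<rightarrow>\<^sub>M prob_algebra (borel :: 'a::topological_space measure)"
  shows "Ionescu_Tulcea (chain_step P x) (\<lambda>_. borel)"
proof (rule Ionescu_Tulcea.intro)
  have P': "P \<in> borel \<rightarrow>\<^sub>M subprob_algebra borel"
    using P by (rule measurable_prob_algebraD)
  show "chain_step P x i \<in> PiM {0..<i} (\<lambda>_. borel) \<rightarrow>\<^sub>M subprob_algebra borel" for i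
  proof (cases i)
    case 0
    have "return borel x \<in> space (subprob_algebra borel)"
      using measurable_space[OF return_measurable, of x borel] by simp
    then show ?thesis
      using 0 by (simp add: chain_step_def[abs_def])
  next
    case (Suc k)
    have "(\<lambda>\<omega>. P (\<omega> k)) \<in> PiM {0..<Suc k} (\<lambda>_. borel) \<rightarrow>\<^sub>M subprob_algebra borel"
      by (rule measurable_compose[OF _ P']) (rule measurable_component_singleton, simp)
    then show ?thesis
      using Suc by (simp add: chain_step_def[abs_def])
  qed
  fix i \<omega>
  show "prob_space (chain_step P x i \<omega>)"
  proof (cases i)
    case 0
    then show ?thesis by (simp add: chain_step_def prob_space_return)
  next
    case (Suc k)
    have "P (\<omega> k) \<in> space (prob_algebra borel)"
      using measurable_space[OF P] by simp
    then show ?thesis using Suc by (simp add: chain_step_def space_prob_algebra)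
  qed
qed

definition irreducibility_measure :: "('a::topological_space \<Rightarrow> 'a measure) \<Rightarrow> 'a measure \<Rightarrow> bool" where
  "irreducibility_measure P \<phi> \<longleftrightarrow>
     sets \<phi> = sets borel \<and> sigma_finite_measure \<phi> \<and> emeasure \<phi> UNIV \<noteq> 0 \<and>
     (\<forall>A\<in>sets borel. emeasure \<phi> A > 0 \<longrightarrow> (\<forall>x. \<exists>n\<ge>1. emeasure (kernel_pow P n x) A > 0))"

definition phi_irreducible :: "('a::topological_space \<Rightarrow> 'a measure) \<Rightarrow> bool" where
  "phi_irreducible P \<longleftrightarrow> (\<exists>\<phi>. irreducibility_measure P \<phi>)"

definition maximal_irreducibility_measure ::
  "('a::topological_space \<Rightarrow> 'a measure) \<Rightarrow> 'a measure \<Rightarrow> bool" where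
  "maximal_irreducibility_measure P \<psi> \<longleftrightarrow>
     irreducibility_measure P \<psi> \<and> (\<forall>\<phi>. irreducibility_measure P \<phi> \<longrightarrow> absolutely_continuous \<psi> \<phi>)"

text \<open>
  A \<open>d\<close>-cycle consists of disjoint sets \<open>D 0, \<dots>, D (d - 1)\<close>, visited cyclically, whose union has a
  \<open>\<psi>\<close>-null complement. All maximal irreducibility measures are equivalent, so the choice of \<open>\<psi>\<close>
  below is immaterial.
\<close>

definition is_cycle ::
  "('a::topological_space \<Rightarrow> 'a measure) \<Rightarrow> 'a measure \<Rightarrow> nat \<Rightarrow> (nat \<Rightarrow> 'a set) \<Rightarrow> bool" where
  "is_cycle P \<psi> d D \<longleftrightarrow>
     d \<ge> 1 \<and> (\<forall>i<d. D i \<in> sets borel) \<and> disjoint_family_on D {..<d} \<and>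
     (\<forall>i<d. \<forall>x\<in>D i. emeasure (P x) (D (Suc i mod d)) = 1) \<and>
     emeasure \<psi> (UNIV - (\<Union>i<d. D i)) = 0"

definition aperiodic :: "('a::topological_space \<Rightarrow> 'a measure) \<Rightarrow> bool" where
  "aperiodic P \<longleftrightarrow>
     (\<exists>\<psi>. maximal_irreducibility_measure P \<psi> \<and> \<not> (\<exists>d\<ge>2. \<exists>D. is_cycle P \<psi> d D))"

definition harris :: "('a::topological_space \<Rightarrow> 'a measure) \<Rightarrow> bool" where
  "harris P \<longleftrightarrow>
     (\<exists>\<psi>. maximal_irreducibility_measure P \<psi> \<and>
        (\<forall>A\<in>sets borel. emeasure \<psi> A > 0 \<longrightarrow>
           (\<forall>x. AE \<omega> in path_law P x. \<exists>\<^sub>\<infinity>n. \<omega> n \<in> A)))"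

definition stationary_distribution :: "('a::topological_space \<Rightarrow> 'a measure) \<Rightarrow> 'a measure \<Rightarrow> bool" where
  "stationary_distribution P \<mu> \<longleftrightarrow>
     sets \<mu> = sets borel \<and> prob_space \<mu> \<and>
     (\<forall>A\<in>sets borel. emeasure \<mu> A = (\<integral>\<^sup>+x. emeasure (P x) A \<partial>\<mu>))"

definition positive_harris :: "('a::topological_space \<Rightarrow> 'a measure) \<Rightarrow> bool" where
  "positive_harris P \<longleftrightarrow> harris P \<and> (\<exists>\<mu>. stationary_distribution P \<mu>)"

text \<open>
  The \<open>f\<close>-norm of the signed measure \<open>\<mu> - \<nu>\<close>, for finite measures \<open>\<mu>\<close> and \<open>\<nu>\<close>. The supremum is
  over those \<open>g\<close> for which \<open>\<mu>(g) - \<nu>(g)\<close> makes sense. These include all bounded measurable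
  \<open>g\<close> with \<open>\<bar>g\<bar> \<le> f\<close>, hence the value is the integral of \<open>f\<close> against the total variation
  measure of \<open>\<mu> - \<nu>\<close>, possibly infinite.
\<close>

definition f_norm_diff :: "('a::topological_space \<Rightarrow> real) \<Rightarrow> 'a measure \<Rightarrow> 'a measure \<Rightarrow> ereal" where
  "f_norm_diff f \<mu> \<nu> =
     (SUP g \<in> {g. integrable \<mu> g \<and> integrable \<nu> g \<and> (\<forall>x. \<bar>g x\<bar> \<le> f x)}.
        ereal \<bar>(\<integral>x. g x \<partial>\<mu>) - (\<integral>x. g x \<partial>\<nu>)\<bar>)"

definition fr_ergodic ::
  "('a::topological_space \<Rightarrow> 'a measure) \<Rightarrow> 'a measure \<Rightarrow> ('a \<Rightarrow> real) \<Rightarrow> (nat \<Rightarrow> real) \<Rightarrow> bool" where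
  "fr_ergodic P \<mu> f r \<longleftrightarrow>
     aperiodic P \<and> phi_irreducible P \<and> positive_harris P \<and> stationary_distribution P \<mu> \<and>
     f \<in> borel_measurable borel \<and> (\<forall>x. 1 \<le> f x) \<and>
     (\<forall>x. (\<lambda>n. ereal (r n) * f_norm_diff f (kernel_pow P n x) \<mu>) \<longlonglongrightarrow> 0)"

section \<open>The symmetric random walk Metropolis kernel\<close>

definition prob_density :: "('a::euclidean_space \<Rightarrow> real) \<Rightarrow> bool" where
  "prob_density q \<longleftrightarrow>
     q \<in> borel_measurable borel \<and> (\<forall>x. 0 \<le> q x) \<and> (\<integral>\<^sup>+x. ennreal (q x) \<partial>lborel) = 1"

definition accept :: "('a::euclidean_space \<Rightarrow> real) \<Rightarrow> 'a \<Rightarrow> 'a \<Rightarrow> real" where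
  "accept \<pi> x y = min 1 (\<pi> (x + y) / \<pi> x)"

definition srwm :: "('a::euclidean_space \<Rightarrow> real) \<Rightarrow> ('a \<Rightarrow> real) \<Rightarrow> 'a \<Rightarrow> 'a measure" where
  "srwm \<pi> q x = measure_of UNIV (sets borel) (\<lambda>A.
     (\<integral>\<^sup>+y\<in>{y. x + y \<in> A}. ennreal (accept \<pi> x y * q y) \<partial>lborel) +
     indicator A x * (\<integral>\<^sup>+y. ennreal ((1 - accept \<pi> x y) * q y) \<partial>lborel))"

lemma emeasure_srwm:
  fixes \<pi> q :: "'a::euclidean_space \<Rightarrow> real"
  assumes [measurable]: "\<pi> \<in> borel_measurable borel" "q \<in> borel_measurable borel"
    and A: "A \<in> sets borel"
  shows "emeasure (srwm \<pi> q x) A =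
     (\<integral>\<^sup>+y\<in>{y. x + y \<in> A}. ennreal (accept \<pi> x y * q y) \<partial>lborel) +
     indicator A x * (\<integral>\<^sup>+y. ennreal ((1 - accept \<pi> x y) * q y) \<partial>lborel)"
proof -
  have [measurable]: "accept \<pi> x \<in> borel_measurable borel"
    unfolding accept_def[abs_def] by measurable
  define D where "D = distr (density lborel (\<lambda>y. ennreal (accept \<pi> x y * q y))) borel ((+) x)"
  define c where "c = (\<integral>\<^sup>+y. ennreal ((1 - accept \<pi> x y) * q y) \<partial>lborel)"
  let ?F = "\<lambda>A. (\<integral>\<^sup>+y\<in>{y. x + y \<in> A}. ennreal (accept \<pi> x y * q y) \<partial>lborel) + indicator A x * c"
  have F: "?F B = emeasure D B + c * emeasure (return borel x) B" if [measurable]: "B \<in> sets borel" for B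
  proof -
    have *: "{y. x + y \<in> B} \<in> sets borel" by measurable
    have "emeasure D B = (\<integral>\<^sup>+y\<in>{y. x + y \<in> B}. ennreal (accept \<pi> x y * q y) \<partial>lborel)"
      unfolding D_def using * by (simp add: emeasure_distr emeasure_density vimage_def)
    then show ?thesis by (simp add: mult.commute)
  qed
  have "emeasure (srwm \<pi> q x) A = ?F A"
  proof (rule emeasure_measure_of)
    show "srwm \<pi> q x = measure_of UNIV (sets borel) ?F"
      by (simp add: srwm_def c_def)
    show "positive (sets (srwm \<pi> q x)) ?F"
      by (simp add: positive_def)
    show "countably_additive (sets (srwm \<pi> q x)) ?F"
    proof (rule countably_additiveI)
      fix B :: "nat \<Rightarrow> 'a set"
      have S: "sets (srwm \<pi> q x) = sets borel"
        unfolding srwm_def using sets.sigma_sets_eq[of "borel :: 'a measure"]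
        by (simp add: sets_measure_of_conv)
      assume B: "range B \<subseteq> sets (srwm \<pi> q x)" "disjoint_family B" "\<Union> (range B) \<in> sets (srwm \<pi> q x)"
      then have B': "range B \<subseteq> sets borel" "\<And>i. B i \<in> sets borel" "\<Union> (range B) \<in> sets borel"
        by (auto simp: S)
      have "(\<Sum>i. ?F (B i)) = (\<Sum>i. emeasure D (B i) + c * emeasure (return borel x) (B i))"
        using F B'(2) by simp
      also have "\<dots> = (\<Sum>i. emeasure D (B i)) + c * (\<Sum>i. emeasure (return borel x) (B i))"
        by (simp add: suminf_add[symmetric])
      also have "\<dots> = emeasure D (\<Union> (range B)) + c * emeasure (return borel x) (\<Union> (range B))"
        using B' B(2) by (subst (1 2) suminf_emeasure) (auto simp: D_def)
      also have "\<dots> = ?F (\<Union> (range B))"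
        using F[OF B'(3)] by simp
      finally show "(\<Sum>i. ?F (B i)) = ?F (\<Union> (range B))" .
    qed
    show "A \<in> sets (srwm \<pi> q x)"
      unfolding srwm_def using sets.sigma_sets_eq[of "borel :: 'a measure"] A
      by (simp add: sets_measure_of_conv)
  qed simp
  then show ?thesis by (simp add: c_def)
qed

lemma sets_srwm [simp]: "sets (srwm \<pi> q x) = sets borel"
  unfolding srwm_def using sets.sigma_sets_eq[of "borel :: 'a measure"]
  by (simp add: sets_measure_of_conv)

lemma space_srwm [simp]: "space (srwm \<pi> q x) = UNIV"
  using sets_eq_imp_space_eq[OF sets_srwm] by simp

lemma srwm_kernel:
  fixes \<pi> q :: "'a::euclidean_space \<Rightarrow> real"
  assumes \<pi>: "\<pi> \<in> borel_measurable borel" "\<And>x. 0 < \<pi> x" and q: "prob_density q"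
  shows "srwm \<pi> q \<in> borel \<rightarrow>\<^sub>M prob_algebra borel"
proof (rule measurable_prob_algebraI)
  note [measurable] = \<pi>(1)
  have [measurable]: "q \<in> borel_measurable borel" and q0: "\<And>y. 0 \<le> q y"
    and q1: "(\<integral>\<^sup>+y. ennreal (q y) \<partial>lborel) = 1"
    using q by (auto simp: prob_density_def)
  have [measurable]: "accept \<pi> x \<in> borel_measurable borel" for x
    unfolding accept_def[abs_def] by measurable
  have acc: "0 \<le> accept \<pi> x y" "accept \<pi> x y \<le> 1" for x y
    using \<pi>(2) by (auto simp: accept_def less_imp_le)
  show P: "prob_space (srwm \<pi> q x)" for x
  proof
    have "emeasure (srwm \<pi> q x) UNIV =
        (\<integral>\<^sup>+y. ennreal (accept \<pi> x y * q y) + ennreal ((1 - accept \<pi> x y) * q y) \<partial>lborel)"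
      by (subst emeasure_srwm) (auto simp: nn_integral_add)
    also have "\<dots> = (\<integral>\<^sup>+y. ennreal (q y) \<partial>lborel)"
    proof (intro nn_integral_cong)
      fix y
      have "0 \<le> accept \<pi> x y * q y" "0 \<le> (1 - accept \<pi> x y) * q y"
        using acc q0 by auto
      then show "ennreal (accept \<pi> x y * q y) + ennreal ((1 - accept \<pi> x y) * q y) = ennreal (q y)"
        by (subst ennreal_plus[symmetric]) (auto simp: algebra_simps)
    qed
    finally show "emeasure (srwm \<pi> q x) (space (srwm \<pi> q x)) = 1"
      using q1 by simp
  qed
  show "srwm \<pi> q \<in> borel \<rightarrow>\<^sub>M subprob_algebra borel"
  proof (rule measurable_subprob_algebra)
    show "subprob_space (srwm \<pi> q x)" for x
      using P by (rule prob_space_imp_subprob_space)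
    fix A :: "'a set" assume [measurable]: "A \<in> sets borel"
    have [measurable]: "(\<lambda>(x, y). accept \<pi> x y) \<in> borel_measurable (borel \<Otimes>\<^sub>M lborel)"
      unfolding accept_def by measurable
    show "(\<lambda>x. emeasure (srwm \<pi> q x) A) \<in> borel_measurable borel"
      by (subst emeasure_srwm) measurable
  qed simp
qed

section \<open>The class of target densities\<close>

text \<open>
  Polynomials in the coordinates of \<open>\<real>\<^sup>d\<close> are given by their coefficients \<open>c \<alpha>\<close>, of which only
  finitely many are nonzero, indexed by multi-indices \<open>\<alpha>\<close>.
\<close>

definition poly_support :: "(('n \<Rightarrow> nat) \<Rightarrow> real) \<Rightarrow> ('n \<Rightarrow> nat) set" where
  "poly_support c = {\<alpha>. c \<alpha> \<noteq> 0}"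

definition mon :: "('n::finite \<Rightarrow> nat) \<Rightarrow> real ^ 'n \<Rightarrow> real" where
  "mon \<alpha> x = (\<Prod>i\<in>UNIV. (x $ i) ^ \<alpha> i)"

definition poly_order :: "(('n::finite \<Rightarrow> nat) \<Rightarrow> real) \<Rightarrow> nat" where
  "poly_order c = Max (insert 0 ((\<lambda>\<alpha>. sum \<alpha> UNIV) ` poly_support c))"

definition poly_eval :: "(('n::finite \<Rightarrow> nat) \<Rightarrow> real) \<Rightarrow> real ^ 'n \<Rightarrow> real" where
  "poly_eval c x = (\<Sum>\<alpha>\<in>poly_support c. c \<alpha> * mon \<alpha> x)"

definition leading_part_eval :: "(('n::finite \<Rightarrow> nat) \<Rightarrow> real) \<Rightarrow> real ^ 'n \<Rightarrow> real" where
  "leading_part_eval c x =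
     (\<Sum>\<alpha>\<in>{\<alpha>\<in>poly_support c. sum \<alpha> UNIV = poly_order c}. c \<alpha> * mon \<alpha> x)"

definition slowly_varying :: "('a::real_normed_vector \<Rightarrow> real) \<Rightarrow> bool" where
  "slowly_varying g \<longleftrightarrow> (\<forall>K>0.
     Limsup at_infinity (\<lambda>x. INF y\<in>cball 0 K. ereal (g (x + y) / g x)) = 1 \<and>
     Limsup at_infinity (\<lambda>x. SUP y\<in>cball 0 K. ereal (g (x + y) / g x)) = 1)"

definition continuous_second_derivatives :: "(real ^ 'n \<Rightarrow> real) \<Rightarrow> bool" where
  "continuous_second_derivatives \<pi> \<longleftrightarrow>
     (\<exists>(G :: real ^ 'n \<Rightarrow> real ^ 'n) (H :: real ^ 'n \<Rightarrow> real ^ 'n ^ 'n).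
        (\<forall>x. (\<pi> has_derivative (\<lambda>h. G x \<bullet> h)) (at x)) \<and>
        (\<forall>x. (G has_derivative (\<lambda>h. H x *v h)) (at x)) \<and>
        continuous_on UNIV H)"

definition class_P :: "(real ^ 'n::finite \<Rightarrow> real) set" where
  "class_P = {\<pi>. prob_density \<pi> \<and> (\<forall>x. 0 < \<pi> x) \<and> continuous_second_derivatives \<pi> \<and>
     (\<exists>Z>0. \<exists>g c. (\<forall>x. \<pi> x = Z * (g x * exp (- poly_eval c x))) \<and>
        (\<forall>x. 0 < g x) \<and> slowly_varying g \<and>
        finite (poly_support c) \<and> (\<forall>x. 0 < poly_eval c x) \<and> even (poly_order c) \<and>
        filterlim (leading_part_eval c) at_top at_infinity)}"

section \<open>The increment density\<close>

definition pos_def :: "real ^ 'n ^ 'n \<Rightarrow> bool" where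
  "pos_def A \<longleftrightarrow> transpose A = A \<and> (\<forall>x. x \<noteq> 0 \<longrightarrow> 0 < x \<bullet> (A *v x))"

text \<open>The unique positive definite square root of a positive definite matrix.\<close>

definition matrix_sqrt :: "real ^ 'n ^ 'n \<Rightarrow> real ^ 'n ^ 'n" where
  "matrix_sqrt A = (THE B. pos_def B \<and> B ** B = A)"

definition rotationally_invariant :: "(real ^ 'n \<Rightarrow> real) \<Rightarrow> bool" where
  "rotationally_invariant q \<longleftrightarrow> (\<forall>U x. orthogonal_matrix U \<longrightarrow> q (U *v x) = q x)"

text \<open>The function \<open>1 + \<bar>x\<bar>\<^sup>a\<close>; the case distinction ensures \<open>\<bar>x\<bar>\<^sup>0 = 1\<close> also at
  \<open>x = 0\<close>, where \<open>0 powr 0 = 0\<close>.\<close>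

definition power_weight :: "real \<Rightarrow> 'a::real_normed_vector \<Rightarrow> real" where
  "power_weight a x = 1 + (if a = 0 then 1 else norm x powr a)"

end

theory Submission
  imports Defs "HOL-Real_Asymp.Real_Asymp"
begin

text \<open>
  Take \<open>V = \<pi>\<^sup>-\<^sup>1\<^sup>/\<^sup>2\<close>. Far out the polynomial \<open>p\<close> makes the ratio \<open>\<pi>(x + y) / \<pi>(x)\<close> close to
  \<open>0\<close> or to infinity, according to the sign of \<open>\<nabla>p(x) \<bullet> y\<close>: proposals of the first kind are
  rejected and leave \<open>V\<close> unchanged, those of the second kind are accepted and make \<open>V\<close>
  negligible. As \<open>q\<close> is symmetric, \<open>P V / V\<close> tends to \<open>1/2\<close> at infinity, whatever the
  tails of \<open>q\<close>. By Steinhaus's theorem two steps of the chain have a density bounded below near the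
  starting point, so some power of \<open>P\<close> is minorized on each ball. The argument of Hairer and
  Mattingly turns drift and minorization into a contraction for a weighted oscillation, hence
  into geometric convergence in the \<open>V\<close>-norm. Since \<open>V\<close> grows exponentially, this dominates every
  polynomial weight and rate. Irreducibility, aperiodicity and Harris recurrence are consequences of
  convergence in total variation from every starting point.
\<close>

section \<open>Powers of a Markov kernel\<close>

text \<open>The exponent 1/2 is a convenient value strictly between 0 and 1: weighted with the
  acceptance probability, the change of \<open>V\<close> under an accepted proposal is a factor of
  at most 1 whatever the ratio of densities, so \<open>2 * q\<close> dominates every integrand and
  the limit can be taken under the integral. The gradient decides the sign of the increment of
  \<open>p\<close> because it has size at least of order |x|^(m-1), by Euler's relation for the
  leading part, while the remainder is of order |x|^(m-2). The obstacle to a minorization is that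
  \<open>q\<close> may vanish near 0 and be nowhere continuous. Two jumps from a set where
  \<open>q\<close> is bounded below cover a ball around the starting point whose radius is the same
  for all starting points, so repetition reaches any distance. The contraction controls every
  starting point and not just almost every one, as Harris recurrence demands.\<close>

text \<open>Positive and negative parts are treated separately by \<open>nn_integral_bind\<close>.
  Integrability under each \<open>N x\<close> and under the mixture keeps both finite, so
  \<open>enn2real\<close> loses nothing and the parts can be subtracted. It serves functions that
  are unbounded but dominated by the drift function.\<close>

lemma integral_bind_integrable:
  fixes f :: "'b \<Rightarrow> real"
  assumes N: "N \<in> M \<rightarrow>\<^sub>M subprob_algebra B" and ne: "space M \<noteq> {}"
    and f[measurable]: "f \<in> borel_measurable B"
    and fN: "\<And>x. x \<in> space M \<Longrightarrow> integrable (N x) f"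
    and fb: "integrable (M \<bind> N) f"
  shows "integral\<^sup>L (M \<bind> N) f = (\<integral>x. integral\<^sup>L (N x) f \<partial>M)"
    and "integrable M (\<lambda>x. integral\<^sup>L (N x) f)"
proof -
  note [measurable] = N
  have *: "has_bochner_integral M (\<lambda>x. enn2real (\<integral>\<^sup>+y. ennreal (h y) \<partial>N x))
      (enn2real (\<integral>\<^sup>+y. ennreal (h y) \<partial>(M \<bind> N)))"
    if [measurable]: "h \<in> borel_measurable B" and hN: "\<And>x. x \<in> space M \<Longrightarrow> (\<integral>\<^sup>+y. ennreal (h y) \<partial>N x) < \<infinity>"
      and hb: "(\<integral>\<^sup>+y. ennreal (h y) \<partial>(M \<bind> N)) < \<infinity>" for h
  proof (rule has_bochner_integral_nn_integral)
    show "(\<lambda>x. enn2real (\<integral>\<^sup>+y. ennreal (h y) \<partial>N x)) \<in> borel_measurable M"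
      by measurable
    have "(\<integral>\<^sup>+x. ennreal (enn2real (\<integral>\<^sup>+y. ennreal (h y) \<partial>N x)) \<partial>M) = (\<integral>\<^sup>+x. (\<integral>\<^sup>+y. ennreal (h y) \<partial>N x) \<partial>M)"
      using hN by (intro nn_integral_cong) simp
    also have "\<dots> = (\<integral>\<^sup>+y. ennreal (h y) \<partial>(M \<bind> N))"
      by (rule nn_integral_bind[OF _ N, symmetric]) measurable
    finally show "(\<integral>\<^sup>+x. ennreal (enn2real (\<integral>\<^sup>+y. ennreal (h y) \<partial>N x)) \<partial>M) =
        ennreal (enn2real (\<integral>\<^sup>+y. ennreal (h y) \<partial>(M \<bind> N)))"
      using hb by simp
  qed auto
  have fin: "(\<integral>\<^sup>+y. ennreal (f y) \<partial>L) < \<infinity>" "(\<integral>\<^sup>+y. ennreal (- f y) \<partial>L) < \<infinity>" if "integrable L f" for L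
    using that unfolding real_integrable_def by (auto simp: less_top[symmetric])
  have "has_bochner_integral M
      (\<lambda>x. enn2real (\<integral>\<^sup>+y. ennreal (f y) \<partial>N x) - enn2real (\<integral>\<^sup>+y. ennreal (- f y) \<partial>N x))
      (enn2real (\<integral>\<^sup>+y. ennreal (f y) \<partial>(M \<bind> N)) - enn2real (\<integral>\<^sup>+y. ennreal (- f y) \<partial>(M \<bind> N)))"
    by (intro has_bochner_integral_diff * fin fN fb) auto
  moreover have "(enn2real (\<integral>\<^sup>+y. ennreal (f y) \<partial>(M \<bind> N)) - enn2real (\<integral>\<^sup>+y. ennreal (- f y) \<partial>(M \<bind> N)))
      = integral\<^sup>L (M \<bind> N) f"
    by (rule real_lebesgue_integral_def[OF fb, symmetric])
  moreover have "has_bochner_integral M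
      (\<lambda>x. enn2real (\<integral>\<^sup>+y. ennreal (f y) \<partial>N x) - enn2real (\<integral>\<^sup>+y. ennreal (- f y) \<partial>N x)) v \<longleftrightarrow>
    has_bochner_integral M (\<lambda>x. integral\<^sup>L (N x) f) v" for v
    by (rule has_bochner_integral_cong) (simp_all add: real_lebesgue_integral_def[OF fN])
  ultimately have "has_bochner_integral M (\<lambda>x. integral\<^sup>L (N x) f) (integral\<^sup>L (M \<bind> N) f)"
    by simp
  then show "integral\<^sup>L (M \<bind> N) f = (\<integral>x. integral\<^sup>L (N x) f \<partial>M)"
    and "integrable M (\<lambda>x. integral\<^sup>L (N x) f)"
    by (auto simp: has_bochner_integral_iff)
qed

lemma stationary_distributionD:
  assumes "stationary_distribution P \<mu>"
  shows "sets \<mu> = sets borel" "space \<mu> = UNIV" "prob_space \<mu>"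
  using assms sets_eq_imp_space_eq[of \<mu> borel] by (auto simp: stationary_distribution_def)

locale markov_kernel =
  fixes P :: "'a::topological_space \<Rightarrow> 'a measure"
  assumes P: "P \<in> borel \<rightarrow>\<^sub>M prob_algebra borel"
begin

lemma P_subprob [measurable]: "P \<in> borel \<rightarrow>\<^sub>M subprob_algebra borel"
  using P by (rule measurable_prob_algebraD)

lemma sets_P [simp, measurable_cong]: "sets (P x) = sets borel"
  using measurable_space[OF P, of x] by (simp add: space_prob_algebra)

lemma space_P [simp]: "space (P x) = UNIV"
  using sets_eq_imp_space_eq[OF sets_P] by simp

lemma prob_space_P: "prob_space (P x)"
  using measurable_space[OF P, of x] by (simp add: space_prob_algebra)

lemma kernel_pow_prob: "kernel_pow P n \<in> borel \<rightarrow>\<^sub>M prob_algebra borel"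
proof (induction n)
  case 0
  have "kernel_pow P 0 = return borel" by (simp add: fun_eq_iff)
  then show ?case by simp
next
  case (Suc n)
  have "(\<lambda>x. P x \<bind> kernel_pow P n) \<in> borel \<rightarrow>\<^sub>M prob_algebra borel"
    by (rule measurable_bind_prob_space[OF P Suc])
  then show ?case by (simp cong: measurable_cong)
qed

lemma kernel_pow_subprob [measurable]: "kernel_pow P n \<in> borel \<rightarrow>\<^sub>M subprob_algebra borel"
  using kernel_pow_prob by (rule measurable_prob_algebraD)

lemma sets_kernel_pow [simp, measurable_cong]: "sets (kernel_pow P n x) = sets borel"
  using measurable_space[OF kernel_pow_prob, of x] by (simp add: space_prob_algebra)

lemma space_kernel_pow [simp]: "space (kernel_pow P n x) = UNIV"
  using sets_eq_imp_space_eq[OF sets_kernel_pow] by simp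

lemma prob_space_kernel_pow: "prob_space (kernel_pow P n x)"
  using measurable_space[OF kernel_pow_prob, of x] by (simp add: space_prob_algebra)

lemma kernel_pow_add: "kernel_pow P (m + n) x = kernel_pow P m x \<bind> kernel_pow P n"
proof (induction m arbitrary: x)
  case 0
  show ?case by (simp add: bind_return[OF kernel_pow_subprob])
next
  case (Suc m)
  have "kernel_pow P (Suc m + n) x = P x \<bind> (\<lambda>y. kernel_pow P m y \<bind> kernel_pow P n)"
    using Suc by (simp cong: bind_cong)
  also have "\<dots> = (P x \<bind> kernel_pow P m) \<bind> kernel_pow P n"
    by (rule bind_assoc[symmetric, where N=borel and R=borel]) auto
  finally show ?case by simp
qed

lemma nn_integral_kernel_pow_add:
  assumes "f \<in> borel_measurable borel"
  shows "(\<integral>\<^sup>+z. f z \<partial>kernel_pow P (m + n) x) = (\<integral>\<^sup>+y. (\<integral>\<^sup>+z. f z \<partial>kernel_pow P n y) \<partial>kernel_pow P m x)"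
  unfolding kernel_pow_add by (rule nn_integral_bind[OF assms]) auto

lemma nn_integral_kernel_pow_Suc:
  assumes "f \<in> borel_measurable borel"
  shows "(\<integral>\<^sup>+z. f z \<partial>kernel_pow P (Suc n) x) = (\<integral>\<^sup>+y. (\<integral>\<^sup>+z. f z \<partial>kernel_pow P n y) \<partial>P x)"
  by (simp, rule nn_integral_bind[OF assms]) auto

lemma emeasure_kernel_pow_add:
  assumes "A \<in> sets borel"
  shows "emeasure (kernel_pow P (m + n) x) A = (\<integral>\<^sup>+y. emeasure (kernel_pow P n y) A \<partial>kernel_pow P m x)"
  unfolding kernel_pow_add using assms by (intro emeasure_bind) auto

lemma kernel_pow_1: "kernel_pow P (Suc 0) x = P x"
proof -
  have "kernel_pow P (Suc 0) x = P x \<bind> return borel"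
    by (simp cong: bind_cong)
  also have "\<dots> = P x"
    by (rule bind_return'') simp
  finally show ?thesis .
qed

lemma stationary_bind:
  assumes "stationary_distribution P \<mu>"
  shows "\<mu> \<bind> kernel_pow P n = \<mu>"
proof (induction n)
  note s = stationary_distributionD(1)[OF assms] and sp = stationary_distributionD(2)[OF assms]
  note [measurable_cong] = s
  have "\<mu> \<bind> kernel_pow P 0 = \<mu> \<bind> return borel"
    by (simp cong: bind_cong)
  also have "\<dots> = \<mu>"
    by (rule bind_return'') (simp add: s)
  finally show "\<mu> \<bind> kernel_pow P 0 = \<mu>" .
  fix n
  assume IH: "\<mu> \<bind> kernel_pow P n = \<mu>"
  have m: "P \<in> \<mu> \<rightarrow>\<^sub>M subprob_algebra borel" by measurable
  have 1: "\<mu> \<bind> P = \<mu>"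
  proof (rule measure_eqI)
    show ss: "sets (\<mu> \<bind> P) = sets \<mu>"
      by (subst sets_bind[where N=borel]) (auto simp: s sp)
    fix A assume "A \<in> sets (\<mu> \<bind> P)"
    then have A: "A \<in> sets borel" using ss s by simp
    have "emeasure (\<mu> \<bind> P) A = (\<integral>\<^sup>+x. emeasure (P x) A \<partial>\<mu>)"
      by (rule emeasure_bind[OF _ m A]) (simp add: sp)
    also have "\<dots> = emeasure \<mu> A"
      using A assms by (simp add: stationary_distribution_def)
    finally show "emeasure (\<mu> \<bind> P) A = emeasure \<mu> A" .
  qed
  have "\<mu> \<bind> kernel_pow P (Suc n) = \<mu> \<bind> (\<lambda>x. P x \<bind> kernel_pow P n)"
    by (simp cong: bind_cong)
  also have "\<dots> = (\<mu> \<bind> P) \<bind> kernel_pow P n"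
    by (rule bind_assoc[symmetric, OF m, where R=borel]) auto
  finally show "\<mu> \<bind> kernel_pow P (Suc n) = \<mu>"
    using 1 IH by simp
qed

end

section \<open>Geometric convergence from drift and minorization\<close>

text \<open>Every value of \<open>f - w\<close> lies below every value of \<open>f + w\<close>, so
  the supremum of the former separates the two. This is the duality behind the contraction argument:
  a bound on weighted differences is a weighted supremum bound modulo constants.\<close>

lemma centre_of_oscillation:
  fixes f w :: "'a \<Rightarrow> real"
  assumes "\<And>x y. f x - f y \<le> w x + w y"
  shows "\<exists>c. \<forall>x. \<bar>f x - c\<bar> \<le> w x"
proof -
  have b: "f x - w x \<le> f y + w y" for x y
    using assms[of x y] by simp
  have "bdd_above (range (\<lambda>x. f x - w x))"
    using b[of _ undefined] by (intro bdd_aboveI[where M="f undefined + w undefined"]) auto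
  then have "f x - w x \<le> (SUP x. f x - w x)" for x
    by (intro cSUP_upper) auto
  moreover have "(SUP x. f x - w x) \<le> f y + w y" for y
    using b by (intro cSUP_least) auto
  ultimately show ?thesis
    by (intro exI[of _ "SUP x. f x - w x"]) (auto simp: abs_le_iff algebra_simps)
qed

lemma integral_le_of_minorant:
  fixes k :: "'a \<Rightarrow> real"
  assumes "sets N = sets M" "\<And>A. A \<in> sets M \<Longrightarrow> emeasure N A \<le> emeasure M A"
    and k: "integrable M k" "\<And>x. 0 \<le> k x"
  shows "integrable N k" "(\<integral>x. k x \<partial>N) \<le> (\<integral>x. k x \<partial>M)"
proof -
  have "N \<le> M"
    using assms(1,2) sets_eq_imp_space_eq[OF assms(1)]
    by (subst le_measure) (auto simp: le_fun_def intro: le_measure_iff[THEN iffD2])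
  have le: "(\<integral>\<^sup>+x. ennreal (k x) \<partial>N) \<le> (\<integral>\<^sup>+x. ennreal (k x) \<partial>M)"
    by (rule nn_integral_mono_measure[OF assms(1) \<open>N \<le> M\<close>])
  have fin: "(\<integral>\<^sup>+x. ennreal (k x) \<partial>M) < \<infinity>"
    using k by (simp add: integrable_iff_bounded)
  have meas: "k \<in> borel_measurable N"
    using k(1) assms(1) by (simp add: borel_measurable_integrable cong: measurable_cong_sets)
  show "integrable N k"
    using meas le fin k(2) by (simp add: integrable_iff_bounded)
  show "(\<integral>x. k x \<partial>N) \<le> (\<integral>x. k x \<partial>M)"
    using le fin k meas by (simp add: integral_eq_nn_integral enn2real_mono)
qed

text \<open>The weight \<open>\<beta>\<close> is chosen as in Hairer and Mattingly: small enough that the mass \<open>\<nu>(UNIV)\<close>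
  coupled on a sublevel set outweighs the additive drift constant.\<close>

lemma weighted_contraction:
  fixes Q :: "'a::topological_space \<Rightarrow> 'a measure" and V :: "'a \<Rightarrow> real"
  assumes Q: "\<And>x. sets (Q x) = sets borel" "\<And>x. prob_space (Q x)"
    and V[measurable]: "V \<in> borel_measurable borel" "\<And>x. 0 \<le> V x"
    and drift: "\<And>x. integrable (Q x) V" "\<And>x. (\<integral>y. V y \<partial>Q x) \<le> \<gamma> * V x + K"
    and \<gamma>: "0 \<le> \<gamma>" "\<gamma> < 1" and K: "0 < K"
    and \<nu>: "sets \<nu> = sets borel" "emeasure \<nu> UNIV > 0"
    and minor: "\<And>x A. V x \<le> R \<Longrightarrow> A \<in> sets borel \<Longrightarrow> emeasure \<nu> A \<le> emeasure (Q x) A"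
    and R: "2 * K / (1 - \<gamma>) < R"
  shows "\<exists>\<beta>>0. \<exists>a>0. a < 1 \<and> (\<forall>g c b. g \<in> borel_measurable borel \<longrightarrow> 0 \<le> b \<longrightarrow>
     (\<forall>x. \<bar>g x - c\<bar> \<le> b * (1 + \<beta> * V x)) \<longrightarrow>
     (\<exists>c'. \<forall>x. \<bar>(\<integral>y. g y \<partial>Q x) - c'\<bar> \<le> a * b * (1 + \<beta> * V x)))"
proof -
  have [measurable_cong]: "sets (Q x) = sets borel" for x by (rule Q)
  have [measurable_cong]: "sets \<nu> = sets borel" by (rule \<nu>)
  have spQ: "space (Q x) = UNIV" for x using sets_eq_imp_space_eq[OF Q(1)] by simp
  have sp\<nu>: "space \<nu> = UNIV" using sets_eq_imp_space_eq[OF \<nu>(1)] by simp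
  \<comment> \<open>Minorization bounds the mass of \<nu> by 1 only if some point satisfies
    \<open>V x \<le> R\<close>. The cap keeps \<alpha> in (0, 1] even if there is no such point and
    the mass is large or infinite.\<close>
  define \<alpha> where "\<alpha> = (if emeasure \<nu> UNIV < 1 then measure \<nu> UNIV else 1)"
  have \<alpha>: "0 < \<alpha>" "\<alpha> \<le> 1"
    using \<nu>(2) by (auto simp: \<alpha>_def measure_def enn2real_positive_iff less_top
        intro!: enn2real_leI dest: less_imp_le intro: less_trans[OF _ ennreal_one_less_top])
  \<comment> \<open>Chosen so that the drift constants of two points add up to
    \<open>\<beta> * 2 * K = \<alpha>\<close>, half of the gain \<open>2 * \<alpha>\<close> from
    coupling.\<close>
  define \<beta> where "\<beta> = \<alpha> / (2 * K)"
  have \<beta>: "\<beta> > 0" using \<alpha> K by (simp add: \<beta>_def)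
  have R0: "R > 0" using R K \<gamma> by (smt (verit) divide_nonneg_pos)
  \<comment> \<open>If \<open>v \<ge> R\<close> then
    \<open>\<gamma> * v + 2 * K \<le> \<gamma>' * v\<close>: the additive constant is absorbed far
    out, and \<gamma>' < 1 is exactly the condition on \<open>R\<close>.\<close>
  define \<gamma>' where "\<gamma>' = \<gamma> + 2 * K / R"
  have "2 * K / R < 1 - \<gamma>" using R R0 \<gamma> by (simp add: field_simps)
  then have \<gamma>': "0 \<le> \<gamma>'" "\<gamma>' < 1" "\<gamma> \<le> \<gamma>'" using \<gamma> K R0 by (auto simp: \<gamma>'_def)
  \<comment> \<open>The quotient is the value at \<open>v = R\<close> of (2 + \<beta> \<gamma>' v) /
    (2 + \<beta> v), which decreases in \<open>v\<close>; it handles distant pairs. The other two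
    entries handle the constant and the \<open>V\<close> part for pairs in the sublevel set.\<close>
  define a where "a = max (max ((2 + \<beta> * R * \<gamma>') / (2 + \<beta> * R)) (1 - \<alpha> / 2)) \<gamma>"
  have "\<beta> * R * \<gamma>' < \<beta> * R * 1"
    using \<beta> R0 \<gamma>' by (intro mult_strict_left_mono) auto
  then have "(2 + \<beta> * R * \<gamma>') / (2 + \<beta> * R) < 1"
    using \<beta> R0 by (simp add: divide_less_eq add_pos_pos)
  then have a: "a > 0" "a < 1"
    using \<gamma>' \<gamma> \<beta> R0 \<alpha> by (auto simp: a_def less_max_iff_disj)
  have main: "\<exists>c'. \<forall>x. \<bar>(\<integral>y. g y \<partial>Q x) - c'\<bar> \<le> a * b * (1 + \<beta> * V x)"
    if g[measurable]: "g \<in> borel_measurable borel" and b: "0 \<le> b"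
      and gb: "\<And>x. \<bar>g x - c\<bar> \<le> b * (1 + \<beta> * V x)" for g b c
  proof (rule centre_of_oscillation)
    fix x y
    define W where "W x = b * (1 + \<beta> * V x)" for x
    define h where "h x = g x - c" for x
    have hW: "\<bar>h x\<bar> \<le> W x" for x using gb by (simp add: h_def W_def)
    have [measurable]: "W \<in> borel_measurable borel" "h \<in> borel_measurable borel"
      by (auto simp: W_def[abs_def] h_def[abs_def])
    interpret prob_space "Q z" for z by (rule Q)
    have iW: "integrable (Q z) W" for z
      using drift(1)[of z] unfolding W_def[abs_def] by (intro integrable_mult_right integrable_add integrable_const) auto
    have W0: "0 \<le> W z" for z using b V(2) \<beta> by (simp add: W_def)
    have ih: "integrable (Q z) h" for z
      by (rule Bochner_Integration.integrable_bound[OF iW[of z]]) (use hW W0 in auto)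
    have ig: "integrable (Q z) g" for z
    proof -
      have "integrable (Q z) (\<lambda>x. h x + c)" using ih by auto
      then show ?thesis by (simp add: h_def)
    qed
    have hg: "(\<integral>y. h y \<partial>Q z) = (\<integral>y. g y \<partial>Q z) - c" for z
      unfolding h_def using ig by (simp add: prob_space)
    have TW: "(\<integral>y. W y \<partial>Q z) \<le> b * (1 + \<beta> * (\<gamma> * V z + K))" for z
    proof -
      have "(\<integral>y. W y \<partial>Q z) = b * (1 + \<beta> * (\<integral>y. V y \<partial>Q z))"
        unfolding W_def using drift(1)[of z] by (simp add: prob_space)
      then show ?thesis using drift(2)[of z] b \<beta> by (simp add: mult_left_mono)
    qed
    have Th: "\<bar>\<integral>y. h y \<partial>Q z\<bar> \<le> (\<integral>y. W y \<partial>Q z)" for z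
      by (rule order_trans[OF integral_abs_bound integral_mono[OF integrable_abs[OF ih] iW hW]])
    have "(\<integral>y. h y \<partial>Q x) - (\<integral>y. h y \<partial>Q y) \<le> a * b * (2 + \<beta> * (V x + V y))"
    proof (cases "V x + V y \<le> R")
      case False
      define v where "v = V x + V y"
      have v: "v > R" using False by (simp add: v_def)
      have 1: "2 + \<beta> * (\<gamma> * v + 2 * K) \<le> 2 + \<beta> * (\<gamma>' * v)"
        using v R0 K \<beta> by (simp add: \<gamma>'_def field_simps)
      have "(2 + \<beta> * \<gamma>' * v) * (2 + \<beta> * R) \<le> (2 + \<beta> * R * \<gamma>') * (2 + \<beta> * v)"
      proof -
        have "(2 + \<beta> * R * \<gamma>') * (2 + \<beta> * v) - (2 + \<beta> * \<gamma>' * v) * (2 + \<beta> * R) = 2 * \<beta> * (1 - \<gamma>') * (v - R)"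
          by (simp add: algebra_simps)
        also have "\<dots> \<ge> 0" using \<beta> \<gamma>' v by simp
        finally show ?thesis by simp
      qed
      then have "2 + \<beta> * \<gamma>' * v \<le> (2 + \<beta> * R * \<gamma>') / (2 + \<beta> * R) * (2 + \<beta> * v)"
        using \<beta> R0 by (simp add: field_simps add_pos_pos)
      also have "\<dots> \<le> a * (2 + \<beta> * v)"
        using \<beta> R0 v by (intro mult_right_mono) (auto simp: a_def)
      finally have 2: "2 + \<beta> * (\<gamma> * v + 2 * K) \<le> a * (2 + \<beta> * v)"
        using 1 by (simp add: algebra_simps)
      have "(\<integral>y. h y \<partial>Q x) - (\<integral>y. h y \<partial>Q y) \<le> b * (2 + \<beta> * (\<gamma> * v + 2 * K))"
        using Th[of x] Th[of y] TW[of x] TW[of y] by (simp add: v_def algebra_simps)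
      also have "\<dots> \<le> b * (a * (2 + \<beta> * v))" using 2 b by (rule mult_left_mono)
      finally show ?thesis by (simp add: v_def algebra_simps)
    next
      case True
      then have Vxy: "V x \<le> R" "V y \<le> R" using V(2)[of x] V(2)[of y] by auto
      have m: "integrable \<nu> k" "(\<integral>y. k y \<partial>\<nu>) \<le> (\<integral>y. k y \<partial>Q z)"
        if "V z \<le> R" "integrable (Q z) k" "\<And>x. 0 \<le> k x" for z and k :: "'a \<Rightarrow> real"
        using integral_le_of_minorant[of \<nu> "Q z" k] that minor Q \<nu> by auto
      have 1: "integrable (Q z) (\<lambda>y. W y - h y)" "integrable (Q z) (\<lambda>y. W y + h y)" for z
        using iW ih by auto
      have 2: "0 \<le> W y - h y" "0 \<le> W y + h y" for y
        using hW[of y] by (auto simp: abs_le_iff)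
      \<comment> \<open>Coupling without a coupling: \<nu> lies below both \<open>Q x\<close> and
        \<open>Q y\<close>, so the integrals of the nonnegative \<open>W - h\<close> under
        \<open>Q x\<close> and of \<open>W + h\<close> under \<open>Q y\<close> are at least those
        under \<nu>. These sum to twice the \<nu>-integral of \<open>W\<close>, from which
        \<open>h\<close> has disappeared.\<close>
      note A = m(2)[OF Vxy(1) 1(1) 2(1)] and B = m(2)[OF Vxy(2) 1(2) 2(2)]
        and i\<nu> = m(1)[OF Vxy(1) 1(1) 2(1)] m(1)[OF Vxy(2) 1(2) 2(2)]
      have finm: "emeasure \<nu> UNIV \<le> 1"
        using minor[OF Vxy(1), of UNIV] emeasure_space_1[of x] by (simp add: spQ)
      have mu: "measure \<nu> UNIV \<ge> \<alpha>"
      proof (cases "emeasure \<nu> UNIV < 1")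
        case False
        then have "emeasure \<nu> UNIV = 1" using finm by simp
        then show ?thesis by (simp add: \<alpha>_def measure_def)
      qed (simp add: \<alpha>_def)
      interpret \<nu>: finite_measure \<nu>
        by (rule finite_measureI) (use le_less_trans[OF finm ennreal_one_less_top] sp\<nu> in auto)
      have "(\<integral>y. 2 * b \<partial>\<nu>) \<le> (\<integral>y. (W y - h y) + (W y + h y) \<partial>\<nu>)"
      proof (rule integral_mono)
        show "integrable \<nu> (\<lambda>y. (W y - h y) + (W y + h y))"
          by (rule Bochner_Integration.integrable_add[OF i\<nu>])
        show "2 * b \<le> (W y - h y) + (W y + h y)" for y
          using \<beta> V(2)[of y] b by (simp add: W_def distrib_left)
      qed simp
      also have "\<dots> = (\<integral>y. W y - h y \<partial>\<nu>) + (\<integral>y. W y + h y \<partial>\<nu>)"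
        by (rule Bochner_Integration.integral_add[OF i\<nu>])
      finally have "measure \<nu> UNIV * (2 * b) \<le> (\<integral>y. W y - h y \<partial>\<nu>) + (\<integral>y. W y + h y \<partial>\<nu>)"
        by (simp add: sp\<nu>)
      moreover have "\<alpha> * (2 * b) \<le> measure \<nu> UNIV * (2 * b)"
        using mu b by (intro mult_right_mono) auto
      ultimately have "2 * b * \<alpha> \<le> (\<integral>y. W y - h y \<partial>\<nu>) + (\<integral>y. W y + h y \<partial>\<nu>)"
        by (simp only: mult.commute)
      also have "\<dots> \<le> (\<integral>y. W y \<partial>Q x) - (\<integral>y. h y \<partial>Q x) + (\<integral>y. W y \<partial>Q y) + (\<integral>y. h y \<partial>Q y)"
        using A B iW ih by simp
      finally have "(\<integral>y. h y \<partial>Q x) - (\<integral>y. h y \<partial>Q y) \<le> b * (2 + \<beta> * (\<gamma> * (V x + V y) + 2 * K)) - 2 * b * \<alpha>"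
        using TW[of x] TW[of y] by (simp add: algebra_simps)
      also have "\<dots> = b * (2 * (1 - \<alpha> / 2) + \<gamma> * (\<beta> * (V x + V y)))"
        using K by (simp add: \<beta>_def field_simps)
      also have "\<dots> \<le> b * (2 * a + a * (\<beta> * (V x + V y)))"
        using b \<beta> V(2) by (intro mult_left_mono add_mono mult_right_mono) (auto simp: a_def)
      finally show ?thesis by (simp add: algebra_simps)
    qed
    then show "(\<integral>z. g z \<partial>Q x) - (\<integral>z. g z \<partial>Q y) \<le> a * b * (1 + \<beta> * V x) + a * b * (1 + \<beta> * V y)"
      using hg[of x] hg[of y] by (simp add: algebra_simps)
  qed
  show ?thesis
    using \<beta> a main by blast
qed

context markov_kernel
begin

lemma integral_kernel_pow_add:
  fixes f :: "'a \<Rightarrow> real"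
  assumes f: "f \<in> borel_measurable borel" "\<And>y. integrable (kernel_pow P n y) f"
    and i: "integrable (kernel_pow P (m + n) x) f"
  shows "integral\<^sup>L (kernel_pow P (m + n) x) f = (\<integral>y. integral\<^sup>L (kernel_pow P n y) f \<partial>kernel_pow P m x)"
    and "integrable (kernel_pow P m x) (\<lambda>y. integral\<^sup>L (kernel_pow P n y) f)"
proof -
  have N: "kernel_pow P n \<in> kernel_pow P m x \<rightarrow>\<^sub>M subprob_algebra borel" by measurable
  note * = integral_bind_integrable[OF N _ f(1) f(2), folded kernel_pow_add, OF _ i]
  show "integral\<^sup>L (kernel_pow P (m + n) x) f = (\<integral>y. integral\<^sup>L (kernel_pow P n y) f \<partial>kernel_pow P m x)"
    "integrable (kernel_pow P m x) (\<lambda>y. integral\<^sup>L (kernel_pow P n y) f)"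
    using * by auto
qed

lemma integral_stationary:
  fixes f :: "'a \<Rightarrow> real"
  assumes \<mu>: "stationary_distribution P \<mu>"
    and f: "f \<in> borel_measurable borel" "\<And>y. integrable (kernel_pow P n y) f" "integrable \<mu> f"
  shows "(\<integral>y. integral\<^sup>L (kernel_pow P n y) f \<partial>\<mu>) = integral\<^sup>L \<mu> f"
    and "integrable \<mu> (\<lambda>y. integral\<^sup>L (kernel_pow P n y) f)"
proof -
  note s = stationary_distributionD(1)[OF \<mu>] and sp = stationary_distributionD(2)[OF \<mu>]
  note [measurable_cong] = s
  have N: "kernel_pow P n \<in> \<mu> \<rightarrow>\<^sub>M subprob_algebra borel" by measurable
  note * = integral_bind_integrable[OF N _ f(1) f(2), unfolded stationary_bind[OF \<mu>], OF _ f(3)]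
  show "(\<integral>y. integral\<^sup>L (kernel_pow P n y) f \<partial>\<mu>) = integral\<^sup>L \<mu> f"
    "integrable \<mu> (\<lambda>y. integral\<^sup>L (kernel_pow P n y) f)"
    using * sp by auto
qed

text \<open>\<open>K / (1 - \<gamma>)\<close> is the fixed point of v \<mapsto> \<gamma> v + K, so
  the induction reproduces it unchanged.\<close>

lemma drift_kernel_pow:
  fixes V :: "'a \<Rightarrow> real"
  assumes [measurable]: "V \<in> borel_measurable borel" and V0: "\<And>x. 0 \<le> V x"
    and drift: "\<And>x. (\<integral>\<^sup>+y. ennreal (V y) \<partial>P x) \<le> ennreal (\<gamma> * V x + K)"
    and \<gamma>: "0 \<le> \<gamma>" "\<gamma> < 1" and K: "0 \<le> K"
  shows "(\<integral>\<^sup>+y. ennreal (V y) \<partial>kernel_pow P n x) \<le> ennreal (\<gamma> ^ n * V x + K / (1 - \<gamma>))"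
proof (induction n)
  case 0
  have "0 \<le> K / (1 - \<gamma>)" using K \<gamma> by simp
  then show ?case by (simp add: nn_integral_return ennreal_leI)
next
  case (Suc n)
  interpret prob_space "kernel_pow P n x" by (rule prob_space_kernel_pow)
  have K': "0 \<le> K / (1 - \<gamma>)" using K \<gamma> by simp
  have eq: "ennreal (\<gamma> * v + K) = ennreal \<gamma> * ennreal v + ennreal K" if "0 \<le> v" for v
    using that \<gamma> K by (simp add: ennreal_mult)
  have "(\<integral>\<^sup>+y. ennreal (V y) \<partial>kernel_pow P (Suc n) x) =
      (\<integral>\<^sup>+y. (\<integral>\<^sup>+z. ennreal (V z) \<partial>P y) \<partial>kernel_pow P n x)"
    using nn_integral_kernel_pow_add[of "\<lambda>y. ennreal (V y)" n "Suc 0" x] by (simp add: kernel_pow_1 del: kernel_pow.simps)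
  also have "\<dots> \<le> (\<integral>\<^sup>+y. ennreal \<gamma> * ennreal (V y) + ennreal K \<partial>kernel_pow P n x)"
    using drift eq[OF V0] by (intro nn_integral_mono) simp
  also have "\<dots> = ennreal \<gamma> * (\<integral>\<^sup>+y. ennreal (V y) \<partial>kernel_pow P n x) + ennreal K"
    using emeasure_space_1 by (simp add: nn_integral_add nn_integral_cmult)
  also have "\<dots> \<le> ennreal \<gamma> * ennreal (\<gamma> ^ n * V x + K / (1 - \<gamma>)) + ennreal K"
    using Suc by (intro add_mono mult_left_mono) auto
  also have "\<dots> = ennreal (\<gamma> * (\<gamma> ^ n * V x + K / (1 - \<gamma>)) + K)"
    using \<gamma> V0 K' by (intro eq[symmetric]) simp
  also have "\<gamma> * (\<gamma> ^ n * V x + K / (1 - \<gamma>)) + K = \<gamma> ^ Suc n * V x + K / (1 - \<gamma>)"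
    using \<gamma> by (simp add: field_simps)
  finally show ?case .
qed

text \<open>Truncating \<open>V\<close> at \<open>M\<close> makes both sides of the stationarity identity finite, and the factor
  \<open>\<gamma>\<^sup>n\<close> kills the contribution of the starting point before \<open>M\<close> is removed.\<close>

lemma drift_stationary:
  fixes V :: "'a \<Rightarrow> real"
  assumes V[measurable]: "V \<in> borel_measurable borel" and V0: "\<And>x. 0 \<le> V x"
    and drift: "\<And>x. (\<integral>\<^sup>+y. ennreal (V y) \<partial>P x) \<le> ennreal (\<gamma> * V x + K)"
    and \<gamma>: "0 \<le> \<gamma>" "\<gamma> < 1" and K: "0 \<le> K"
    and \<mu>: "stationary_distribution P \<mu>"
  shows "(\<integral>\<^sup>+y. ennreal (V y) \<partial>\<mu>) \<le> ennreal (K / (1 - \<gamma>))"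
proof -
  note s = stationary_distributionD(1)[OF \<mu>] and sp = stationary_distributionD(2)[OF \<mu>]
    and p = stationary_distributionD(3)[OF \<mu>]
  note [measurable_cong] = s
  interpret prob_space \<mu> by (rule p)
  have trunc: "(\<integral>\<^sup>+y. min (ennreal (V y)) (of_nat M) \<partial>\<mu>) \<le> ennreal (K / (1 - \<gamma>))" for M
  proof -
    let ?u = "\<lambda>n x. min (ennreal (\<gamma> ^ n * V x + K / (1 - \<gamma>))) (of_nat M)"
    have 1: "(\<integral>\<^sup>+y. min (ennreal (V y)) (of_nat M) \<partial>\<mu>) \<le> (\<integral>\<^sup>+x. ?u n x \<partial>\<mu>)" for n
    proof -
      have "(\<integral>\<^sup>+y. min (ennreal (V y)) (of_nat M) \<partial>\<mu>) =
          (\<integral>\<^sup>+y. min (ennreal (V y)) (of_nat M) \<partial>(\<mu> \<bind> kernel_pow P n))"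
        by (simp add: stationary_bind[OF \<mu>])
      also have "\<dots> = (\<integral>\<^sup>+x. (\<integral>\<^sup>+y. min (ennreal (V y)) (of_nat M) \<partial>kernel_pow P n x) \<partial>\<mu>)"
        by (rule nn_integral_bind[where B=borel]) auto
      also have "\<dots> \<le> (\<integral>\<^sup>+x. ?u n x \<partial>\<mu>)"
      proof (intro nn_integral_mono min.boundedI)
        fix x
        interpret k: prob_space "kernel_pow P n x" by (rule prob_space_kernel_pow)
        show "(\<integral>\<^sup>+y. min (ennreal (V y)) (of_nat M) \<partial>kernel_pow P n x) \<le> ennreal (\<gamma> ^ n * V x + K / (1 - \<gamma>))"
          by (rule order_trans[OF nn_integral_mono drift_kernel_pow[OF V V0 drift \<gamma> K]]) auto
        have "(\<integral>\<^sup>+y. min (ennreal (V y)) (of_nat M) \<partial>kernel_pow P n x) \<le> (\<integral>\<^sup>+y. of_nat M \<partial>kernel_pow P n x)"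
          by (intro nn_integral_mono) auto
        then show "(\<integral>\<^sup>+y. min (ennreal (V y)) (of_nat M) \<partial>kernel_pow P n x) \<le> of_nat M"
          using k.emeasure_space_1 by simp
      qed
      finally show ?thesis .
    qed
    have "(\<lambda>n. \<integral>\<^sup>+x. ?u n x \<partial>\<mu>) \<longlonglongrightarrow> (\<integral>\<^sup>+x. min (ennreal (K / (1 - \<gamma>))) (of_nat M) \<partial>\<mu>)"
    proof (rule nn_integral_dominated_convergence[where w="\<lambda>_. of_nat M"])
      have "(\<lambda>n. min (ennreal (\<gamma> ^ n * V x + K / (1 - \<gamma>))) (of_nat M))
          \<longlonglongrightarrow> min (ennreal (0 * V x + K / (1 - \<gamma>))) (of_nat M)" for x
        using \<gamma> by (intro tendsto_min tendsto_ennrealI tendsto_intros LIMSEQ_power_zero) auto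
      then show "AE x in \<mu>. (\<lambda>n. ?u n x) \<longlonglongrightarrow> min (ennreal (K / (1 - \<gamma>))) (of_nat M)"
        by simp
    qed (use emeasure_space_1 in \<open>auto simp: less_top[symmetric]\<close>)
    from LIMSEQ_le_const[OF this] 1
    have "(\<integral>\<^sup>+y. min (ennreal (V y)) (of_nat M) \<partial>\<mu>) \<le> (\<integral>\<^sup>+x. min (ennreal (K / (1 - \<gamma>))) (of_nat M) \<partial>\<mu>)"
      by blast
    also have "\<dots> \<le> (\<integral>\<^sup>+x. ennreal (K / (1 - \<gamma>)) \<partial>\<mu>)" by (intro nn_integral_mono) auto
    finally show ?thesis using emeasure_space_1 by simp
  qed
  have "(\<integral>\<^sup>+y. ennreal (V y) \<partial>\<mu>) = (\<integral>\<^sup>+y. (SUP M. min (ennreal (V y)) (of_nat M)) \<partial>\<mu>)"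
  proof (intro nn_integral_cong antisym)
    fix y
    obtain M :: nat where "V y \<le> real M" using real_arch_simple by blast
    then have "ennreal (V y) \<le> of_nat M" by (simp add: ennreal_leI flip: ennreal_of_nat_eq_real_of_nat)
    then have "ennreal (V y) = min (ennreal (V y)) (of_nat M)" by simp
    also have "\<dots> \<le> (SUP M. min (ennreal (V y)) (of_nat M))" by (rule SUP_upper) simp
    finally show "ennreal (V y) \<le> (SUP M. min (ennreal (V y)) (of_nat M))" .
  qed (auto intro: SUP_least)
  also have "\<dots> = (SUP M. \<integral>\<^sup>+y. min (ennreal (V y)) (of_nat M) \<partial>\<mu>)"
    by (intro nn_integral_monotone_convergence_SUP) (auto simp: incseq_def le_fun_def intro: min.coboundedI2)
  also have "\<dots> \<le> ennreal (K / (1 - \<gamma>))" using trunc by (intro SUP_least) auto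
  finally show ?thesis .
qed

text \<open>The contraction applies to the skeleton of period \<open>n0\<close>. Iterating it
  confines the conditional means of a test function to a shrinking weighted neighbourhood of some
  constant \<open>c\<close>; both the mean after \<open>n\<close> steps and the stationary mean are
  then close to this same \<open>c\<close>. The rate is common to all starting points and only
  \<open>C\<close> depends on \<open>x\<close>.\<close>

theorem geometric_convergence:
  fixes V :: "'a \<Rightarrow> real"
  assumes V[measurable]: "V \<in> borel_measurable borel" and V0: "\<And>x. 0 \<le> V x"
    and drift: "\<And>x. (\<integral>\<^sup>+y. ennreal (V y) \<partial>P x) \<le> ennreal (\<gamma> * V x + K)"
    and \<gamma>: "0 \<le> \<gamma>" "\<gamma> < 1" and K: "0 < K"
    and minor: "\<And>R. \<exists>n\<ge>1. \<exists>\<nu>. sets \<nu> = sets borel \<and> emeasure \<nu> UNIV > 0 \<and>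
      (\<forall>x A. V x \<le> R \<longrightarrow> A \<in> sets borel \<longrightarrow> emeasure \<nu> A \<le> emeasure (kernel_pow P n x) A)"
    and \<mu>: "stationary_distribution P \<mu>"
  shows "\<exists>\<rho>>0. \<rho> < 1 \<and> (\<forall>x. \<exists>C. \<forall>n. \<forall>g. g \<in> borel_measurable borel \<longrightarrow> (\<forall>y. \<bar>g y\<bar> \<le> 1 + V y) \<longrightarrow>
    \<bar>integral\<^sup>L (kernel_pow P n x) g - integral\<^sup>L \<mu> g\<bar> \<le> C * \<rho> ^ n)"
proof -
  note s = stationary_distributionD(1)[OF \<mu>] and sp = stationary_distributionD(2)[OF \<mu>]
    and p = stationary_distributionD(3)[OF \<mu>]
  note [measurable_cong] = s
  interpret \<mu>: prob_space \<mu> by (rule p)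
  define K' where "K' = K / (1 - \<gamma>)"
  have K': "0 < K'" using K \<gamma> by (simp add: K'_def)
  have nnV: "(\<integral>\<^sup>+y. ennreal (V y) \<partial>kernel_pow P n x) \<le> ennreal (\<gamma> ^ n * V x + K')" for n x
    unfolding K'_def using V V0 drift \<gamma> K by (intro drift_kernel_pow) auto
  have nn\<mu>: "(\<integral>\<^sup>+y. ennreal (V y) \<partial>\<mu>) \<le> ennreal K'"
    unfolding K'_def using V V0 drift \<gamma> K \<mu> by (intro drift_stationary) auto
  have int: "integrable M V" "integral\<^sup>L M V \<le> B"
    if "(\<integral>\<^sup>+y. ennreal (V y) \<partial>M) \<le> ennreal B" "sets M = sets borel" "0 \<le> B" for M B
  proof -
    have "V \<in> borel_measurable M" using V that(2) by (simp cong: measurable_cong_sets)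
    moreover have "(\<integral>\<^sup>+y. ennreal (V y) \<partial>M) < \<infinity>" using that(1) by (auto intro: le_less_trans)
    ultimately show "integrable M V" using V0 by (simp add: integrable_iff_bounded)
    then show "integral\<^sup>L M V \<le> B"
      using that V0 by (simp add: integral_eq_nn_integral borel_measurable_integrable enn2real_leI)
  qed
  have iV: "integrable (kernel_pow P n x) V" and bV: "integral\<^sup>L (kernel_pow P n x) V \<le> \<gamma> ^ n * V x + K'" for n x
    using int[OF nnV] \<gamma> V0 K' by auto
  have i\<mu>V: "integrable \<mu> V" and b\<mu>V: "integral\<^sup>L \<mu> V \<le> K'"
    using int[OF nn\<mu> s] K' by auto
  define R where "R = 2 * K' / (1 - \<gamma>) + 1"
  obtain n0 \<nu> where n0: "n0 \<ge> 1" and \<nu>: "sets \<nu> = sets borel" "emeasure \<nu> UNIV > 0"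
    and \<nu>P: "\<And>x A. V x \<le> R \<Longrightarrow> A \<in> sets borel \<Longrightarrow> emeasure \<nu> A \<le> emeasure (kernel_pow P n0 x) A"
    using minor[of R] by blast
  \<comment> \<open>As \<open>n0 \<ge> 1\<close>, the skeleton obeys a drift inequality with the
    same \<gamma> and with \<open>K'\<close> in place of \<open>K\<close>.\<close>
  have gn0: "\<gamma> ^ n0 \<le> \<gamma>" using power_decreasing[of 1 n0 \<gamma>] n0 \<gamma> by simp
  have bV0: "integral\<^sup>L (kernel_pow P n0 x) V \<le> \<gamma> * V x + K'" for x
    using bV[of n0 x] mult_right_mono[OF gn0 V0[of x]] by linarith
  have R': "2 * K' / (1 - \<gamma>) < R" by (simp add: R_def)
  have "\<exists>\<beta>>0. \<exists>a>0. a < 1 \<and> (\<forall>g c b. g \<in> borel_measurable borel \<longrightarrow> 0 \<le> b \<longrightarrow>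
     (\<forall>x. \<bar>g x - c\<bar> \<le> b * (1 + \<beta> * V x)) \<longrightarrow>
     (\<exists>c'. \<forall>x. \<bar>(\<integral>y. g y \<partial>kernel_pow P n0 x) - c'\<bar> \<le> a * b * (1 + \<beta> * V x)))"
    by (rule weighted_contraction[OF sets_kernel_pow prob_space_kernel_pow V V0 iV bV0 \<gamma> K' \<nu> _ R'])
      (rule \<nu>P)
  then obtain \<beta> a where \<beta>: "\<beta> > 0" and a: "0 < a" "a < 1" and contr:
    "\<forall>g c b. g \<in> borel_measurable borel \<longrightarrow> 0 \<le> b \<longrightarrow> (\<forall>x. \<bar>g x - c\<bar> \<le> b * (1 + \<beta> * V x)) \<longrightarrow>
     (\<exists>c'. \<forall>x. \<bar>(\<integral>y. g y \<partial>kernel_pow P n0 x) - c'\<bar> \<le> a * b * (1 + \<beta> * V x))"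
    by (elim exE conjE) (rule that)
  \<comment> \<open>Gives \<open>1 + V \<le> b0 * (1 + \<beta> * V)\<close>, which translates the
    given weight into the one contracted.\<close>
  define b0 where "b0 = max 1 (1 / \<beta>)"
  have b0: "b0 \<ge> 1" "b0 * \<beta> \<ge> 1"
    using \<beta> by (auto simp: b0_def max_def field_simps)
  define \<rho> where "\<rho> = a powr (1 / n0)"
  have \<rho>: "0 < \<rho>" "\<rho> < 1"
    using a n0 powr_less_mono2[of "1 / n0" a 1] by (auto simp: \<rho>_def)
  have "\<bar>integral\<^sup>L (kernel_pow P n x) g - integral\<^sup>L \<mu> g\<bar> \<le> b0 * (2 + \<beta> * (V x + 2 * K')) / a * \<rho> ^ n"
    if g[measurable]: "g \<in> borel_measurable borel" and gV: "\<And>y. \<bar>g y\<bar> \<le> 1 + V y" for n x g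
  proof -
    have ig: "integrable (kernel_pow P n x) g" for n x
    proof -
      interpret prob_space "kernel_pow P n x" by (rule prob_space_kernel_pow)
      have "integrable (kernel_pow P n x) (\<lambda>y. 1 + V y)" using iV by auto
      then show ?thesis by (rule Bochner_Integration.integrable_bound) (use gV V0 in \<open>auto simp: add_nonneg_nonneg\<close>)
    qed
    have i\<mu>: "integrable \<mu> g"
    proof -
      have "integrable \<mu> (\<lambda>y. 1 + V y)" using i\<mu>V by auto
      then show ?thesis by (rule Bochner_Integration.integrable_bound) (use gV V0 in \<open>auto simp: add_nonneg_nonneg\<close>)
    qed
    define h where "h k y = integral\<^sup>L (kernel_pow P (n0 * k) y) g" for k y
    have h[measurable]: "h k \<in> borel_measurable borel" for k
      unfolding h_def[abs_def]
      by (rule measurable_compose[OF kernel_pow_subprob integral_measurable_subprob_algebra[OF g]])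
    have "\<exists>c. \<forall>y. \<bar>h k y - c\<bar> \<le> a ^ k * b0 * (1 + \<beta> * V y)" for k
    proof (induction k)
      case 0
      have "h 0 = g" by (simp add: h_def fun_eq_iff integral_return)
      moreover have "\<bar>g y - 0\<bar> \<le> b0 * (1 + \<beta> * V y)" for y
      proof -
        have "1 + V y \<le> b0 + (b0 * \<beta>) * V y"
          using b0 V0[of y] mult_right_mono[OF b0(2) V0[of y]] by simp
        with gV[of y] show ?thesis by (simp add: algebra_simps)
      qed
      ultimately show ?case by (intro exI[of _ 0]) simp
    next
      case (Suc k)
      then obtain c where c: "\<forall>y. \<bar>h k y - c\<bar> \<le> (a ^ k * b0) * (1 + \<beta> * V y)" by blast
      have "0 \<le> a ^ k * b0" using a b0 by simp
      from contr[rule_format, OF h this c[rule_format]]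
      obtain c' where c': "\<And>x. \<bar>(\<integral>y. h k y \<partial>kernel_pow P n0 x) - c'\<bar> \<le> a * (a ^ k * b0) * (1 + \<beta> * V x)"
        by blast
      have "h (Suc k) x = (\<integral>y. h k y \<partial>kernel_pow P n0 x)" for x
        using integral_kernel_pow_add(1)[OF g ig ig, of n0 "n0 * k" x] by (simp add: h_def)
      then show ?case using c' by (intro exI[of _ c']) (simp add: mult.assoc)
    qed
    then obtain c where c: "\<And>y. \<bar>h (n div n0) y - c\<bar> \<le> a ^ (n div n0) * b0 * (1 + \<beta> * V y)" by blast
    \<comment> \<open>The \<open>j\<close> leftover steps are placed before the
      \<open>n0 * k\<close> others: the mean is then that of \<open>h k\<close>, whose oscillation
      is already small, under the law after \<open>j\<close> steps, where the mean of
      \<open>V\<close> is controlled.\<close>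
    define k j where "k = n div n0" and "j = n mod n0"
    have nkj: "j + n0 * k = n" by (simp add: k_def j_def)
    have *: "\<bar>integral\<^sup>L M (h k) - c\<bar> \<le> a ^ k * b0 * (1 + \<beta> * B)"
      if "prob_space M" "sets M = sets borel" "integrable M V" "integral\<^sup>L M V \<le> B" "integrable M (h k)" for M B
    proof -
      interpret prob_space M by fact
      have "\<bar>integral\<^sup>L M (h k) - c\<bar> = \<bar>\<integral>y. h k y - c \<partial>M\<bar>"
        using that(5) by (simp add: prob_space)
      also have "\<dots> \<le> (\<integral>y. \<bar>h k y - c\<bar> \<partial>M)" by (rule integral_abs_bound)
      also have "\<dots> \<le> (\<integral>y. a ^ k * b0 * (1 + \<beta> * V y) \<partial>M)"
        using that c[folded k_def] by (intro integral_mono) auto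
      also have "\<dots> = a ^ k * b0 * (1 + \<beta> * integral\<^sup>L M V)"
        using that by (simp add: prob_space)
      also have "\<dots> \<le> a ^ k * b0 * (1 + \<beta> * B)"
        using that a b0 \<beta> by (intro mult_left_mono add_mono) auto
      finally show ?thesis .
    qed
    have "\<bar>integral\<^sup>L (kernel_pow P n x) g - c\<bar> \<le> a ^ k * b0 * (1 + \<beta> * (V x + K'))"
    proof -
      have "\<gamma> ^ j * V x \<le> V x" using \<gamma> V0 by (simp add: mult_left_le_one_le power_le_one)
      then have "integral\<^sup>L (kernel_pow P j x) V \<le> V x + K'" using bV[of j x] by simp
      moreover have "integral\<^sup>L (kernel_pow P n x) g = integral\<^sup>L (kernel_pow P j x) (h k)"
          "integrable (kernel_pow P j x) (h k)"
        using integral_kernel_pow_add[OF g ig ig, where m=j and n="n0 * k" and x=x] unfolding nkj h_def[abs_def] by auto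
      ultimately show ?thesis using *[OF prob_space_kernel_pow sets_kernel_pow iV] by simp
    qed
    moreover have "\<bar>integral\<^sup>L \<mu> g - c\<bar> \<le> a ^ k * b0 * (1 + \<beta> * K')"
      using *[OF p s i\<mu>V b\<mu>V] integral_stationary[OF \<mu> g ig i\<mu>, where n="n0 * k"] unfolding h_def[abs_def] by simp
    ultimately have "\<bar>integral\<^sup>L (kernel_pow P n x) g - integral\<^sup>L \<mu> g\<bar> \<le>
        a ^ k * b0 * (1 + \<beta> * (V x + K')) + a ^ k * b0 * (1 + \<beta> * K')" by linarith
    also have "\<dots> = a ^ k * (b0 * (2 + \<beta> * (V x + 2 * K')))" by (simp add: algebra_simps)
    also have "\<dots> \<le> (\<rho> ^ n / a) * (b0 * (2 + \<beta> * (V x + 2 * K')))"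
    proof (rule mult_right_mono)
      \<comment> \<open>Since \<open>k\<close> is a rounded quotient, \<open>\<rho> ^ n\<close>
        dominates only the power \<open>a ^ (k + 1)\<close>; this costs the factor 1 / a in the
        constant.\<close>
      have "real n \<le> real n0 * (real k + 1)"
      proof -
        have "n < n0 * (k + 1)" unfolding k_def using n0 by (simp add: dividend_less_times_div mult.commute)
        then have "real n < real (n0 * (k + 1))" by (simp only: of_nat_less_iff)
        then show ?thesis by (simp add: distrib_left)
      qed
      then have "real n / real n0 \<le> real k + 1" using n0 by (simp add: field_simps)
      then have "a powr (real k + 1) \<le> a powr (real n / real n0)"
        using a by (intro powr_mono') auto
      moreover have "\<rho> ^ n = a powr (real n / real n0)"
        using a by (simp add: \<rho>_def powr_power)
      moreover have "a powr (real k + 1) = a ^ k * a"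
        using a by (simp add: powr_add powr_realpow)
      ultimately show "a ^ k \<le> \<rho> ^ n / a" using a by (simp add: field_simps)
      show "0 \<le> b0 * (2 + \<beta> * (V x + 2 * K'))" using b0 \<beta> V0 K' by simp
    qed
    finally show ?thesis by (simp add: field_simps)
  qed
  then show ?thesis using \<rho> by blast
qed

end

section \<open>Irreducibility, aperiodicity and Harris recurrence from convergence\<close>

context markov_kernel
begin

text \<open>The probability that the chain started in \<open>y\<close> stays outside
  \<open>A\<close> at all times 0, ..., m, both ends included. The recursion through the kernel
  postpones path space until \<open>harris_of_avoid\<close>.\<close>

primrec avoid :: "'a set \<Rightarrow> nat \<Rightarrow> 'a \<Rightarrow> ennreal" where
  "avoid A 0 y = indicator (- A) y"
| "avoid A (Suc m) y = indicator (- A) y * (\<integral>\<^sup>+z. avoid A m z \<partial>P y)"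

lemma avoid_measurable [measurable]:
  assumes [measurable]: "A \<in> sets borel"
  shows "avoid A m \<in> borel_measurable borel"
proof (induction m)
  case 0
  have "avoid A 0 = indicator (- A)" by (simp add: fun_eq_iff)
  then show ?case by simp
next
  case (Suc m)
  note [measurable] = Suc
  have "avoid A (Suc m) = (\<lambda>y. indicator (- A) y * (\<integral>\<^sup>+z. avoid A m z \<partial>P y))" by (simp add: fun_eq_iff)
  then show ?case by simp
qed

lemma avoid_le_1: "avoid A m y \<le> 1"
proof (induction m arbitrary: y)
  case (Suc m)
  interpret prob_space "P y" by (rule prob_space_P)
  have "(\<integral>\<^sup>+z. avoid A m z \<partial>P y) \<le> (\<integral>\<^sup>+z. 1 \<partial>P y)"
    using Suc by (intro nn_integral_mono) auto
  then show ?case using emeasure_space_1 by (auto split: split_indicator)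
qed (auto split: split_indicator)

lemma avoid_decseq: "avoid A (Suc m) y \<le> avoid A m y"
proof (induction m arbitrary: y)
  case 0
  interpret prob_space "P y" by (rule prob_space_P)
  have "(\<integral>\<^sup>+z. avoid A 0 z \<partial>P y) \<le> (\<integral>\<^sup>+z. 1 \<partial>P y)"
    by (intro nn_integral_mono) (auto split: split_indicator)
  then show ?case using emeasure_space_1 by (auto split: split_indicator)
next
  case (Suc m)
  have "(\<integral>\<^sup>+z. avoid A (Suc m) z \<partial>P y) \<le> (\<integral>\<^sup>+z. avoid A m z \<partial>P y)"
    using Suc by (intro nn_integral_mono) auto
  then show ?case by (auto split: split_indicator)
qed

text \<open>The probability \<open>g\<close> of never visiting \<open>A\<close> is subharmonic, \<open>g \<le> P\<^sup>n g\<close>, so \<open>g \<le> \<mu>(g)\<close> in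
  the limit. Then \<open>g = \<mu>(g)\<close> almost everywhere, and \<open>g\<close> vanishes on \<open>A\<close>.\<close>

lemma INF_avoid_eq_0:
  assumes \<mu>: "stationary_distribution P \<mu>"
    and conv: "\<And>x (g :: 'a \<Rightarrow> real). g \<in> borel_measurable borel \<Longrightarrow> (\<And>y. \<bar>g y\<bar> \<le> 1) \<Longrightarrow>
      (\<lambda>n. integral\<^sup>L (kernel_pow P n x) g) \<longlonglongrightarrow> integral\<^sup>L \<mu> g"
    and A[measurable]: "A \<in> sets borel" and pos: "emeasure \<mu> A > 0"
  shows "(INF m. avoid A m y) = 0"
proof -
  note s = stationary_distributionD(1)[OF \<mu>] and sp = stationary_distributionD(2)[OF \<mu>]
    and p = stationary_distributionD(3)[OF \<mu>]
  note [measurable_cong] = s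
  interpret \<mu>: prob_space \<mu> by (rule p)
  define G where "G y = (INF m. avoid A m y)" for y
  have [measurable]: "G \<in> borel_measurable borel"
    unfolding G_def[abs_def] by measurable
  have G1: "G y \<le> 1" for y
    unfolding G_def by (rule INF_lower2[of 0]) (auto split: split_indicator)
  have GA: "G y = 0" if "y \<in> A" for y
  proof -
    have "G y \<le> avoid A 0 y" unfolding G_def by (rule INF_lower) simp
    then show ?thesis using that by simp
  qed
  have GP: "G y \<le> (\<integral>\<^sup>+z. G z \<partial>P y)" for y
  proof -
    interpret prob_space "P y" by (rule prob_space_P)
    have "(\<integral>\<^sup>+z. G z \<partial>P y) = (INF m. \<integral>\<^sup>+z. avoid A m z \<partial>P y)"
      unfolding G_def
    proof (rule nn_integral_monotone_convergence_INF_AE)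
      have "(\<integral>\<^sup>+z. avoid A 0 z \<partial>P y) \<le> (\<integral>\<^sup>+z. 1 \<partial>P y)"
        by (intro nn_integral_mono) (auto split: split_indicator)
      then show "(\<integral>\<^sup>+z. avoid A 0 z \<partial>P y) < \<infinity>" using emeasure_space_1 by (auto intro: le_less_trans)
    qed (use avoid_decseq in auto)
    also have "\<dots> \<ge> G y"
    proof (rule INF_greatest)
      fix m
      have "G y \<le> avoid A (Suc m) y" unfolding G_def by (rule INF_lower) simp
      also have "\<dots> \<le> (\<integral>\<^sup>+z. avoid A m z \<partial>P y)" by (auto split: split_indicator)
      finally show "G y \<le> (\<integral>\<^sup>+z. avoid A m z \<partial>P y)" .
    qed
    finally show ?thesis .
  qed
  have GPn: "G y \<le> (\<integral>\<^sup>+z. G z \<partial>kernel_pow P n y)" for n y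
  proof (induction n arbitrary: y)
    case 0 show ?case by (simp add: nn_integral_return)
  next
    case (Suc n)
    have "G y \<le> (\<integral>\<^sup>+z. G z \<partial>P y)" by (rule GP)
    also have "\<dots> \<le> (\<integral>\<^sup>+z. (\<integral>\<^sup>+w. G w \<partial>kernel_pow P n z) \<partial>P y)" by (intro nn_integral_mono Suc)
    finally show ?case by (subst nn_integral_kernel_pow_Suc) auto
  qed
  define g where "g y = enn2real (G y)" for y
  have Gg: "G y = ennreal (g y)" for y
    using le_less_trans[OF G1[of y] ennreal_one_less_top] by (simp add: g_def)
  have g0: "0 \<le> g y" for y by (simp add: g_def)
  have g1: "g y \<le> 1" for y using G1[of y] by (simp add: Gg)
  have [measurable]: "g \<in> borel_measurable borel" unfolding g_def[abs_def] by measurable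
  have ig: "integrable M g" if "prob_space M" "sets M = sets borel" for M
  proof -
    interpret prob_space M by fact
    note [measurable_cong] = that(2)
    show ?thesis by (rule integrable_const_bound[where B=1]) (use g0 g1 in auto)
  qed
  have i\<mu>: "integrable \<mu> g" by (rule ig[OF p s])
  have gle: "g y \<le> integral\<^sup>L \<mu> g" for y
  proof (rule LIMSEQ_le_const)
    show "(\<lambda>n. integral\<^sup>L (kernel_pow P n y) g) \<longlonglongrightarrow> integral\<^sup>L \<mu> g"
      by (rule conv) (use g0 g1 in auto)
    have "g y \<le> integral\<^sup>L (kernel_pow P n y) g" for n
    proof -
      have "ennreal (g y) \<le> (\<integral>\<^sup>+z. ennreal (g z) \<partial>kernel_pow P n y)"
        using GPn[of y n] by (simp add: Gg)
      also have "\<dots> = ennreal (integral\<^sup>L (kernel_pow P n y) g)"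
        by (rule nn_integral_eq_integral[OF ig]) (auto simp: prob_space_kernel_pow g0)
      finally show ?thesis
        by (subst (asm) ennreal_le_iff) (auto intro: integral_nonneg_AE simp: g0)
    qed
    then show "\<exists>N. \<forall>n\<ge>N. g y \<le> integral\<^sup>L (kernel_pow P n y) g" by blast
  qed
  define c where "c = integral\<^sup>L \<mu> g"
  have "(\<integral>y. c - g y \<partial>\<mu>) = 0" using i\<mu> by (simp add: \<mu>.prob_space c_def)
  moreover have "integrable \<mu> (\<lambda>y. c - g y)" using i\<mu> by auto
  ultimately have ae: "AE y in \<mu>. c - g y = 0"
    using gle by (subst (asm) integral_nonneg_eq_0_iff_AE) (auto simp: c_def)
  have nae: "\<not> (AE y in \<mu>. y \<notin> A)"
    using pos A s sp by (subst AE_iff_measurable[where N=A]) auto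
  have "\<exists>y\<in>A. g y = c"
  proof (rule ccontr)
    assume "\<not> (\<exists>y\<in>A. g y = c)"
    then have "AE y in \<mu>. y \<notin> A"
      using ae by (auto elim!: eventually_mono)
    with nae show False by blast
  qed
  then obtain y0 where "y0 \<in> A" "g y0 = c" by blast
  then have "c = 0" using GA by (simp add: g_def)
  then have "g y = 0" using gle[of y] g0[of y] by (simp add: c_def)
  then show ?thesis using Gg by (simp add: G_def)
qed

text \<open>Reduces cylinder events to the finite-horizon law, where single coordinates can be
  integrated out.\<close>

lemma path_law_eq:
  assumes X: "X \<in> sets (PiM {0..<k} (\<lambda>_. borel :: 'a measure))"
  shows "emeasure (path_law P x) (prod_emb UNIV (\<lambda>_. borel) {0..<k} X) =
    emeasure (Ionescu_Tulcea.C (chain_step P x) (\<lambda>_. borel) 0 k (\<lambda>_. undefined)) X"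
proof -
  interpret IT: Ionescu_Tulcea "chain_step P x" "\<lambda>_. borel"
    by (rule Ionescu_Tulcea_chain_step[OF P])
  have "prod_emb {0..<k} (\<lambda>_. borel) {0..<k} X = X"
    using sets.sets_into_space[OF X] by (intro prod_emb_id) (auto simp: space_PiM)
  then show ?thesis
    unfolding path_law_def using IT.lim[OF _ X] IT.emeasure_CI[of "{0..<k}" k, OF _ X] by simp
qed

text \<open>A path with finitely many visits avoids \<open>A\<close> from some time \<open>n\<close>
  on. By the Markov property, missing \<open>A\<close> at times n, ..., n + j has as probability the
  mean of \<open>avoid A j\<close> at the state at time \<open>n\<close>, and this tends to 0 with
  growing \<open>j\<close> by monotone convergence.\<close>

lemma harris_of_avoid:
  assumes A[measurable]: "A \<in> sets borel" and zero: "\<And>y. (INF m. avoid A m y) = 0"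
  shows "AE \<omega> in path_law P x. \<exists>\<^sub>\<infinity>n. \<omega> n \<in> A"
proof -
  interpret IT: Ionescu_Tulcea "chain_step P x" "\<lambda>_. borel"
    by (rule Ionescu_Tulcea_chain_step[OF P])
  let ?Pi = "\<lambda>k::nat. PiM {0..<k} (\<lambda>_. borel :: 'a measure)"
  \<comment> \<open>The law of the coordinates 0, ..., k - 1; the state at time \<open>n\<close>
    therefore appears in \<open>C (Suc n)\<close>.\<close>
  define C where "C k = IT.C 0 k (\<lambda>_. undefined)" for k
  have und: "(\<lambda>_. undefined) \<in> space (?Pi 0)" by (simp add: space_PiM PiE_iff extensional_def)
  have sC[measurable_cong]: "sets (C k) = sets (?Pi k)" for k
    using IT.sets_C[OF und, of k] by (simp add: C_def)
  have spC: "space (C k) = space (?Pi k)" for k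
    using sets_eq_imp_space_eq[OF sC] .
  have pC: "prob_space (C k)" for k
    unfolding C_def by (rule IT.prob_space_C[OF und])
  have sl: "sets (path_law P x) = sets (PiM UNIV (\<lambda>_. borel))"
    by (simp add: path_law_def)
  have spl: "space (path_law P x) = UNIV"
    using sets_eq_imp_space_eq[OF sl] by (simp add: space_PiM)
  have CS: "C (Suc k) = C k \<bind> IT.eP k" for k by (simp add: C_def)
  have comp[measurable]: "i < k \<Longrightarrow> (\<lambda>\<omega>. \<omega> i) \<in> ?Pi k \<rightarrow>\<^sub>M borel" for i k
    by (rule measurable_component_singleton) auto
  \<comment> \<open>Covers the times n, ..., n + j - 1. In \<open>step\<close>, time n + j is left
    to the leading indicator of \<open>avoid\<close>.\<close>
  define E where "E n j \<omega> = (\<Prod>i\<in>{n..<n+j}. indicator (- A) (\<omega> i) :: ennreal)" for n j and \<omega> :: "nat \<Rightarrow> 'a"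
  have E[measurable]: "E n j \<in> borel_measurable (?Pi k)" if "n + j \<le> k" for n j k
    unfolding E_def[abs_def] using that by (intro borel_measurable_prod_ennreal) auto
  have ES: "E n (Suc j) \<omega> = E n j \<omega> * indicator (- A) (\<omega> (n + j))" for n j \<omega>
    by (simp add: E_def)
  have Eu: "E n j (fun_upd \<omega> k z) = E n j \<omega>" if "n + j \<le> k" for n j k \<omega> z
    unfolding E_def using that by (intro prod.cong) auto
  \<comment> \<open>The Markov property, one coordinate at a time: integrating out the last
    coordinate exchanges one factor of \<open>E\<close> for one more step in \<open>avoid\<close>,
    now evaluated at the preceding coordinate.\<close>
  have step: "(\<integral>\<^sup>+\<omega>. E n j \<omega> * avoid A m (\<omega> (n + j)) \<partial>C (Suc (n + j))) =
      (\<integral>\<^sup>+\<omega>. avoid A (m + j) (\<omega> n) \<partial>C (Suc n))" for n j m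
  proof (induction j arbitrary: m)
    case 0
    show ?case by (simp add: E_def)
  next
    case (Suc j)
    have "(\<integral>\<^sup>+\<omega>. E n (Suc j) \<omega> * avoid A m (\<omega> (n + Suc j)) \<partial>C (Suc (n + Suc j))) =
        (\<integral>\<^sup>+\<omega>. (\<integral>\<^sup>+\<omega>'. E n (Suc j) \<omega>' * avoid A m (\<omega>' (n + Suc j)) \<partial>IT.eP (Suc (n + j)) \<omega>) \<partial>C (Suc (n + j)))"
      unfolding CS[of "n + Suc j"]
      by (subst nn_integral_bind[where B="?Pi (Suc (n + Suc j))"]) (auto simp: measurable_cong_sets[OF sC refl])
    also have "\<dots> = (\<integral>\<^sup>+\<omega>. E n j \<omega> * avoid A (Suc m) (\<omega> (n + j)) \<partial>C (Suc (n + j)))"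
    proof (rule nn_integral_cong)
      fix \<omega> assume "\<omega> \<in> space (C (Suc (n + j)))"
      then have \<omega>: "\<omega> \<in> space (?Pi (Suc (n + j)))" by (simp add: spC)
      have "(\<integral>\<^sup>+\<omega>'. E n (Suc j) \<omega>' * avoid A m (\<omega>' (n + Suc j)) \<partial>IT.eP (Suc (n + j)) \<omega>) =
          (\<integral>\<^sup>+z. E n (Suc j) (fun_upd \<omega> (Suc (n + j)) z) * avoid A m (fun_upd \<omega> (Suc (n + j)) z (n + Suc j))
             \<partial>(chain_step P x (Suc (n + j)) \<omega>))"
        by (rule IT.nn_integral_eP[OF \<omega>]) measurable
      also have "\<dots> = (\<integral>\<^sup>+z. E n (Suc j) \<omega> * avoid A m z \<partial>P (\<omega> (n + j)))"
        by (simp add: chain_step_def Eu)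
      also have "\<dots> = E n (Suc j) \<omega> * (\<integral>\<^sup>+z. avoid A m z \<partial>P (\<omega> (n + j)))"
        by (rule nn_integral_cmult) (subst measurable_cong_sets[OF sets_P refl], rule avoid_measurable[OF A])
      also have "\<dots> = E n j \<omega> * avoid A (Suc m) (\<omega> (n + j))"
        by (simp add: ES mult.assoc)
      finally show "(\<integral>\<^sup>+\<omega>'. E n (Suc j) \<omega>' * avoid A m (\<omega>' (n + Suc j)) \<partial>IT.eP (Suc (n + j)) \<omega>) =
          E n j \<omega> * avoid A (Suc m) (\<omega> (n + j))" .
    qed
    also have "\<dots> = (\<integral>\<^sup>+\<omega>. avoid A (Suc m + j) (\<omega> n) \<partial>C (Suc n))" by (rule Suc)
    finally show ?case by simp
  qed
  define B where "B n j = {\<omega> :: nat \<Rightarrow> 'a. \<forall>i\<in>{n..n+j}. \<omega> i \<notin> A}" for n j :: nat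
  have Bm: "B n j \<in> sets (path_law P x)" for n j
  proof -
    have "(\<lambda>\<omega>. \<omega> i) -` (- A) \<inter> space (PiM UNIV (\<lambda>_. borel)) \<in> sets (PiM UNIV (\<lambda>_. borel :: 'a measure))" for i
      by (rule measurable_sets[OF measurable_component_singleton]) auto
    moreover have "B n j = (\<Inter>i\<in>{n..n+j}. (\<lambda>\<omega>. \<omega> i) -` (- A) \<inter> space (PiM UNIV (\<lambda>_. borel)))"
      by (auto simp: B_def space_PiM)
    ultimately show ?thesis by (auto simp: sl intro!: sets.finite_INT)
  qed
  have Bval: "emeasure (path_law P x) (B n j) = (\<integral>\<^sup>+\<omega>. avoid A j (\<omega> n) \<partial>C (Suc n))" for n j
  proof -
    let ?k = "Suc (n + j)"
    define X where "X = {\<omega>\<in>space (?Pi ?k). \<forall>i\<in>{n..n+j}. \<omega> i \<notin> A}"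
    have X[measurable]: "X \<in> sets (?Pi ?k)"
      unfolding X_def by (rule sets.sets_Collect_finite_All) (auto intro!: measurable_sets_Collect)
    have "B n j = prod_emb UNIV (\<lambda>_. borel) {0..<?k} X"
      by (auto simp: B_def X_def prod_emb_def space_PiM)
    then have "emeasure (path_law P x) (B n j) = emeasure (C ?k) X"
      using path_law_eq[OF X] by (simp add: C_def)
    also have "\<dots> = (\<integral>\<^sup>+\<omega>. indicator X \<omega> \<partial>C ?k)" by simp
    also have "\<dots> = (\<integral>\<^sup>+\<omega>. E n j \<omega> * avoid A 0 (\<omega> (n + j)) \<partial>C ?k)"
    proof (rule nn_integral_cong)
      fix \<omega> assume "\<omega> \<in> space (C ?k)"
      then have "\<omega> \<in> X \<longleftrightarrow> (\<forall>i\<in>{n..n+j}. \<omega> i \<notin> A)" by (auto simp: X_def spC)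
      moreover have "E n j \<omega> * avoid A 0 (\<omega> (n + j)) = (\<Prod>i\<in>{n..n+j}. indicator (- A) (\<omega> i))"
        unfolding E_def by (simp add: prod.last_plus atLeastLessThanSuc_atLeastAtMost[symmetric] mult.commute)
      moreover have "(\<Prod>i\<in>{n..n+j}. indicator (- A) (\<omega> i) :: ennreal) = (if \<forall>i\<in>{n..n+j}. \<omega> i \<notin> A then 1 else 0)"
      proof (cases "\<forall>i\<in>{n..n+j}. \<omega> i \<notin> A")
        case False
        then have "\<exists>i\<in>{n..n+j}. indicator (- A) (\<omega> i) = (0 :: ennreal)" by (auto simp: indicator_def)
        then show ?thesis using False by (simp add: prod_zero)
      qed (simp add: prod.neutral)
      ultimately show "indicator X \<omega> = E n j \<omega> * avoid A 0 (\<omega> (n + j))" by simp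
    qed
    also have "\<dots> = (\<integral>\<^sup>+\<omega>. avoid A j (\<omega> n) \<partial>C (Suc n))" using step[of n j 0] by simp
    finally show ?thesis .
  qed
  have null: "(\<Inter>j. B n j) \<in> null_sets (path_law P x)" for n
  proof -
    interpret pc: prob_space "C (Suc n)" by (rule pC)
    have [measurable]: "(\<lambda>\<omega>. avoid A j (\<omega> n)) \<in> borel_measurable (C (Suc n))" for j
      by (rule measurable_compose[OF _ avoid_measurable[OF A]]) (simp add: measurable_cong_sets[OF sC refl])
    have "(INF j. \<integral>\<^sup>+\<omega>. avoid A j (\<omega> n) \<partial>C (Suc n)) = (\<integral>\<^sup>+\<omega>. (INF j. avoid A j (\<omega> n)) \<partial>C (Suc n))"
    proof (rule nn_integral_monotone_convergence_INF_AE[symmetric])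
      have "(\<integral>\<^sup>+\<omega>. avoid A 0 (\<omega> n) \<partial>C (Suc n)) \<le> (\<integral>\<^sup>+\<omega>. 1 \<partial>C (Suc n))"
        by (intro nn_integral_mono avoid_le_1)
      then show "(\<integral>\<^sup>+\<omega>. avoid A 0 (\<omega> n) \<partial>C (Suc n)) < \<infinity>"
        using pc.emeasure_space_1 by (auto intro: le_less_trans)
    qed (use avoid_decseq in auto)
    also have "\<dots> = 0" by (simp add: zero)
    finally have 0: "(INF j. emeasure (path_law P x) (B n j)) = 0" by (simp add: Bval)
    have "emeasure (path_law P x) (\<Inter>j. B n j) \<le> emeasure (path_law P x) (B n j)" for j
      by (rule emeasure_mono[OF _ Bm]) auto
    then have "emeasure (path_law P x) (\<Inter>j. B n j) \<le> (INF j. emeasure (path_law P x) (B n j))"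
      by (intro INF_greatest)
    then have "emeasure (path_law P x) (\<Inter>j. B n j) = 0" using 0 by simp
    then show ?thesis using Bm by (auto intro!: null_setsI)
  qed
  have "(\<Union>n. \<Inter>j. B n j) \<in> null_sets (path_law P x)" using null by (intro null_sets_UN)
  then show ?thesis
  proof (rule AE_I')
    show "{\<omega>\<in>space (path_law P x). \<not> (\<exists>\<^sub>\<infinity>n. \<omega> n \<in> A)} \<subseteq> (\<Union>n. \<Inter>j. B n j)"
    proof safe
      fix \<omega> :: "nat \<Rightarrow> 'a" assume "\<not> (\<exists>\<^sub>\<infinity>n. \<omega> n \<in> A)"
      then obtain n where "\<And>m. m > n \<Longrightarrow> \<omega> m \<notin> A" by (auto simp: INFM_nat)
      then show "\<omega> \<in> (\<Union>n. \<Inter>j. B n j)" by (auto simp: B_def intro!: exI[of _ "Suc n"])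
    qed
  qed
qed

text \<open>A set of positive \<mu>-measure is charged by late powers from every start. Conversely,
  a \<mu>-null set is, by stationarity, null for all powers from almost every start, so no
  irreducibility measure charges it; hence \<mu> is maximal. In a cycle of length d the powers along
  a residue class modulo d sit on a single class, so \<mu> would give mass 1 to each of at least two
  disjoint sets.\<close>

lemma ergodic_of_convergence:
  assumes \<mu>: "stationary_distribution P \<mu>"
    and conv: "\<And>x (g :: 'a \<Rightarrow> real). g \<in> borel_measurable borel \<Longrightarrow> (\<And>y. \<bar>g y\<bar> \<le> 1) \<Longrightarrow>
      (\<lambda>n. integral\<^sup>L (kernel_pow P n x) g) \<longlonglongrightarrow> integral\<^sup>L \<mu> g"
  shows "maximal_irreducibility_measure P \<mu>" "phi_irreducible P" "aperiodic P" "positive_harris P"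
proof -
  note s = stationary_distributionD(1)[OF \<mu>] and sp = stationary_distributionD(2)[OF \<mu>]
    and p = stationary_distributionD(3)[OF \<mu>]
  note [measurable_cong] = s
  interpret \<mu>: prob_space \<mu> by (rule p)
  have lim: "(\<lambda>n. measure (kernel_pow P n x) A) \<longlonglongrightarrow> measure \<mu> A" if A: "A \<in> sets borel" for A x
  proof -
    have "(\<lambda>n. integral\<^sup>L (kernel_pow P n x) (indicator A :: 'a \<Rightarrow> real)) \<longlonglongrightarrow> integral\<^sup>L \<mu> (indicator A)"
      by (rule conv) (use A in \<open>auto split: split_indicator\<close>)
    then show ?thesis using A by (simp add: sp s)
  qed
  have irr: "irreducibility_measure P \<mu>"
    unfolding irreducibility_measure_def
  proof (intro conjI ballI impI allI)
    fix A x assume A: "A \<in> sets (borel :: 'a measure)" and pos: "0 < emeasure \<mu> A"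
    then have "0 < measure \<mu> A" by (simp add: \<mu>.emeasure_eq_measure)
    then have "\<forall>\<^sub>F n in sequentially. 0 < measure (kernel_pow P n x) A"
      using order_tendstoD(1)[OF lim[OF A]] by blast
    then have "\<forall>\<^sub>F n in sequentially. 0 < measure (kernel_pow P n x) A \<and> n \<ge> 1"
      using eventually_ge_at_top[of "1::nat"] by eventually_elim auto
    then obtain n where "n \<ge> 1" "0 < measure (kernel_pow P n x) A"
      by (auto dest: eventually_happens)
    then show "\<exists>n\<ge>1. emeasure (kernel_pow P n x) A > 0"
      using finite_measure.emeasure_eq_measure[OF prob_space.finite_measure[OF prob_space_kernel_pow]]
      by (intro exI[of _ n]) (simp add: ennreal_less_zero_iff)
  qed (use s sp \<mu>.emeasure_space_1 \<mu>.sigma_finite_measure_axioms in auto)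
  show mx: "maximal_irreducibility_measure P \<mu>"
    unfolding maximal_irreducibility_measure_def absolutely_continuous_def
  proof (intro conjI irr allI impI subsetI)
    fix \<phi> A assume \<phi>: "irreducibility_measure P \<phi>" and "A \<in> null_sets \<mu>"
    then have A: "A \<in> sets borel" "emeasure \<mu> A = 0" by (auto simp: s)
    have "emeasure \<phi> A = 0"
    proof (rule ccontr)
      assume "emeasure \<phi> A \<noteq> 0"
      then have ex: "\<exists>n\<ge>1. emeasure (kernel_pow P n x) A > 0" for x
        using \<phi> A by (auto simp: irreducibility_measure_def zero_less_iff_neq_zero)
      have "AE x in \<mu>. emeasure (kernel_pow P n x) A = 0" for n
      proof -
        have "(\<integral>\<^sup>+x. emeasure (kernel_pow P n x) A \<partial>\<mu>) = emeasure (\<mu> \<bind> kernel_pow P n) A"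
          using A by (intro emeasure_bind[symmetric, where N=borel]) (auto simp: sp)
        also have "\<dots> = 0" using A stationary_bind[OF \<mu>] by simp
        finally show ?thesis
          using A by (subst (asm) nn_integral_0_iff_AE) auto
      qed
      then have "AE x in \<mu>. \<forall>n. emeasure (kernel_pow P n x) A = 0" by (subst AE_all_countable) auto
      then have "AE x in \<mu>. False"
      proof eventually_elim
        case (elim x)
        with ex[of x] show False by auto
      qed
      then show False by simp
    qed
    then show "A \<in> null_sets \<phi>" using \<phi> A by (auto simp: irreducibility_measure_def)
  qed
  show "phi_irreducible P" using irr by (auto simp: phi_irreducible_def)
  show "positive_harris P"
    unfolding positive_harris_def harris_def
    using mx harris_of_avoid INF_avoid_eq_0[OF \<mu> conv] \<mu> by blast
  show "aperiodic P"
    unfolding aperiodic_def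
  proof (intro exI[of _ \<mu>] conjI mx notI)
    assume "\<exists>d\<ge>2. \<exists>D. is_cycle P \<mu> d D"
    then obtain d D where d: "d \<ge> 2" and D: "\<And>i. i < d \<Longrightarrow> D i \<in> sets borel"
      and disj: "disjoint_family_on D {..<d}"
      and cyc: "\<And>i x. i < d \<Longrightarrow> x \<in> D i \<Longrightarrow> emeasure (P x) (D (Suc i mod d)) = 1"
      and null: "emeasure \<mu> (UNIV - (\<Union>i<d. D i)) = 0"
      unfolding is_cycle_def by blast
    have "(\<Union>i<d. D i) \<noteq> {}"
    proof
      assume "(\<Union>i<d. D i) = {}"
      then have "emeasure \<mu> UNIV = 0" using null by simp
      then show False using \<mu>.emeasure_space_1 by (simp add: sp)
    qed
    then obtain i x where i: "i < d" and x: "x \<in> D i" by blast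
    have pow: "emeasure (kernel_pow P n y) (D ((j + n) mod d)) = 1" if "j < d" "y \<in> D j" for n j y
      using that
    proof (induction n arbitrary: j y)
      case 0
      then show ?case using D by simp
    next
      case (Suc n)
      interpret py: prob_space "P y" by (rule prob_space_P)
      have j': "Suc j mod d < d" using d by simp
      have m: "D ((j + Suc n) mod d) \<in> sets borel" using d by (intro D) simp
      have "AE z in P y. z \<in> D (Suc j mod d)"
        using cyc[OF Suc.prems] D[OF j'] py.emeasure_eq_1_AE by (simp add: py.AE_in_set_eq_1 py.emeasure_eq_measure)
      then have "AE z in P y. emeasure (kernel_pow P n z) (D ((j + Suc n) mod d)) = 1"
      proof eventually_elim
        case (elim z)
        have "(Suc j mod d + n) mod d = (j + Suc n) mod d" by (simp add: mod_add_left_eq)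
        then show ?case using Suc.IH[OF j' elim] by simp
      qed
      then have "(\<integral>\<^sup>+z. emeasure (kernel_pow P n z) (D ((j + Suc n) mod d)) \<partial>P y) = (\<integral>\<^sup>+z. 1 \<partial>P y)"
        by (rule nn_integral_cong_AE)
      then show ?case
        using emeasure_kernel_pow_add[OF m, of "Suc 0" n y] py.emeasure_space_1 by (simp add: kernel_pow_1 del: kernel_pow.simps)
    qed
    have full: "measure \<mu> (D ((i + r) mod d)) = 1" for r
    proof -
      have m: "D ((i + r) mod d) \<in> sets borel" using d by (intro D) simp
      have "measure (kernel_pow P (r + d * n) x) (D ((i + r) mod d)) = 1" for n
        using pow[OF i x, of "r + d * n"] by (simp add: measure_def mod_mult_self2 flip: add.assoc)
      moreover have "strict_mono (\<lambda>n. r + d * n)" using d by (simp add: strict_mono_def)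
      then have "(\<lambda>n. measure (kernel_pow P (r + d * n) x) (D ((i + r) mod d))) \<longlonglongrightarrow> measure \<mu> (D ((i + r) mod d))"
        using LIMSEQ_subseq_LIMSEQ[OF lim[OF m]] by (fastforce simp: o_def)
      ultimately show ?thesis by (simp add: LIMSEQ_const_iff)
    qed
    have 1: "measure \<mu> (D i) = 1" using full[of 0] i by simp
    have 2: "measure \<mu> (D (Suc i mod d)) = 1" using full[of 1] by simp
    have ne: "Suc i mod d \<noteq> i" "Suc i mod d < d" using d i by (auto simp: mod_Suc)
    then have "D i \<inter> D (Suc i mod d) = {}"
      using disj i by (auto simp: disjoint_family_on_def)
    then have "measure \<mu> (D i \<union> D (Suc i mod d)) = 2"
      using 1 2 D[OF i] D[OF ne(2)] s by (subst \<mu>.finite_measure_Union) auto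
    then show False using \<mu>.prob_le_1[of "D i \<union> D (Suc i mod d)"] by simp
  qed
qed

end

section \<open>Stationarity and minorization for the Metropolis kernel\<close>

lemma nn_integral_lborel_translate:
  fixes f :: "'a::euclidean_space \<Rightarrow> ennreal"
  assumes [measurable]: "f \<in> borel_measurable borel"
  shows "(\<integral>\<^sup>+x. f (c + x) \<partial>lborel) = (\<integral>\<^sup>+x. f x \<partial>lborel)"
proof -
  have "(\<integral>\<^sup>+x. f x \<partial>lborel) = (\<integral>\<^sup>+x. f x \<partial>distr lborel borel ((+) c))"
    by (simp add: lborel_distr_plus)
  also have "\<dots> = (\<integral>\<^sup>+x. f (c + x) \<partial>lborel)"
    by (subst nn_integral_distr) auto
  finally show ?thesis by simp
qed

lemma nn_integral_lborel_reflect: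
  fixes f :: "'a::euclidean_space \<Rightarrow> ennreal"
  assumes [measurable]: "f \<in> borel_measurable borel"
  shows "(\<integral>\<^sup>+x. f (- x) \<partial>lborel) = (\<integral>\<^sup>+x. f x \<partial>lborel)"
proof -
  have "lborel = density (distr lborel borel (\<lambda>x::'a. 0 + (- 1) *\<^sub>R x)) (\<lambda>_. ennreal (\<bar>- 1 :: real\<bar> ^ DIM('a)))"
    by (rule lborel_affine) simp
  then have *: "lborel = distr lborel borel (uminus :: 'a \<Rightarrow> 'a)"
    by (simp add: density_1)
  have "(\<integral>\<^sup>+x. f x \<partial>lborel) = (\<integral>\<^sup>+x. f x \<partial>distr lborel borel uminus)"
    using * by simp
  also have "\<dots> = (\<integral>\<^sup>+x. f (- x) \<partial>lborel)"
    by (subst nn_integral_distr) auto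
  finally show ?thesis by simp
qed

lemma emeasure_lborel_translate:
  fixes A :: "'a::euclidean_space set"
  assumes [measurable]: "A \<in> sets borel"
  shows "emeasure lborel {x. c + x \<in> A} = emeasure lborel A"
proof -
  have "{x. c + x \<in> A} \<in> sets lborel" by measurable
  then have "emeasure lborel {x. c + x \<in> A} = (\<integral>\<^sup>+x. indicator {x. c + x \<in> A} x \<partial>lborel)"
    by (rule nn_integral_indicator[symmetric])
  also have "\<dots> = (\<integral>\<^sup>+x. indicator A (c + x) \<partial>lborel)"
    by (intro nn_integral_cong) (auto split: split_indicator)
  also have "\<dots> = emeasure lborel A"
    by (subst nn_integral_lborel_translate) auto
  finally show ?thesis .
qed

lemma mult_emeasure_lborel_Int:
  assumes [measurable]: "A \<in> sets borel" "B \<in> sets borel"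
  shows "c * emeasure lborel (A \<inter> B) = (\<integral>\<^sup>+z. c * indicator B z * indicator A z \<partial>lborel)"
proof -
  have "(\<integral>\<^sup>+z. c * indicator B z * indicator A z \<partial>lborel) = (\<integral>\<^sup>+z. c * indicator (A \<inter> B) z \<partial>lborel)"
    by (intro nn_integral_cong) (auto split: split_indicator)
  also have "\<dots> = c * emeasure lborel (A \<inter> B)"
    by (rule nn_integral_cmult_indicator) simp
  finally show ?thesis by simp
qed

lemma emeasure_density_indicator:
  assumes [measurable]: "A \<in> sets borel" "B \<in> sets borel"
  shows "emeasure (density lborel (\<lambda>z. c * indicator B z)) A = c * emeasure lborel (A \<inter> B)"
  by (simp add: emeasure_density mult_emeasure_lborel_Int)

text \<open>A quantitative Steinhaus theorem: a compact \<open>K \<subseteq> E\<close> and its small translates lie in an open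
  set of measure less than \<open>3/2\<close> that of \<open>K\<close>, hence overlap.\<close>

lemma steinhaus_overlap:
  fixes E :: "'a::euclidean_space set"
  assumes E: "E \<in> sets borel" "bounded E" "emeasure lborel E > 0"
  shows "\<exists>\<delta>>0. \<exists>\<epsilon>>0. \<forall>w. norm w < \<delta> \<longrightarrow> ennreal \<epsilon> \<le> emeasure lborel {z. z \<in> E \<and> z - w \<in> E}"
proof -
  have fin: "emeasure lborel B < \<infinity>" if "bounded B" for B :: "'a set"
    using that by (rule emeasure_bounded_finite)
  have El: "E \<in> sets lebesgue" using E by (simp add: sets_completionI_sets)
  define mE where "mE = measure lborel E"
  have mE: "mE > 0" "emeasure lborel E = ennreal mE"
    using E fin[OF E(2)] by (auto simp: mE_def measure_def enn2real_positive_iff)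
  obtain K where K: "closed K" "K \<subseteq> E" "emeasure lebesgue (E - K) < ennreal mE"
    by (rule sets_lebesgue_inner_closed[OF El mE(1)])
  have Kb: "K \<in> sets borel" using K by auto
  have "bounded K" using E(2) K(2) by (rule bounded_subset)
  then have cK: "compact K" using K by (simp add: compact_eq_bounded_closed)
  define m where "m = measure lborel K"
  have mK: "emeasure lborel K = ennreal m"
    using fin[OF \<open>bounded K\<close>] by (simp add: m_def measure_def)
  have m: "m > 0"
  proof (rule ccontr)
    assume "\<not> m > 0"
    then have "emeasure lborel K = 0" by (simp add: mK ennreal_neg)
    have "emeasure lborel E = emeasure lborel K + emeasure lborel (E - K)"
      using E Kb K(2) by (subst plus_emeasure) (auto simp: Un_absorb1)
    also have "\<dots> < ennreal mE" using K(3) E Kb \<open>emeasure lborel K = 0\<close> by simp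
    finally show False using mE by simp
  qed
  obtain U where U: "open U" "K \<subseteq> U" "emeasure lebesgue (U - K) < ennreal (m / 2)"
  proof (rule sets_lebesgue_outer_open)
    show "K \<in> sets lebesgue" using Kb by (simp add: sets_completionI_sets)
    show "0 < m / 2" using m by simp
  qed
  have Ub: "U \<in> sets borel" using U by auto
  obtain \<delta> where \<delta>: "\<delta> > 0" "\<And>x y. x \<in> K \<Longrightarrow> y \<in> - U \<Longrightarrow> \<delta> \<le> dist x y"
  proof -
    have "closed (- U)" "K \<inter> - U = {}" using U by auto
    from separate_compact_closed[OF cK this] show thesis using that by blast
  qed
  have "ennreal (m / 2) \<le> emeasure lborel {z. z \<in> E \<and> z - w \<in> E}" if w: "norm w < \<delta>" for w
  proof -
    \<comment> \<open>The translate of \<open>K\<close> by \<open>w\<close>. It stays inside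
      \<open>U\<close>, so its part outside \<open>K\<close> has measure at most
      \<open>m / 2\<close>, and the rest lies in both \<open>E\<close> and its translate.\<close>
    define K' where "K' = {z. - w + z \<in> K}"
    have K'b[measurable]: "K' \<in> sets borel" unfolding K'_def using Kb by measurable
    have K'U: "K' \<subseteq> U"
    proof
      fix z assume "z \<in> K'"
      then have z: "- w + z \<in> K" by (simp add: K'_def)
      show "z \<in> U"
      proof (rule ccontr)
        assume "z \<notin> U"
        then have "\<delta> \<le> dist (- w + z) z" using \<delta>(2)[OF z, of z] by simp
        then show False using w by (simp add: dist_norm)
      qed
    qed
    have mK': "emeasure lborel K' = ennreal m"
      unfolding K'_def by (subst emeasure_lborel_translate[OF Kb]) (rule mK)
    have "emeasure lborel K' \<le> emeasure lborel ((K' \<inter> K) \<union> (U - K))"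
      using K'U Kb Ub by (intro emeasure_mono) auto
    also have "\<dots> \<le> emeasure lborel (K' \<inter> K) + emeasure lborel (U - K)"
      using Kb Ub by (intro emeasure_subadditive) auto
    finally have "ennreal m \<le> emeasure lborel (K' \<inter> K) + ennreal (m / 2)"
      using U(3) Kb Ub mK' by (simp add: order_trans[OF _ add_left_mono] less_imp_le)
    then have "ennreal m - ennreal (m / 2) \<le> emeasure lborel (K' \<inter> K)"
      by (simp add: ennreal_minus_le_iff add.commute)
    then have "ennreal (m / 2) \<le> emeasure lborel (K' \<inter> K)"
      using m by (simp add: ennreal_minus)
    also have "\<dots> \<le> emeasure lborel {z. z \<in> E \<and> z - w \<in> E}"
    proof (rule emeasure_mono)
      show "{z. z \<in> E \<and> z - w \<in> E} \<in> sets lborel" using E by measurable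
    qed (use K in \<open>auto simp: K'_def\<close>)
    finally show ?thesis .
  qed
  then show ?thesis using \<delta> m by (intro exI[of _ \<delta>] conjI exI[of _ "m / 2"]) auto
qed

text \<open>Tonelli exchanges midpoint \<open>z\<close> and target \<open>w\<close>: the density of
  two jumps, one in \<open>E\<close> and one in \<open>F\<close>, is at \<open>w\<close> the
  constant \<open>a * b\<close> times the volume of admissible midpoints. Both the initial two-step
  bound and its iteration are instances.\<close>

lemma nn_integral_two_step_ge:
  fixes x :: "'a::euclidean_space"
  assumes [measurable]: "E \<in> sets borel" "F \<in> sets borel" "A \<in> sets borel" "B \<in> sets borel"
    and overlap: "\<And>w. w \<in> B \<Longrightarrow> e \<le> emeasure lborel {z. z - x \<in> E \<and> w - z \<in> F}"
    and second: "\<And>z. z - x \<in> E \<Longrightarrow> (\<integral>\<^sup>+w. b * indicator F (w - z) * indicator A w \<partial>lborel) \<le> h z"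
  shows "a * b * e * emeasure lborel (A \<inter> B) \<le> (\<integral>\<^sup>+z. a * indicator E (z - x) * h z \<partial>lborel)"
proof -
  let ?g = "\<lambda>z w. a * indicator E (z - x) * (b * indicator F (w - z) * indicator A w)"
  have "a * b * e * emeasure lborel (A \<inter> B) = (\<integral>\<^sup>+w. a * b * e * indicator B w * indicator A w \<partial>lborel)"
    by (rule mult_emeasure_lborel_Int) auto
  also have "\<dots> \<le> (\<integral>\<^sup>+w. (\<integral>\<^sup>+z. ?g z w \<partial>lborel) \<partial>lborel)"
  proof (rule nn_integral_mono)
    fix w
    have m: "{z. z - x \<in> E \<and> w - z \<in> F} \<in> sets lborel" by measurable
    have "a * b * e * indicator B w * indicator A w = a * b * indicator A w * (e * indicator B w)"
      by (simp add: ac_simps)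
    also have "\<dots> \<le> a * b * indicator A w * emeasure lborel {z. z - x \<in> E \<and> w - z \<in> F}"
      using overlap[of w] by (intro mult_left_mono) (auto split: split_indicator)
    also have "\<dots> = (\<integral>\<^sup>+z. a * b * indicator A w * indicator {z. z - x \<in> E \<and> w - z \<in> F} z \<partial>lborel)"
      by (rule nn_integral_cmult_indicator[OF m, symmetric])
    also have "\<dots> = (\<integral>\<^sup>+z. ?g z w \<partial>lborel)"
      by (intro nn_integral_cong) (auto split: split_indicator)
    finally show "a * b * e * indicator B w * indicator A w \<le> (\<integral>\<^sup>+z. ?g z w \<partial>lborel)" .
  qed
  also have "\<dots> = (\<integral>\<^sup>+z. (\<integral>\<^sup>+w. ?g z w \<partial>lborel) \<partial>lborel)"
    by (rule lborel_pair.Fubini') measurable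
  also have "\<dots> = (\<integral>\<^sup>+z. a * indicator E (z - x) * (\<integral>\<^sup>+w. b * indicator F (w - z) * indicator A w \<partial>lborel) \<partial>lborel)"
    by (intro nn_integral_cong nn_integral_cmult) measurable
  also have "\<dots> \<le> (\<integral>\<^sup>+z. a * indicator E (z - x) * h z \<partial>lborel)"
    using second by (intro nn_integral_mono) (auto split: split_indicator intro!: mult_left_mono)
  finally show ?thesis .
qed

section \<open>The Metropolis kernel: integrals and stationarity\<close>

locale srwm_chain =
  fixes \<pi> q :: "'a::euclidean_space \<Rightarrow> real"
  assumes \<pi>_cont: "continuous_on UNIV \<pi>" and \<pi>_pos: "\<And>x. 0 < \<pi> x"
    and \<pi>_density: "prob_density \<pi>"
    and q: "prob_density q" and q_sym: "\<And>y. q (- y) = q y"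
begin

lemma \<pi>_meas [measurable]: "\<pi> \<in> borel_measurable borel"
  using \<pi>_density by (simp add: prob_density_def)

lemma q_meas [measurable]: "q \<in> borel_measurable borel"
  and q_nonneg: "0 \<le> q y"
  and nn_integral_q: "(\<integral>\<^sup>+y. ennreal (q y) \<partial>lborel) = 1"
  using q by (auto simp: prob_density_def)

sublocale markov_kernel "srwm \<pi> q"
  by standard (rule srwm_kernel[OF \<pi>_meas \<pi>_pos q])

lemma accept_meas [measurable]: "(\<lambda>(x, y). accept \<pi> x y) \<in> borel_measurable (borel \<Otimes>\<^sub>M borel)"
  unfolding accept_def by measurable

lemma accept_nonneg: "0 \<le> accept \<pi> x y" and accept_le_1: "accept \<pi> x y \<le> 1"
  using \<pi>_pos by (auto simp: accept_def less_imp_le)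

lemma nn_integral_srwm:
  assumes "f \<in> borel_measurable borel"
  shows "(\<integral>\<^sup>+z. f z \<partial>srwm \<pi> q x) = (\<integral>\<^sup>+y. ennreal (accept \<pi> x y * q y) * f (x + y) \<partial>lborel) +
     f x * (\<integral>\<^sup>+y. ennreal ((1 - accept \<pi> x y) * q y) \<partial>lborel)"
  using assms
proof (induction f rule: borel_measurable_induct)
  case (cong f g)
  then have "f = g" by (simp add: fun_eq_iff)
  with cong show ?case by simp
next
  case (set A)
  then show ?case
    by (subst nn_integral_indicator) (auto simp: emeasure_srwm intro!: arg_cong2[where f="(+)"] nn_integral_cong split: split_indicator)
next
  case (mult u c)
  have [measurable]: "u \<in> borel_measurable borel" using mult by auto
  have "(\<integral>\<^sup>+y. ennreal (accept \<pi> x y * q y) * (c * u (x + y)) \<partial>lborel) =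
      c * (\<integral>\<^sup>+y. ennreal (accept \<pi> x y * q y) * u (x + y) \<partial>lborel)"
    by (subst nn_integral_cmult[symmetric]) (auto simp: ac_simps)
  moreover have "(\<integral>\<^sup>+z. c * u z \<partial>srwm \<pi> q x) = c * (\<integral>\<^sup>+z. u z \<partial>srwm \<pi> q x)"
    by (rule nn_integral_cmult) measurable
  ultimately show ?case using mult by (simp add: distrib_left mult.assoc)
next
  case (add u v)
  have [measurable]: "u \<in> borel_measurable borel" "v \<in> borel_measurable borel" using add by auto
  have "(\<integral>\<^sup>+z. v z + u z \<partial>srwm \<pi> q x) = (\<integral>\<^sup>+z. v z \<partial>srwm \<pi> q x) + (\<integral>\<^sup>+z. u z \<partial>srwm \<pi> q x)"
    by (rule nn_integral_add) measurable
  moreover have "(\<integral>\<^sup>+y. ennreal (accept \<pi> x y * q y) * (v (x + y) + u (x + y)) \<partial>lborel) =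
      (\<integral>\<^sup>+y. ennreal (accept \<pi> x y * q y) * v (x + y) \<partial>lborel) +
      (\<integral>\<^sup>+y. ennreal (accept \<pi> x y * q y) * u (x + y) \<partial>lborel)"
    by (subst nn_integral_add[symmetric]) (auto simp: distrib_left)
  ultimately show ?case using add by (simp add: distrib_right ac_simps)
next
  case (seq U)
  have [measurable]: "U i \<in> borel_measurable borel" for i using seq by auto
  have inc: "incseq (\<lambda>i. U i z)" for z using seq.hyps(3) by (auto simp: incseq_def le_fun_def)
  let ?c = "\<integral>\<^sup>+y. ennreal ((1 - accept \<pi> x y) * q y) \<partial>lborel"
  let ?I = "\<lambda>i. \<integral>\<^sup>+y. ennreal (accept \<pi> x y * q y) * U i (x + y) \<partial>lborel"
  have mono: "incseq (\<lambda>i y. ennreal (accept \<pi> x y * q y) * U i (x + y))"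
    using seq.hyps(3) by (auto simp: incseq_def le_fun_def intro!: mult_left_mono)
  have "(\<integral>\<^sup>+z. (SUP i. U i) z \<partial>srwm \<pi> q x) = (SUP i. \<integral>\<^sup>+z. U i z \<partial>srwm \<pi> q x)"
    unfolding SUP_apply by (rule nn_integral_monotone_convergence_SUP[OF seq.hyps(3)]) measurable
  also have "\<dots> = (SUP i. ?I i + U i x * ?c)" using seq.IH by simp
  also have "\<dots> = (SUP i. ?I i) + (SUP i. U i x * ?c)"
    using seq.hyps(3) mono
    by (intro ennreal_SUP_add) (auto simp: incseq_def le_fun_def intro!: nn_integral_mono mult_right_mono)
  also have "(SUP i. ?I i) = (\<integral>\<^sup>+y. (SUP i. ennreal (accept \<pi> x y * q y) * U i (x + y)) \<partial>lborel)"
    by (rule nn_integral_monotone_convergence_SUP[OF mono, symmetric]) measurable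
  finally show ?case
    by (simp add: SUP_mult_left_ennreal SUP_mult_right_ennreal image_comp)
qed

text \<open>Reversibility. The accepted flow
  \<open>s x y = min (\<pi> x) (\<pi> (x + y)) * q y\<close> is invariant under (x, y) \<mapsto> (x
  + y, -y), a translation followed by a reflection. So the accepted flow into \<open>A\<close>
  equals the accepted flow starting in \<open>A\<close>, and adding the rejected mass restores \<pi>
  on \<open>A\<close>.\<close>

lemma srwm_stationary: "stationary_distribution (srwm \<pi> q) (density lborel \<pi>)"
  unfolding stationary_distribution_def
proof (intro conjI ballI)
  show "prob_space (density lborel \<pi>)"
    using \<pi>_density by (intro prob_spaceI) (simp add: emeasure_density prob_density_def)
  fix A :: "'a set" assume A[measurable]: "A \<in> sets borel"
  define s where "s x y = ennreal (min (\<pi> x) (\<pi> (x + y)) * q y)" for x y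
  have s[measurable]: "(\<lambda>(x, y). s x y) \<in> borel_measurable (borel \<Otimes>\<^sub>M borel)"
    unfolding s_def by measurable
  have s_acc: "s x y = ennreal (\<pi> x) * ennreal (accept \<pi> x y * q y)" for x y
  proof -
    have "min (\<pi> x) (\<pi> (x + y)) = \<pi> x * accept \<pi> x y"
      using \<pi>_pos[of x] by (auto simp: accept_def min_def field_simps)
    then show ?thesis using \<pi>_pos[of x]
      by (simp add: s_def mult.assoc ennreal_mult' less_imp_le)
  qed
  have "(\<integral>\<^sup>+x. (\<integral>\<^sup>+y. s x y * indicator A (x + y) \<partial>lborel) \<partial>lborel) =
      (\<integral>\<^sup>+y. (\<integral>\<^sup>+x. s x y * indicator A (x + y) \<partial>lborel) \<partial>lborel)"
    by (rule lborel_pair.Fubini') measurable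
  also have "\<dots> = (\<integral>\<^sup>+y. (\<integral>\<^sup>+x. s (- y + x) y * indicator A (- y + x + y) \<partial>lborel) \<partial>lborel)"
    by (intro nn_integral_cong nn_integral_lborel_translate[symmetric]) measurable
  also have "\<dots> = (\<integral>\<^sup>+y. (\<integral>\<^sup>+x. s x (- y) * indicator A x \<partial>lborel) \<partial>lborel)"
    by (intro nn_integral_cong) (simp add: s_def q_sym min.commute)
  also have "\<dots> = (\<integral>\<^sup>+x. (\<integral>\<^sup>+y. s x (- y) * indicator A x \<partial>lborel) \<partial>lborel)"
    by (rule lborel_pair.Fubini'[symmetric]) measurable
  also have "\<dots> = (\<integral>\<^sup>+x. (\<integral>\<^sup>+y. s x y * indicator A x \<partial>lborel) \<partial>lborel)"
    by (intro nn_integral_cong nn_integral_lborel_reflect) measurable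
  finally have balance: "(\<integral>\<^sup>+x. (\<integral>\<^sup>+y. s x y * indicator A (x + y) \<partial>lborel) \<partial>lborel) =
      (\<integral>\<^sup>+x. (\<integral>\<^sup>+y. s x y * indicator A x \<partial>lborel) \<partial>lborel)" .
  define c where "c x = (\<integral>\<^sup>+y. ennreal ((1 - accept \<pi> x y) * q y) \<partial>lborel)" for x
  have [measurable]: "c \<in> borel_measurable borel"
    unfolding c_def by measurable
  have "(\<integral>\<^sup>+x. emeasure (srwm \<pi> q x) A \<partial>density lborel \<pi>) =
      (\<integral>\<^sup>+x. ennreal (\<pi> x) * emeasure (srwm \<pi> q x) A \<partial>lborel)"
    by (rule nn_integral_density) auto
  also have "\<dots> = (\<integral>\<^sup>+x. (\<integral>\<^sup>+y. s x y * indicator A (x + y) \<partial>lborel) + ennreal (\<pi> x) * (indicator A x * c x) \<partial>lborel)"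
  proof (rule nn_integral_cong)
    fix x
    have "(\<integral>\<^sup>+y. s x y * indicator A (x + y) \<partial>lborel) =
        ennreal (\<pi> x) * (\<integral>\<^sup>+y. ennreal (accept \<pi> x y * q y) * indicator A (x + y) \<partial>lborel)"
      unfolding s_acc by (subst nn_integral_cmult[symmetric]) (auto simp: mult.assoc)
    moreover have "emeasure (srwm \<pi> q x) A =
        (\<integral>\<^sup>+y. ennreal (accept \<pi> x y * q y) * indicator A (x + y) \<partial>lborel) + indicator A x * c x"
      using nn_integral_srwm[of "indicator A" x] by (simp add: c_def)
    ultimately show "ennreal (\<pi> x) * emeasure (srwm \<pi> q x) A =
        (\<integral>\<^sup>+y. s x y * indicator A (x + y) \<partial>lborel) + ennreal (\<pi> x) * (indicator A x * c x)"
      by (simp add: distrib_left)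
  qed
  also have "\<dots> = (\<integral>\<^sup>+x. (\<integral>\<^sup>+y. s x y * indicator A x \<partial>lborel) \<partial>lborel) +
      (\<integral>\<^sup>+x. ennreal (\<pi> x) * (indicator A x * c x) \<partial>lborel)"
    by (subst nn_integral_add) (auto simp: balance)
  also have "\<dots> = (\<integral>\<^sup>+x. (\<integral>\<^sup>+y. s x y * indicator A x \<partial>lborel) + ennreal (\<pi> x) * (indicator A x * c x) \<partial>lborel)"
    by (rule nn_integral_add[symmetric]) measurable
  also have "\<dots> = (\<integral>\<^sup>+x. ennreal (\<pi> x) * indicator A x \<partial>lborel)"
  proof (rule nn_integral_cong)
    fix x
    have "(\<integral>\<^sup>+y. s x y * indicator A x \<partial>lborel) =
        ennreal (\<pi> x) * indicator A x * (\<integral>\<^sup>+y. ennreal (accept \<pi> x y * q y) \<partial>lborel)"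
      unfolding s_acc by (subst nn_integral_cmult[symmetric]) (auto simp: ac_simps)
    moreover have "(\<integral>\<^sup>+y. ennreal (accept \<pi> x y * q y) \<partial>lborel) + c x = 1"
    proof -
      have "(\<integral>\<^sup>+y. ennreal (accept \<pi> x y * q y) \<partial>lborel) + c x =
          (\<integral>\<^sup>+y. ennreal (accept \<pi> x y * q y) + ennreal ((1 - accept \<pi> x y) * q y) \<partial>lborel)"
        unfolding c_def by (rule nn_integral_add[symmetric]) measurable
      also have "\<dots> = (\<integral>\<^sup>+y. ennreal (q y) \<partial>lborel)"
        using accept_nonneg[of x] accept_le_1[of x] q_nonneg
        by (intro nn_integral_cong, subst ennreal_plus[symmetric])
          (auto simp: algebra_simps mult_right_le_one_le)
      finally show ?thesis by (simp add: nn_integral_q)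
    qed
    ultimately show "(\<integral>\<^sup>+y. s x y * indicator A x \<partial>lborel) + ennreal (\<pi> x) * (indicator A x * c x) =
        ennreal (\<pi> x) * indicator A x"
      by (simp add: mult.assoc flip: distrib_left)
  qed
  also have "\<dots> = emeasure (density lborel \<pi>) A" by (simp add: emeasure_density)
  finally show "emeasure (density lborel \<pi>) A = (\<integral>\<^sup>+x. emeasure (srwm \<pi> q x) A \<partial>density lborel \<pi>)" by simp
qed simp

section \<open>Minorization on balls\<close>

text \<open>The sets where \<open>q\<close> is at least 1 / (k + 1) within radius \<open>k\<close>
  exhaust the set where \<open>q\<close> is positive, so one of them has positive measure. Evenness
  of \<open>q\<close> makes each of them symmetric.\<close>

lemma increment_lower_bound:
  "\<exists>E \<eta> L. E \<in> sets borel \<and> (\<forall>y. - y \<in> E \<longleftrightarrow> y \<in> E) \<and> 0 < emeasure lborel E \<and> 0 < \<eta> \<and> 0 \<le> L \<and>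
    (\<forall>y\<in>E. norm y \<le> L \<and> \<eta> \<le> q y)"
proof -
  define E where "E k = {y. inverse (real (Suc k)) \<le> q y \<and> norm y \<le> real k}" for k
  have Em[measurable]: "E k \<in> sets borel" for k unfolding E_def by measurable
  have "\<exists>k. emeasure lborel (E k) \<noteq> 0"
  proof (rule ccontr)
    assume "\<not> ?thesis"
    then have "(\<Union>k. E k) \<in> null_sets lborel" by (intro null_sets_UN) auto
    moreover have "{y\<in>space lborel. \<not> q y = 0} \<subseteq> (\<Union>k. E k)"
    proof safe
      fix y assume "q y \<noteq> 0"
      then have "0 < q y" using q_nonneg[of y] by simp
      then obtain n where n: "inverse (real (Suc n)) < q y" using reals_Archimedean by blast
      obtain m where m: "norm y \<le> real m" using real_arch_simple by blast
      have "inverse (real (Suc (max n m))) \<le> inverse (real (Suc n))" by (intro le_imp_inverse_le) auto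
      then have "inverse (real (Suc (max n m))) \<le> q y" using n by linarith
      moreover have "norm y \<le> real (max n m)" using m by linarith
      ultimately show "y \<in> (\<Union>k. E k)" unfolding E_def by blast
    qed
    ultimately have "AE y in lborel. q y = 0" by (rule AE_I')
    then have "AE y in lborel. ennreal (q y) = 0" by eventually_elim simp
    then have "(\<integral>\<^sup>+y. ennreal (q y) \<partial>lborel) = (\<integral>\<^sup>+y. 0 \<partial>(lborel :: 'a measure))"
      by (rule nn_integral_cong_AE)
    then show False by (simp add: nn_integral_q)
  qed
  then obtain k where "0 < emeasure lborel (E k)" by (auto simp: zero_less_iff_neq_zero)
  then show ?thesis
    by (intro exI[of _ "E k"] exI[of _ "inverse (real (Suc k))"] exI[of _ "real k"])
      (auto simp: E_def q_sym)
qed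

text \<open>Both \<open>x\<close> and \<open>x + y\<close> lie in a fixed compact ball, on which the
  continuous positive density attains its extrema.\<close>

lemma accept_lower_bound:
  "\<exists>c>0. \<forall>x y. norm x \<le> r \<longrightarrow> norm y \<le> L \<longrightarrow> c \<le> accept \<pi> x y"
proof (cases "0 \<le> r \<and> 0 \<le> L")
  case True
  have c: "compact (cball (0::'a) (r + L))" "cball (0::'a) (r + L) \<noteq> {}" using True by auto
  obtain a where a: "a \<in> cball 0 (r + L)" "\<And>x. x \<in> cball 0 (r + L) \<Longrightarrow> \<pi> a \<le> \<pi> x"
    using continuous_attains_inf[OF c continuous_on_subset[OF \<pi>_cont]] by auto
  obtain b where b: "b \<in> cball 0 (r + L)" "\<And>x. x \<in> cball 0 (r + L) \<Longrightarrow> \<pi> x \<le> \<pi> b"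
    using continuous_attains_sup[OF c continuous_on_subset[OF \<pi>_cont]] by auto
  have "min 1 (\<pi> a / \<pi> b) \<le> accept \<pi> x y" if "norm x \<le> r" "norm y \<le> L" for x y
  proof -
    have "x \<in> cball 0 (r + L)" "x + y \<in> cball 0 (r + L)"
      using that True norm_triangle_ineq[of x y] by auto
    then have "\<pi> a / \<pi> b \<le> \<pi> (x + y) / \<pi> x"
      using a b \<pi>_pos by (intro frac_le) (auto simp: less_imp_le)
    then show ?thesis by (auto simp: accept_def)
  qed
  then show ?thesis using \<pi>_pos by (intro exI[of _ "min 1 (\<pi> a / \<pi> b)"]) auto
next
  case False
  have "\<not> (norm x \<le> r \<and> norm y \<le> L)" for x y :: 'a
    using False norm_ge_zero[of x] norm_ge_zero[of y] by linarith
  then show ?thesis by (intro exI[of _ 1]) auto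
qed

lemma nn_integral_srwm_ge:
  assumes [measurable]: "E \<in> sets borel" "f \<in> borel_measurable borel"
    and le: "\<And>y. y \<in> E \<Longrightarrow> c \<le> accept \<pi> x y * q y" and c: "0 \<le> c"
  shows "(\<integral>\<^sup>+z. ennreal c * indicator E (z - x) * f z \<partial>lborel) \<le> (\<integral>\<^sup>+z. f z \<partial>srwm \<pi> q x)"
proof -
  have "(\<integral>\<^sup>+z. ennreal c * indicator E (z - x) * f z \<partial>lborel) =
      (\<integral>\<^sup>+y. ennreal c * indicator E ((x + y) - x) * f (x + y) \<partial>lborel)"
    by (rule nn_integral_lborel_translate[symmetric]) measurable
  also have "\<dots> \<le> (\<integral>\<^sup>+y. ennreal (accept \<pi> x y * q y) * f (x + y) \<partial>lborel)"
    using le by (intro nn_integral_mono mult_right_mono) (auto split: split_indicator intro: ennreal_leI)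
  also have "\<dots> \<le> (\<integral>\<^sup>+z. f z \<partial>srwm \<pi> q x)"
    by (simp add: nn_integral_srwm)
  finally show ?thesis .
qed

abbreviation "Pn \<equiv> kernel_pow (srwm \<pi> q)"

text \<open>By symmetry of \<open>E\<close>, the midpoints between \<open>x\<close> and
  \<open>w\<close> form a translate of the overlap of \<open>E\<close> with its translate by
  \<open>w - x\<close>, which Steinhaus bounds below for small \<open>w - x\<close>. The order of
  quantifiers matters: \<delta> comes from \<open>q\<close> alone, and only \<epsilon> deteriorates
  with \<open>r\<close> through the acceptance probability. The iteration can therefore enlarge
  \<open>r\<close> at a fixed step size.\<close>

lemma two_step_minorization:
  "\<exists>\<delta>>0. \<forall>r. \<exists>\<epsilon>>0. \<forall>x A. norm x \<le> r \<longrightarrow> A \<in> sets borel \<longrightarrow>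
     ennreal \<epsilon> * emeasure lborel (A \<inter> ball x \<delta>) \<le> emeasure (Pn 2 x) A"
proof -
  obtain E \<eta> L where E[measurable]: "E \<in> sets borel" and Esym: "\<And>y. - y \<in> E \<longleftrightarrow> y \<in> E"
    and Epos: "0 < emeasure lborel E" and \<eta>: "0 < \<eta>" and L: "0 \<le> L"
    and Eq: "\<And>y. y \<in> E \<Longrightarrow> norm y \<le> L" "\<And>y. y \<in> E \<Longrightarrow> \<eta> \<le> q y"
    using increment_lower_bound by blast
  have "bounded E" using Eq(1) by (auto simp: bounded_iff)
  then obtain \<delta> e where \<delta>: "\<delta> > 0" and e: "e > 0"
    and overlap: "\<And>w. norm w < \<delta> \<Longrightarrow> ennreal e \<le> emeasure lborel {z. z \<in> E \<and> z - w \<in> E}"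
    using steinhaus_overlap[OF E _ Epos] by blast
  have "\<exists>\<epsilon>>0. \<forall>x A. norm x \<le> r \<longrightarrow> A \<in> sets borel \<longrightarrow>
     ennreal \<epsilon> * emeasure lborel (A \<inter> ball x \<delta>) \<le> emeasure (Pn 2 x) A" for r
  proof -
    obtain c where c: "c > 0" "\<And>x y. norm x \<le> r + L \<Longrightarrow> norm y \<le> L \<Longrightarrow> c \<le> accept \<pi> x y"
      using accept_lower_bound[of "r + L" L] by blast
    have ce: "c * \<eta> \<le> accept \<pi> x y * q y" if "norm x \<le> r + L" "y \<in> E" for x y
      using c \<eta> Eq that by (intro mult_mono) (auto simp: accept_nonneg)
    have "ennreal ((c * \<eta>) * (c * \<eta>) * e) * emeasure lborel (A \<inter> ball x \<delta>) \<le> emeasure (Pn 2 x) A"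
      if x: "norm x \<le> r" and A[measurable]: "A \<in> sets borel" for x A
    proof -
      let ?k = "ennreal (c * \<eta>)"
      have "?k * ?k * ennreal e * emeasure lborel (A \<inter> ball x \<delta>) \<le>
          (\<integral>\<^sup>+z. ?k * indicator E (z - x) * emeasure (srwm \<pi> q z) A \<partial>lborel)"
      proof (rule nn_integral_two_step_ge[where F=E])
        fix w assume "w \<in> ball x \<delta>"
        then have "ennreal e \<le> emeasure lborel {z. z \<in> E \<and> z - (w - x) \<in> E}"
          by (intro overlap) (simp add: dist_norm norm_minus_commute)
        also have "{z. z \<in> E \<and> z - (w - x) \<in> E} = {z. x + z \<in> {z. z - x \<in> E \<and> w - z \<in> E}}"
        proof -
          have "w - (x + z) \<in> E \<longleftrightarrow> z - (w - x) \<in> E" for z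
            using Esym[of "z - (w - x)"] by (simp add: algebra_simps)
          then show ?thesis by auto
        qed
        also have "emeasure lborel \<dots> = emeasure lborel {z. z - x \<in> E \<and> w - z \<in> E}"
          by (rule emeasure_lborel_translate) measurable
        finally show "ennreal e \<le> emeasure lborel {z. z - x \<in> E \<and> w - z \<in> E}" .
      next
        fix z assume z: "z - x \<in> E"
        have "norm z \<le> r + L" using norm_triangle_ineq[of x "z - x"] Eq(1)[OF z] x by simp
        then have "(\<integral>\<^sup>+w. ?k * indicator E (w - z) * indicator A w \<partial>lborel) \<le> (\<integral>\<^sup>+w. indicator A w \<partial>srwm \<pi> q z)"
          using c \<eta> by (intro nn_integral_srwm_ge ce) auto
        then show "(\<integral>\<^sup>+w. ?k * indicator E (w - z) * indicator A w \<partial>lborel) \<le> emeasure (srwm \<pi> q z) A" by simp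
      qed auto
      then have "ennreal ((c * \<eta>) * (c * \<eta>) * e) * emeasure lborel (A \<inter> ball x \<delta>) \<le>
          (\<integral>\<^sup>+z. ?k * indicator E (z - x) * emeasure (srwm \<pi> q z) A \<partial>lborel)"
        using c \<eta> e by (simp add: ennreal_mult)
      also have "\<dots> \<le> (\<integral>\<^sup>+z. emeasure (srwm \<pi> q z) A \<partial>srwm \<pi> q x)"
        using c \<eta> x L by (intro nn_integral_srwm_ge ce) auto
      also have "\<dots> = emeasure (Pn 2 x) A"
        using emeasure_kernel_pow_add[OF A, of "Suc 0" "Suc 0" x]
        by (simp add: kernel_pow_1 numeral_2_eq_2 del: kernel_pow.simps)
      finally show ?thesis .
    qed
    then show ?thesis using c \<eta> e by (intro exI[of _ "(c * \<eta>) * (c * \<eta>) * e"]) auto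
  qed
  then show ?thesis using \<delta> by blast
qed

lemma emeasure_ball_overlap:
  fixes x w :: 'a
  assumes "0 < a" "0 < \<delta>" "\<delta> \<le> 2 * a" "dist x w < a + \<delta> / 2"
  shows "emeasure lborel (ball (0::'a) (\<delta> / 4)) \<le> emeasure lborel (ball x \<delta> \<inter> ball w a)"
proof -
  \<comment> \<open>The point \<open>v\<close> divides the segment from \<open>x\<close> to
    \<open>w\<close> so that, at the extreme distance a + \<delta>/2, it is 3\<delta>/4 from
    \<open>x\<close> and a - \<delta>/4 from \<open>w\<close>. Both balls then have room for a ball
    of radius \<delta>/4 around \<open>v\<close>.\<close>
  define t where "t = (3 / 4 * \<delta>) / (a + \<delta> / 2)"
  have t: "0 \<le> t" "t \<le> 1" using assms by (auto simp: t_def field_simps)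
  have "a + \<delta> / 2 \<noteq> 0" using assms by linarith
  then have ta: "t * (a + \<delta> / 2) = 3 / 4 * \<delta>"
    using t_def nonzero_eq_divide_eq by blast
  define v where "v = x + t *\<^sub>R (w - x)"
  have "dist x v = t * dist x w"
    using t by (simp add: v_def dist_norm norm_minus_commute)
  also have "\<dots> \<le> t * (a + \<delta> / 2)" using assms t by (intro mult_left_mono) auto
  also note ta
  finally have 1: "dist x v \<le> 3 / 4 * \<delta>" .
  have "w - v = (1 - t) *\<^sub>R (w - x)" by (simp add: v_def algebra_simps)
  then have "dist w v = (1 - t) * dist x w"
    using t by (simp add: dist_norm norm_minus_commute)
  also have "\<dots> \<le> (1 - t) * (a + \<delta> / 2)" using assms t by (intro mult_left_mono) auto
  also have "\<dots> = a - \<delta> / 4" using ta by (simp add: left_diff_distrib)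
  finally have 2: "dist w v \<le> a - \<delta> / 4" .
  have "ball v (\<delta> / 4) \<subseteq> ball x \<delta> \<inter> ball w a"
  proof
    fix z assume "z \<in> ball v (\<delta> / 4)"
    then show "z \<in> ball x \<delta> \<inter> ball w a"
      using 1 2 dist_triangle[of x z v] dist_triangle[of w z v] by auto
  qed
  then have "emeasure lborel (ball v (\<delta> / 4)) \<le> emeasure lborel (ball x \<delta> \<inter> ball w a)"
    by (intro emeasure_mono) auto
  moreover have "emeasure lborel (ball v (\<delta> / 4)) = emeasure lborel (ball (0::'a) (\<delta> / 4))"
  proof -
    have "emeasure lborel {z. - v + z \<in> ball 0 (\<delta> / 4)} = emeasure lborel (ball (0::'a) (\<delta> / 4))"
      by (rule emeasure_lborel_translate) auto
    moreover have "{z. - v + z \<in> ball 0 (\<delta> / 4)} = ball v (\<delta> / 4)"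
      by (auto simp: dist_norm norm_minus_commute)
    ultimately show ?thesis by simp
  qed
  ultimately show ?thesis by simp
qed

text \<open>Each further pair of steps gains \<delta>/2 in radius. Gaining only half of \<delta>
  keeps the volume of midpoints bounded below up to the boundary of the larger ball. The induction
  hypothesis is used at \<open>r + \<delta>\<close>, where the midpoints lie.\<close>

lemma iterated_minorization:
  assumes \<delta>: "\<delta> > 0" and two: "\<And>r. \<exists>\<epsilon>>0. \<forall>x A. norm x \<le> r \<longrightarrow> A \<in> sets borel \<longrightarrow>
     ennreal \<epsilon> * emeasure lborel (A \<inter> ball x \<delta>) \<le> emeasure (Pn 2 x) A"
  shows "\<exists>\<epsilon>>0. \<forall>x A. norm x \<le> r \<longrightarrow> A \<in> sets borel \<longrightarrow>
     ennreal \<epsilon> * emeasure lborel (A \<inter> ball x (Suc m * (\<delta> / 2))) \<le> emeasure (Pn (2 * Suc m) x) A"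
proof (induction m arbitrary: r)
  case 0
  obtain \<epsilon> where \<epsilon>: "\<epsilon> > 0" "\<And>x A. norm x \<le> r \<Longrightarrow> A \<in> sets borel \<Longrightarrow>
     ennreal \<epsilon> * emeasure lborel (A \<inter> ball x \<delta>) \<le> emeasure (Pn 2 x) A"
    using two[of r] by blast
  have "ennreal \<epsilon> * emeasure lborel (A \<inter> ball x (Suc 0 * (\<delta> / 2))) \<le> emeasure (Pn (2 * Suc 0) x) A"
    if "norm x \<le> r" "A \<in> sets borel" for x A
  proof -
    have "emeasure lborel (A \<inter> ball x (Suc 0 * (\<delta> / 2))) \<le> emeasure lborel (A \<inter> ball x \<delta>)"
      using \<delta> that by (intro emeasure_mono) auto
    then have "ennreal \<epsilon> * emeasure lborel (A \<inter> ball x (Suc 0 * (\<delta> / 2))) \<le> ennreal \<epsilon> * emeasure lborel (A \<inter> ball x \<delta>)"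
      by (rule mult_left_mono) simp
    also note \<epsilon>(2)[OF that]
    finally show ?thesis by simp
  qed
  then show ?case using \<epsilon>(1) by blast
next
  case (Suc m)
  define a where "a = Suc m * (\<delta> / 2)"
  have "1 * \<delta> \<le> real (Suc m) * \<delta>" using \<delta> by (intro mult_right_mono) auto
  then have a: "a > 0" "\<delta> \<le> 2 * a" using \<delta> by (auto simp: a_def)
  have a': "Suc (Suc m) * (\<delta> / 2) = a + \<delta> / 2" by (simp add: a_def field_simps)
  obtain \<epsilon>1 where \<epsilon>1: "\<epsilon>1 > 0" "\<And>x A. norm x \<le> r \<Longrightarrow> A \<in> sets borel \<Longrightarrow>
     ennreal \<epsilon>1 * emeasure lborel (A \<inter> ball x \<delta>) \<le> emeasure (Pn 2 x) A"
    using two[of r] by blast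
  obtain \<epsilon>2 where \<epsilon>2: "\<epsilon>2 > 0" "\<And>x A. norm x \<le> r + \<delta> \<Longrightarrow> A \<in> sets borel \<Longrightarrow>
     ennreal \<epsilon>2 * emeasure lborel (A \<inter> ball x a) \<le> emeasure (Pn (2 * Suc m) x) A"
    using Suc.IH[of "r + \<delta>"] unfolding a_def by blast
  have [measurable]: "ball y e \<in> sets borel" for y :: 'a and e by auto
  define b where "b = measure lborel (ball (0::'a) (\<delta> / 4))"
  have b: "b > 0" "emeasure lborel (ball (0::'a) (\<delta> / 4)) = ennreal b"
    using \<delta> content_ball_pos[of "\<delta> / 4" "0::'a"] emeasure_bounded_finite[of "ball (0::'a) (\<delta> / 4)"]
      emeasure_eq_ennreal_measure[of lborel "ball (0::'a) (\<delta> / 4)"]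
    unfolding b_def by (simp_all add: less_top)
  have "ennreal (\<epsilon>1 * \<epsilon>2 * b) * emeasure lborel (A \<inter> ball x (Suc (Suc m) * (\<delta> / 2)))
      \<le> emeasure (Pn (2 * Suc (Suc m)) x) A"
    if x: "norm x \<le> r" and A[measurable]: "A \<in> sets borel" for x A
  proof -
    have "ennreal \<epsilon>1 * ennreal \<epsilon>2 * ennreal b * emeasure lborel (A \<inter> ball x (a + \<delta> / 2)) \<le>
        (\<integral>\<^sup>+z. ennreal \<epsilon>1 * indicator (ball 0 \<delta>) (z - x) * emeasure (Pn (2 * Suc m) z) A \<partial>lborel)"
    proof (rule nn_integral_two_step_ge[where F="ball 0 a"])
      fix w assume "w \<in> ball x (a + \<delta> / 2)"
      then have "ennreal b \<le> emeasure lborel (ball x \<delta> \<inter> ball w a)"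
        using emeasure_ball_overlap[OF a(1) \<delta> a(2), of x w] b by simp
      also have "ball x \<delta> \<inter> ball w a = {z. z - x \<in> ball 0 \<delta> \<and> w - z \<in> ball 0 a}"
        by (auto simp: dist_norm norm_minus_commute)
      finally show "ennreal b \<le> emeasure lborel {z. z - x \<in> ball 0 \<delta> \<and> w - z \<in> ball 0 a}" .
    next
      fix z assume "z - x \<in> ball 0 \<delta>"
      then have "norm z \<le> r + \<delta>" using norm_triangle_ineq[of x "z - x"] x by simp
      then have le: "ennreal \<epsilon>2 * emeasure lborel (A \<inter> ball z a) \<le> emeasure (Pn (2 * Suc m) z) A"
        by (rule \<epsilon>2(2)) simp
      have "(\<integral>\<^sup>+w. ennreal \<epsilon>2 * indicator (ball 0 a) (w - z) * indicator A w \<partial>lborel) =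
          (\<integral>\<^sup>+w. ennreal \<epsilon>2 * indicator (ball z a) w * indicator A w \<partial>lborel)"
        by (intro nn_integral_cong) (auto split: split_indicator simp: dist_norm norm_minus_commute)
      also have "\<dots> = ennreal \<epsilon>2 * emeasure lborel (A \<inter> ball z a)"
        by (rule mult_emeasure_lborel_Int[symmetric]) auto
      finally show "(\<integral>\<^sup>+w. ennreal \<epsilon>2 * indicator (ball 0 a) (w - z) * indicator A w \<partial>lborel)
          \<le> emeasure (Pn (2 * Suc m) z) A" using le by simp
    qed auto
    then have "ennreal (\<epsilon>1 * \<epsilon>2 * b) * emeasure lborel (A \<inter> ball x (a + \<delta> / 2)) \<le>
        (\<integral>\<^sup>+z. ennreal \<epsilon>1 * indicator (ball 0 \<delta>) (z - x) * emeasure (Pn (2 * Suc m) z) A \<partial>lborel)"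
      using \<epsilon>1 \<epsilon>2 b by (simp add: ennreal_mult)
    also have "\<dots> = (\<integral>\<^sup>+z. ennreal \<epsilon>1 * indicator (ball x \<delta>) z * emeasure (Pn (2 * Suc m) z) A \<partial>lborel)"
      by (intro nn_integral_cong) (auto split: split_indicator simp: dist_norm norm_minus_commute)
    also have "\<dots> = (\<integral>\<^sup>+z. emeasure (Pn (2 * Suc m) z) A \<partial>density lborel (\<lambda>z. ennreal \<epsilon>1 * indicator (ball x \<delta>) z))"
      by (rule nn_integral_density[symmetric]) measurable
    also have "\<dots> \<le> (\<integral>\<^sup>+z. emeasure (Pn (2 * Suc m) z) A \<partial>Pn 2 x)"
    proof (rule nn_integral_mono_measure)
      show "density lborel (\<lambda>z. ennreal \<epsilon>1 * indicator (ball x \<delta>) z) \<le> Pn 2 x"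
        unfolding le_measure_iff
      proof (simp, rule le_funI)
        fix B :: "'a set"
        let ?D = "density lborel (\<lambda>z. ennreal \<epsilon>1 * indicator (ball x \<delta>) z)"
        show "emeasure ?D B \<le> emeasure (Pn 2 x) B"
        proof (cases "B \<in> sets borel")
          case True
          then have "emeasure ?D B = ennreal \<epsilon>1 * emeasure lborel (B \<inter> ball x \<delta>)"
            by (rule emeasure_density_indicator) simp
          then show ?thesis using \<epsilon>1(2)[OF x True] by simp
        qed (simp add: emeasure_notin_sets)
      qed
    qed simp
    also have "\<dots> = emeasure (Pn (2 + 2 * Suc m) x) A"
      by (rule emeasure_kernel_pow_add[symmetric]) simp
    finally show ?thesis unfolding a' by (simp del: kernel_pow.simps)
  qed
  then show ?case using \<epsilon>1 \<epsilon>2 b by (intro exI[of _ "\<epsilon>1 * \<epsilon>2 * b"]) auto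
qed

lemma ball_minorization:
  "\<exists>n\<ge>1. \<exists>\<nu>. sets \<nu> = sets borel \<and> emeasure \<nu> UNIV > 0 \<and>
    (\<forall>x A. norm x \<le> r \<longrightarrow> A \<in> sets borel \<longrightarrow> emeasure \<nu> A \<le> emeasure (Pn n x) A)"
proof -
  obtain \<delta> where \<delta>: "\<delta> > 0" and two: "\<And>r. \<exists>\<epsilon>>0. \<forall>x A. norm x \<le> r \<longrightarrow> A \<in> sets borel \<longrightarrow>
     ennreal \<epsilon> * emeasure lborel (A \<inter> ball x \<delta>) \<le> emeasure (Pn 2 x) A"
    using two_step_minorization by blast
  \<comment> \<open>From any \<open>x\<close> of norm at most \<open>r\<close>, radius r + 1 covers
    the unit ball around 0, which supports the common minorant \<nu>.\<close>
  obtain m :: nat where "(r + 1) / (\<delta> / 2) \<le> m" using real_arch_simple by blast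
  then have m: "r + 1 \<le> Suc m * (\<delta> / 2)" using \<delta> by (simp add: field_simps)
  obtain \<epsilon> where \<epsilon>: "\<epsilon> > 0" and min: "\<And>x A. norm x \<le> r \<Longrightarrow> A \<in> sets borel \<Longrightarrow>
     ennreal \<epsilon> * emeasure lborel (A \<inter> ball x (Suc m * (\<delta> / 2))) \<le> emeasure (Pn (2 * Suc m) x) A"
    using iterated_minorization[OF \<delta> two, of r m] by blast
  define \<nu> where "\<nu> = density lborel (\<lambda>z. ennreal \<epsilon> * indicator (ball (0::'a) 1) z)"
  have \<nu>: "emeasure \<nu> A = ennreal \<epsilon> * emeasure lborel (A \<inter> ball 0 1)" if [measurable]: "A \<in> sets borel" for A
    unfolding \<nu>_def
    by (rule emeasure_density_indicator) auto
  have "emeasure \<nu> A \<le> emeasure (Pn (2 * Suc m) x) A"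
    if x: "norm x \<le> r" and A: "A \<in> sets borel" for x A
  proof -
    have "ball 0 1 \<subseteq> ball x (Suc m * (\<delta> / 2))"
    proof
      fix z assume "z \<in> ball (0::'a) 1"
      then have "dist x z < r + 1" using norm_triangle_ineq4[of x z] x by (simp add: dist_norm)
      then show "z \<in> ball x (Suc m * (\<delta> / 2))" using m by simp
    qed
    then have "emeasure \<nu> A \<le> ennreal \<epsilon> * emeasure lborel (A \<inter> ball x (Suc m * (\<delta> / 2)))"
      unfolding \<nu>[OF A] using A by (intro mult_left_mono emeasure_mono) auto
    also note min[OF that]
    finally show ?thesis .
  qed
  moreover have "emeasure \<nu> UNIV > 0"
  proof -
    have "0 < measure lborel (ball (0::'a) 1)" by (rule content_ball_pos) simp
    then have "0 < emeasure lborel (ball (0::'a) 1)"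
      by (auto simp: measure_def enn2real_positive_iff)
    then show ?thesis using \<epsilon> by (simp add: \<nu> ennreal_zero_less_mult_iff)
  qed
  moreover have "sets \<nu> = sets borel" by (simp add: \<nu>_def)
  ultimately show ?thesis by (intro exI[of _ "2 * Suc m"] conjI exI[of _ \<nu>]) auto
qed

end

section \<open>Increments of polynomials and slowly varying functions\<close>

definition growth_le :: "('a::real_normed_vector \<Rightarrow> real) \<Rightarrow> nat \<Rightarrow> bool" where
  "growth_le f k \<longleftrightarrow> (\<exists>C. \<forall>x. \<bar>f x\<bar> \<le> C * (1 + norm x) ^ k)"

text \<open>A Taylor expansion with remainder of order k - 2, uniform for increments in a ball. The
  quotient of powers stands in for the exponent k - 2, which natural subtraction would truncate for
  k < 2; the base \<open>1 + norm x\<close> makes the bound meaningful at 0 and monotone in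
  \<open>k\<close>.\<close>

definition first_order :: "('a::real_inner \<Rightarrow> real) \<Rightarrow> ('a \<Rightarrow> 'a) \<Rightarrow> nat \<Rightarrow> bool" where
  "first_order f G k \<longleftrightarrow> (\<forall>L. \<exists>C. \<forall>x y. norm y \<le> L \<longrightarrow>
     \<bar>f (x + y) - f x - G x \<bullet> y\<bar> \<le> C * ((1 + norm x) ^ k / (1 + norm x)\<^sup>2))"

lemma growth_le_cmult: "growth_le f k \<Longrightarrow> growth_le (\<lambda>x. c * f x) k"
  unfolding growth_le_def
proof (elim exE)
  fix C assume "\<forall>x. \<bar>f x\<bar> \<le> C * (1 + norm x) ^ k"
  then have "\<forall>x. \<bar>c * f x\<bar> \<le> (\<bar>c\<bar> * C) * (1 + norm x) ^ k"
    by (simp add: abs_mult mult.assoc mult_left_mono)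
  then show "\<exists>C. \<forall>x. \<bar>c * f x\<bar> \<le> C * (1 + norm x) ^ k" by blast
qed

lemma growth_le_add: "growth_le f k \<Longrightarrow> growth_le g k \<Longrightarrow> growth_le (\<lambda>x. f x + g x) k"
  unfolding growth_le_def
proof (elim exE)
  fix C D assume *: "\<forall>x. \<bar>f x\<bar> \<le> C * (1 + norm x) ^ k" "\<forall>x. \<bar>g x\<bar> \<le> D * (1 + norm x) ^ k"
  have "\<bar>f x + g x\<bar> \<le> (C + D) * (1 + norm x) ^ k" for x
    using *[rule_format, of x] abs_triangle_ineq[of "f x" "g x"] by (simp add: distrib_right)
  then show "\<exists>C. \<forall>x. \<bar>f x + g x\<bar> \<le> C * (1 + norm x) ^ k" by blast
qed

lemma growth_le_sum:
  assumes "finite A" "\<And>a. a \<in> A \<Longrightarrow> growth_le (f a) k"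
  shows "growth_le (\<lambda>x. \<Sum>a\<in>A. f a x) k"
  using assms
proof (induction rule: finite_induct)
  case empty then show ?case by (auto simp: growth_le_def intro!: exI[of _ 0])
qed (auto intro: growth_le_add)

lemma growth_le_mono:
  assumes "growth_le f k" "k \<le> l"
  shows "growth_le f l"
proof -
  obtain C where C: "\<And>x. \<bar>f x\<bar> \<le> C * (1 + norm x) ^ k" using assms by (auto simp: growth_le_def)
  have C0: "0 \<le> C" using C[of 0] by simp
  have "\<bar>f x\<bar> \<le> C * (1 + norm x) ^ l" for x
    using C[of x] mult_left_mono[OF power_increasing[OF assms(2), of "1 + norm x"] C0] by simp
  then show ?thesis by (auto simp: growth_le_def)
qed

lemma first_order_cmult: "first_order f G k \<Longrightarrow> first_order (\<lambda>x. c * f x) (\<lambda>x. c *\<^sub>R G x) k"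
  unfolding first_order_def
proof
  fix L assume "\<forall>L. \<exists>C. \<forall>x y. norm y \<le> L \<longrightarrow>
     \<bar>f (x + y) - f x - G x \<bullet> y\<bar> \<le> C * ((1 + norm x) ^ k / (1 + norm x)\<^sup>2)"
  then obtain C where C: "\<And>x y. norm y \<le> L \<Longrightarrow>
     \<bar>f (x + y) - f x - G x \<bullet> y\<bar> \<le> C * ((1 + norm x) ^ k / (1 + norm x)\<^sup>2)" by blast
  have "\<bar>c * f (x + y) - c * f x - (c *\<^sub>R G x) \<bullet> y\<bar> \<le> (\<bar>c\<bar> * C) * ((1 + norm x) ^ k / (1 + norm x)\<^sup>2)"
    if "norm y \<le> L" for x y
  proof -
    have "\<bar>c * f (x + y) - c * f x - (c *\<^sub>R G x) \<bullet> y\<bar> = \<bar>c\<bar> * \<bar>f (x + y) - f x - G x \<bullet> y\<bar>"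
      by (simp flip: abs_mult add: right_diff_distrib)
    then show ?thesis using mult_left_mono[OF C[OF that, of x], of "\<bar>c\<bar>"] by (simp add: mult.assoc)
  qed
  then show "\<exists>C. \<forall>x y. norm y \<le> L \<longrightarrow>
     \<bar>c * f (x + y) - c * f x - (c *\<^sub>R G x) \<bullet> y\<bar> \<le> C * ((1 + norm x) ^ k / (1 + norm x)\<^sup>2)" by blast
qed

lemma first_order_add:
  assumes "first_order f F k" "first_order g G k"
  shows "first_order (\<lambda>x. f x + g x) (\<lambda>x. F x + G x) k"
  unfolding first_order_def
proof
  fix L
  obtain C where C: "\<And>x y. norm y \<le> L \<Longrightarrow>
     \<bar>f (x + y) - f x - F x \<bullet> y\<bar> \<le> C * ((1 + norm x) ^ k / (1 + norm x)\<^sup>2)"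
    using assms(1) unfolding first_order_def by blast
  obtain D where D: "\<And>x y. norm y \<le> L \<Longrightarrow>
     \<bar>g (x + y) - g x - G x \<bullet> y\<bar> \<le> D * ((1 + norm x) ^ k / (1 + norm x)\<^sup>2)"
    using assms(2) unfolding first_order_def by blast
  have "\<bar>f (x + y) + g (x + y) - (f x + g x) - (F x + G x) \<bullet> y\<bar> \<le> (C + D) * ((1 + norm x) ^ k / (1 + norm x)\<^sup>2)"
    if "norm y \<le> L" for x y
    using C[OF that, of x] D[OF that, of x] unfolding inner_add_left distrib_right by linarith
  then show "\<exists>C. \<forall>x y. norm y \<le> L \<longrightarrow> \<bar>f (x + y) + g (x + y) - (f x + g x) - (F x + G x) \<bullet> y\<bar>
      \<le> C * ((1 + norm x) ^ k / (1 + norm x)\<^sup>2)" by blast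
qed

lemma first_order_sum:
  assumes "finite A" "\<And>a. a \<in> A \<Longrightarrow> first_order (f a) (G a) k"
  shows "first_order (\<lambda>x. \<Sum>a\<in>A. f a x) (\<lambda>x. \<Sum>a\<in>A. G a x) k"
  using assms
proof (induction rule: finite_induct)
  case empty then show ?case by (auto simp: first_order_def intro!: exI[of _ 0])
qed (auto intro: first_order_add)

lemma first_order_mono:
  assumes "first_order f G k" "k \<le> l"
  shows "first_order f G l"
  unfolding first_order_def
proof
  fix L
  obtain C where C: "\<And>x y. norm y \<le> L \<Longrightarrow>
     \<bar>f (x + y) - f x - G x \<bullet> y\<bar> \<le> C * ((1 + norm x) ^ k / (1 + norm x)\<^sup>2)"
    using assms(1) unfolding first_order_def by blast
  have "\<bar>f (x + y) - f x - G x \<bullet> y\<bar> \<le> \<bar>C\<bar> * ((1 + norm x) ^ l / (1 + norm x)\<^sup>2)" if "norm y \<le> L" for x y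
  proof -
    have "C * ((1 + norm x) ^ k / (1 + norm x)\<^sup>2) \<le> \<bar>C\<bar> * ((1 + norm x) ^ l / (1 + norm x)\<^sup>2)"
      using assms(2) by (intro mult_mono divide_right_mono power_increasing) auto
    then show ?thesis using C[OF that, of x] by linarith
  qed
  then show "\<exists>C. \<forall>x y. norm y \<le> L \<longrightarrow> \<bar>f (x + y) - f x - G x \<bullet> y\<bar> \<le> C * ((1 + norm x) ^ l / (1 + norm x)\<^sup>2)"
    by blast
qed

text \<open>The last conjunct is Euler's relation for a function homogeneous of degree \<open>k\<close> with gradient \<open>G\<close>.\<close>

definition hom_expansion :: "('a::real_inner \<Rightarrow> real) \<Rightarrow> ('a \<Rightarrow> 'a) \<Rightarrow> nat \<Rightarrow> bool" where
  "hom_expansion f G k \<longleftrightarrow> growth_le f k \<and>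
     (\<exists>C. \<forall>x. norm (G x) \<le> C * ((1 + norm x) ^ k / (1 + norm x))) \<and>
     first_order f G k \<and> (\<forall>x. G x \<bullet> x = real k * f x)"

text \<open>The product rule. With linear parts \<open>df\<close>, \<open>dg\<close> and remainders
  \<open>rf\<close>, \<open>rg\<close>, the remainder of the product is f rg + df dg + df rg + rf
  g(x + y), and each term carries two factors 1 / (1 + |x|), from one remainder or from two
  gradients.\<close>

lemma hom_expansion_mult:
  assumes f: "hom_expansion f F k" and g: "hom_expansion g G l"
  shows "hom_expansion (\<lambda>x. f x * g x) (\<lambda>x. f x *\<^sub>R G x + g x *\<^sub>R F x) (k + l)"
proof -
  obtain C where C: "\<And>x. \<bar>f x\<bar> \<le> C * (1 + norm x) ^ k"
    using f by (auto simp: hom_expansion_def growth_le_def)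
  obtain C' where C': "\<And>x. norm (F x) \<le> C' * ((1 + norm x) ^ k / (1 + norm x))"
    using f by (auto simp: hom_expansion_def)
  obtain D where D: "\<And>x. \<bar>g x\<bar> \<le> D * (1 + norm x) ^ l"
    using g by (auto simp: hom_expansion_def growth_le_def)
  obtain D' where D': "\<And>x. norm (G x) \<le> D' * ((1 + norm x) ^ l / (1 + norm x))"
    using g by (auto simp: hom_expansion_def)
  have pos: "0 \<le> C" "0 \<le> C'" "0 \<le> D" "0 \<le> D'"
    using order_trans[OF abs_ge_zero C[of 0]] order_trans[OF norm_ge_zero C'[of 0]]
      order_trans[OF abs_ge_zero D[of 0]] order_trans[OF norm_ge_zero D'[of 0]] by auto
  have N: "1 \<le> 1 + norm x" for x :: 'a by simp
  have "\<bar>f x * g x\<bar> \<le> (C * D) * (1 + norm x) ^ (k + l)" for x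
    using mult_mono[OF C[of x] D[of x]] pos by (simp add: abs_mult power_add ac_simps)
  then have 1: "growth_le (\<lambda>x. f x * g x) (k + l)" unfolding growth_le_def by blast
  have "norm (f x *\<^sub>R G x + g x *\<^sub>R F x) \<le> (C * D' + D * C') * ((1 + norm x) ^ (k + l) / (1 + norm x))" for x
  proof -
    have "norm (f x *\<^sub>R G x + g x *\<^sub>R F x) \<le> \<bar>f x\<bar> * norm (G x) + \<bar>g x\<bar> * norm (F x)"
      using norm_triangle_ineq[of "f x *\<^sub>R G x" "g x *\<^sub>R F x"] by simp
    also have "\<dots> \<le> (C * (1 + norm x) ^ k) * (D' * ((1 + norm x) ^ l / (1 + norm x))) +
        (D * (1 + norm x) ^ l) * (C' * ((1 + norm x) ^ k / (1 + norm x)))"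
      using C D C' D' pos by (intro add_mono mult_mono) auto
    also have "\<dots> = (C * D' + D * C') * ((1 + norm x) ^ (k + l) / (1 + norm x))"
      by (simp add: power_add add_divide_distrib algebra_simps)
    finally show ?thesis .
  qed
  then have 2: "\<exists>C. \<forall>x. norm (f x *\<^sub>R G x + g x *\<^sub>R F x) \<le> C * ((1 + norm x) ^ (k + l) / (1 + norm x))"
    by blast
  have 3: "first_order (\<lambda>x. f x * g x) (\<lambda>x. f x *\<^sub>R G x + g x *\<^sub>R F x) (k + l)"
    unfolding first_order_def
  proof
    fix L0 :: real
    define L where "L = max L0 0"
    have L: "0 \<le> L" by (simp add: L_def)
    obtain A where A: "\<And>x y. norm y \<le> L \<Longrightarrow>
       \<bar>f (x + y) - f x - F x \<bullet> y\<bar> \<le> A * ((1 + norm x) ^ k / (1 + norm x)\<^sup>2)"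
      using f unfolding hom_expansion_def first_order_def by blast
    obtain B where B: "\<And>x y. norm y \<le> L \<Longrightarrow>
       \<bar>g (x + y) - g x - G x \<bullet> y\<bar> \<le> B * ((1 + norm x) ^ l / (1 + norm x)\<^sup>2)"
      using g unfolding hom_expansion_def first_order_def by blast
    have AB: "0 \<le> A" "0 \<le> B" using order_trans[OF abs_ge_zero A[of 0 0]] order_trans[OF abs_ge_zero B[of 0 0]] L by auto
    define E where "E = C * B + (C' * L) * (D' * L) + (C' * L) * B + A * (D + D' * L + B)"
    have "\<bar>f (x + y) * g (x + y) - f x * g x - (f x *\<^sub>R G x + g x *\<^sub>R F x) \<bullet> y\<bar>
        \<le> E * ((1 + norm x) ^ (k + l) / (1 + norm x)\<^sup>2)" if "norm y \<le> L0" for x y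
    proof -
      have y: "norm y \<le> L" using that by (simp add: L_def)
      define n a b where "n = 1 + norm x" and "a = n ^ k" and "b = n ^ l"
      have n: "1 \<le> n" by (simp add: n_def)
      have ab: "0 \<le> a" "0 \<le> b" using n by (auto simp: a_def b_def)
      define df dg rf rg where "df = F x \<bullet> y" and "dg = G x \<bullet> y"
        and "rf = f (x + y) - f x - df" and "rg = g (x + y) - g x - dg"
      have rf: "\<bar>rf\<bar> \<le> A * (a / n\<^sup>2)" and rg: "\<bar>rg\<bar> \<le> B * (b / n\<^sup>2)"
        using A[OF y, of x] B[OF y, of x] by (auto simp: rf_def rg_def df_def dg_def a_def b_def n_def)
      have df: "\<bar>df\<bar> \<le> (C' * L) * (a / n)"
      proof -
        have "\<bar>df\<bar> \<le> norm (F x) * norm y" unfolding df_def by (rule Cauchy_Schwarz_ineq2)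
        also have "\<dots> \<le> (C' * (a / n)) * L"
          using C'[of x] y pos ab n by (intro mult_mono) (auto simp: a_def n_def)
        finally show ?thesis by (simp add: ac_simps)
      qed
      have dg: "\<bar>dg\<bar> \<le> (D' * L) * (b / n)"
      proof -
        have "\<bar>dg\<bar> \<le> norm (G x) * norm y" unfolding dg_def by (rule Cauchy_Schwarz_ineq2)
        also have "\<dots> \<le> (D' * (b / n)) * L"
          using D'[of x] y pos ab n by (intro mult_mono) (auto simp: b_def n_def)
        finally show ?thesis by (simp add: ac_simps)
      qed
      have dn: "z / n \<le> z" "z / n\<^sup>2 \<le> z" if "0 \<le> z" for z
        using that n by (auto simp: divide_le_eq mult_le_cancel_left1 one_le_power)
      have fx: "\<bar>f x\<bar> \<le> C * a" and gx: "\<bar>g x\<bar> \<le> D * b" using C D by (auto simp: a_def b_def n_def)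
      have g': "\<bar>g (x + y)\<bar> \<le> (D + D' * L + B) * b"
      proof -
        have "g (x + y) = g x + dg + rg" by (simp add: rg_def)
        then have "\<bar>g (x + y)\<bar> \<le> D * b + (D' * L) * (b / n) + B * (b / n\<^sup>2)" using gx dg rg by linarith
        also have "\<dots> \<le> D * b + (D' * L) * b + B * b"
          using dn[OF ab(2)] pos AB L by (intro add_mono mult_left_mono) auto
        finally show ?thesis by (simp add: distrib_right)
      qed
      have df': "\<bar>df\<bar> \<le> (C' * L) * a"
        using df mult_left_mono[OF dn(1)[OF ab(1)], of "C' * L"] pos L by simp
      have eq: "f (x + y) * g (x + y) - f x * g x - (f x *\<^sub>R G x + g x *\<^sub>R F x) \<bullet> y =
          f x * rg + df * dg + df * rg + rf * g (x + y)"
        by (simp add: rf_def rg_def df_def dg_def inner_add_left algebra_simps)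
      have "\<bar>f x * rg\<bar> \<le> (C * a) * (B * (b / n\<^sup>2))"
        unfolding abs_mult using fx rg pos ab by (intro mult_mono) auto
      moreover have "\<bar>df * dg\<bar> \<le> ((C' * L) * (a / n)) * ((D' * L) * (b / n))"
        unfolding abs_mult using df dg pos ab L n by (intro mult_mono) auto
      moreover have "\<bar>df * rg\<bar> \<le> ((C' * L) * a) * (B * (b / n\<^sup>2))"
        unfolding abs_mult using df' rg pos ab L by (intro mult_mono) auto
      moreover have "\<bar>rf * g (x + y)\<bar> \<le> (A * (a / n\<^sup>2)) * ((D + D' * L + B) * b)"
        unfolding abs_mult using rf g' ab AB by (intro mult_mono) auto
      ultimately have "\<bar>f x * rg + df * dg + df * rg + rf * g (x + y)\<bar> \<le>
          (C * a) * (B * (b / n\<^sup>2)) + ((C' * L) * (a / n)) * ((D' * L) * (b / n)) +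
          ((C' * L) * a) * (B * (b / n\<^sup>2)) + (A * (a / n\<^sup>2)) * ((D + D' * L + B) * b)"
        by linarith
      also have "\<dots> = E * (a * b / n\<^sup>2)"
        using n by (simp add: E_def field_simps power2_eq_square)
      finally show ?thesis unfolding eq by (simp add: a_def b_def n_def power_add)
    qed
    then show "\<exists>C. \<forall>x y. norm y \<le> L0 \<longrightarrow>
        \<bar>f (x + y) * g (x + y) - f x * g x - (f x *\<^sub>R G x + g x *\<^sub>R F x) \<bullet> y\<bar>
        \<le> C * ((1 + norm x) ^ (k + l) / (1 + norm x)\<^sup>2)" by blast
  qed
  have 4: "(f x *\<^sub>R G x + g x *\<^sub>R F x) \<bullet> x = real (k + l) * (f x * g x)" for x
    using f g by (simp add: hom_expansion_def inner_add_left algebra_simps)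
  show ?thesis unfolding hom_expansion_def using 1 2 3 4 by blast
qed

lemma hom_expansion_1: "hom_expansion (\<lambda>x. 1) (\<lambda>x. 0) 0"
  unfolding hom_expansion_def growth_le_def first_order_def
proof (intro conjI allI)
  show "\<exists>C. \<forall>x :: 'a. \<bar>1\<bar> \<le> C * (1 + norm x) ^ 0" by (intro exI[of _ 1]) simp
qed (auto intro!: exI[of _ 0])

lemma hom_expansion_component: "hom_expansion (\<lambda>x :: real ^ 'n. x $ i) (\<lambda>x. axis i 1) 1"
  unfolding hom_expansion_def growth_le_def first_order_def
proof (intro conjI allI exI[of _ 1] exI[of _ 0])
  fix x :: "real ^ 'n"
  show "\<bar>x $ i\<bar> \<le> 1 * (1 + norm x) ^ 1" using component_le_norm_cart[of x i] by simp
next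
  fix x :: "real ^ 'n"
  have "1 + norm x \<noteq> 0" using norm_ge_zero[of x] by linarith
  then show "norm (axis i 1 :: real ^ 'n) \<le> 1 * ((1 + norm x) ^ 1 / (1 + norm x))" by simp
qed (simp_all add: inner_axis')

lemma hom_expansion_power:
  assumes "hom_expansion f F k"
  shows "\<exists>G. hom_expansion (\<lambda>x. f x ^ j) G (j * k)"
proof (induction j)
  case 0 then show ?case using hom_expansion_1 by auto
next
  case (Suc j)
  then obtain G where "hom_expansion (\<lambda>x. f x ^ j) G (j * k)" by blast
  from hom_expansion_mult[OF assms this] show ?case by auto
qed

lemma hom_expansion_mon:
  fixes \<alpha> :: "'n::finite \<Rightarrow> nat"
  shows "\<exists>G. hom_expansion (mon \<alpha>) G (sum \<alpha> UNIV)"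
proof -
  have "\<exists>G. hom_expansion (\<lambda>x :: real ^ 'n. \<Prod>i\<in>I. x $ i ^ \<alpha> i) G (sum \<alpha> I)" if "finite I" for I
    using that
  proof (induction rule: finite_induct)
    case empty then show ?case using hom_expansion_1 by auto
  next
    case (insert i I)
    then obtain G where G: "hom_expansion (\<lambda>x :: real ^ 'n. \<Prod>i\<in>I. x $ i ^ \<alpha> i) G (sum \<alpha> I)" by blast
    obtain F where F: "hom_expansion (\<lambda>x :: real ^ 'n. x $ i ^ \<alpha> i) F (\<alpha> i * 1)"
      using hom_expansion_power[OF hom_expansion_component] by blast
    from hom_expansion_mult[OF F G] insert show ?case by auto
  qed
  from this[of UNIV] show ?thesis by (simp add: mon_def[abs_def])
qed

lemma mon_scaleR: "mon \<alpha> (t *\<^sub>R x) = t ^ sum \<alpha> UNIV * mon \<alpha> x"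
  by (simp add: mon_def power_mult_distrib prod.distrib power_sum)

text \<open>\<open>G\<close> is the gradient of the polynomial; Euler's relation for the leading part gives the lower
  bound on its size.\<close>

lemma polynomial_expansion:
  fixes c :: "('n::finite \<Rightarrow> nat) \<Rightarrow> real"
  assumes fin: "finite (poly_support c)" and ev: "even (poly_order c)"
    and lead: "filterlim (leading_part_eval c) at_top at_infinity"
  obtains m G \<kappa> R where "2 \<le> m" "first_order (poly_eval c) G m" "0 < \<kappa>"
    "\<And>x. R \<le> norm x \<Longrightarrow> \<kappa> * ((1 + norm x) ^ m / (1 + norm x)) \<le> norm (G x)"
    "\<And>x. R \<le> norm x \<Longrightarrow> \<kappa> * (1 + norm x) ^ m \<le> poly_eval c x"
proof -
  define m where "m = poly_order c"
  define S where "S = poly_support c"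
  define T where "T = {\<alpha>\<in>S. sum \<alpha> UNIV = m}"
  have fS: "finite S" and fT: "finite T" using fin by (auto simp: S_def T_def)
  have le: "sum \<alpha> UNIV \<le> m" if "\<alpha> \<in> S" for \<alpha>
    unfolding m_def poly_order_def using that fin by (intro Max_ge) (auto simp: S_def)
  have leadT: "leading_part_eval c x = (\<Sum>\<alpha>\<in>T. c \<alpha> * mon \<alpha> x)" for x
    by (simp add: leading_part_eval_def T_def S_def m_def)
  have hom: "leading_part_eval c (t *\<^sub>R x) = t ^ m * leading_part_eval c x" for t x
    by (simp add: leadT mon_scaleR sum_distrib_left T_def ac_simps)
  have "eventually (\<lambda>x. 1 \<le> leading_part_eval c x) at_infinity"
    using lead by (simp add: filterlim_at_top)
  then obtain R1 where R1: "\<And>x. R1 \<le> norm x \<Longrightarrow> 1 \<le> leading_part_eval c x"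
    by (auto simp: eventually_at_infinity)
  define R0 where "R0 = max R1 1"
  have R0: "0 < R0" "\<And>x. R0 \<le> norm x \<Longrightarrow> 1 \<le> leading_part_eval c x"
    using R1 by (auto simp: R0_def)
  \<comment> \<open>Homogeneity: every nonzero \<open>x\<close> is rescaled to the sphere of radius
    \<open>R0\<close>, where the leading part is at least 1.\<close>
  have lower: "(norm x / R0) ^ m \<le> leading_part_eval c x" if "x \<noteq> 0" for x
  proof -
    define z where "z = (R0 / norm x) *\<^sub>R x"
    have "norm z = R0" using that R0 by (simp add: z_def)
    then have "1 \<le> leading_part_eval c z" using R0 by simp
    moreover have "x = (norm x / R0) *\<^sub>R z" using that R0 by (simp add: z_def)
    then have "leading_part_eval c x = (norm x / R0) ^ m * leading_part_eval c z" by (metis hom)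
    moreover have "0 \<le> (norm x / R0) ^ m" using R0 by simp
    ultimately show ?thesis using mult_left_mono[of 1 "leading_part_eval c z" "(norm x / R0) ^ m"] by simp
  qed
  \<comment> \<open>A leading part of order 0 is constant along a line and cannot tend to infinity;
    evenness then leaves \<open>2 \<le> m\<close>.\<close>
  have "m \<noteq> 0"
  proof
    assume "m = 0"
    obtain e :: "real ^ 'n" where e: "norm e = 1" using vector_choose_size[of 1] by auto
    then have "leading_part_eval c (t *\<^sub>R e) = leading_part_eval c e" for t
      using hom[of t e] \<open>m = 0\<close> by simp
    moreover have "eventually (\<lambda>x. leading_part_eval c e + 1 \<le> leading_part_eval c x) at_infinity"
      using lead by (simp add: filterlim_at_top)
    then obtain b where "\<And>x. b \<le> norm x \<Longrightarrow> leading_part_eval c e + 1 \<le> leading_part_eval c x"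
      by (auto simp: eventually_at_infinity)
    from this[of "\<bar>b\<bar> *\<^sub>R e"] have "leading_part_eval c e + 1 \<le> leading_part_eval c (\<bar>b\<bar> *\<^sub>R e)"
      using e by simp
    ultimately show False by simp
  qed
  then have m2: "2 \<le> m" using ev by (auto simp: m_def elim!: evenE)
  obtain g where g: "\<And>\<alpha>. hom_expansion (mon \<alpha>) (g \<alpha>) (sum \<alpha> (UNIV :: 'n set))"
    using hom_expansion_mon by metis
  define G where "G x = (\<Sum>\<alpha>\<in>S. c \<alpha> *\<^sub>R g \<alpha> x)" for x
  have pe: "poly_eval c x = (\<Sum>\<alpha>\<in>S. c \<alpha> * mon \<alpha> x)" for x by (simp add: poly_eval_def S_def)
  have fo: "first_order (poly_eval c) G m"
    unfolding pe[abs_def] G_def[abs_def]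
  proof (intro first_order_sum fS first_order_cmult)
    fix \<alpha> assume "\<alpha> \<in> S"
    then show "first_order (mon \<alpha>) (g \<alpha>) m"
      using g[of \<alpha>] first_order_mono[OF _ le] unfolding hom_expansion_def by blast
  qed
  have low: "growth_le (\<lambda>x. \<Sum>\<alpha>\<in>S - T. w \<alpha> * mon \<alpha> x) (m - 1)" for w
  proof (intro growth_le_sum growth_le_cmult)
    fix \<alpha> assume "\<alpha> \<in> S - T"
    then have "sum \<alpha> UNIV \<le> m - 1" using le[of \<alpha>] by (auto simp: T_def)
    then show "growth_le (mon \<alpha>) (m - 1)"
      using g[of \<alpha>] growth_le_mono unfolding hom_expansion_def by blast
  qed (use fS in auto)
  obtain A where A: "\<And>x. \<bar>\<Sum>\<alpha>\<in>S - T. c \<alpha> * mon \<alpha> x\<bar> \<le> A * (1 + norm x) ^ (m - 1)"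
    using low[of c] unfolding growth_le_def by blast
  obtain B where B: "\<And>x. \<bar>\<Sum>\<alpha>\<in>S - T. (c \<alpha> * real (sum \<alpha> UNIV)) * mon \<alpha> x\<bar> \<le> B * (1 + norm x) ^ (m - 1)"
    using low[of "\<lambda>\<alpha>. c \<alpha> * real (sum \<alpha> UNIV)"] unfolding growth_le_def by blast
  have split: "(\<Sum>\<alpha>\<in>S. h \<alpha>) = (\<Sum>\<alpha>\<in>T. h \<alpha>) + (\<Sum>\<alpha>\<in>S - T. h \<alpha>)" for h :: "_ \<Rightarrow> real"
    using fS by (subst sum.subset_diff[of T S]) (auto simp: T_def)
  have Euler: "G x \<bullet> x = real m * leading_part_eval c x + (\<Sum>\<alpha>\<in>S - T. (c \<alpha> * real (sum \<alpha> UNIV)) * mon \<alpha> x)" for x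
  proof -
    have "G x \<bullet> x = (\<Sum>\<alpha>\<in>S. (c \<alpha> * real (sum \<alpha> UNIV)) * mon \<alpha> x)"
      using g by (simp add: G_def inner_sum_left hom_expansion_def mult.assoc del: of_nat_sum)
    then show ?thesis
      unfolding split leadT by (simp add: T_def sum_distrib_left ac_simps del: of_nat_sum)
  qed
  \<comment> \<open>For |x| \<ge> 1 one has 1 + |x| \<le> 2 |x|, so the leading part is at least
    \<open>2 * \<kappa> * (1 + norm x) ^ m\<close>. Half of this is spent on the lower-order terms
    once |x| \<ge> \<open>R\<close>.\<close>
  define \<kappa> where "\<kappa> = 1 / (2 * (2 * R0) ^ m)"
  have \<kappa>: "0 < \<kappa>" using R0 by (simp add: \<kappa>_def)
  define R where "R = max 1 (max (A / \<kappa>) (B / \<kappa>))"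
  have main: "2 * \<kappa> * (1 + norm x) ^ m \<le> leading_part_eval c x" if "R \<le> norm x" for x
  proof -
    have x1: "1 \<le> norm x" using that by (simp add: R_def)
    have "2 * \<kappa> * (1 + norm x) ^ m = ((1 + norm x) / (2 * R0)) ^ m" by (simp add: \<kappa>_def power_divide)
    also have "\<dots> \<le> (norm x / R0) ^ m" using x1 R0 by (intro power_mono) (auto simp: field_simps)
    also have "\<dots> \<le> leading_part_eval c x" using x1 by (intro lower) auto
    finally show ?thesis .
  qed
  have mm: "(1 + norm x) ^ m = (1 + norm x) * (1 + norm x) ^ (m - 1)" for x :: "real ^ 'n"
    using m2 by (simp flip: power_Suc)
  have small: "D * (1 + norm x) ^ (m - 1) \<le> \<kappa> * (1 + norm x) ^ m" if "D / \<kappa> \<le> norm x" for D and x :: "real ^ 'n"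
  proof -
    have "D \<le> \<kappa> * (1 + norm x)" using that \<kappa> by (simp add: field_simps)
    then show ?thesis unfolding mm mult.assoc[symmetric] by (rule mult_right_mono) simp
  qed
  have p_lower: "\<kappa> * (1 + norm x) ^ m \<le> poly_eval c x" if "R \<le> norm x" for x
  proof -
    have "poly_eval c x = leading_part_eval c x + (\<Sum>\<alpha>\<in>S - T. c \<alpha> * mon \<alpha> x)" unfolding pe split leadT ..
    moreover have "A * (1 + norm x) ^ (m - 1) \<le> \<kappa> * (1 + norm x) ^ m"
      using that by (intro small) (simp add: R_def)
    ultimately show ?thesis using main[OF that] A[of x] by linarith
  qed
  have G_lower: "\<kappa> * ((1 + norm x) ^ m / (1 + norm x)) \<le> norm (G x)" if "R \<le> norm x" for x
  proof -
    have "B * (1 + norm x) ^ (m - 1) \<le> \<kappa> * (1 + norm x) ^ m"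
      using that by (intro small) (simp add: R_def)
    moreover have "2 * \<kappa> * (1 + norm x) ^ m \<le> real m * leading_part_eval c x"
    proof -
      have "0 \<le> 2 * \<kappa> * (1 + norm x) ^ m" using \<kappa> by simp
      then have "0 \<le> leading_part_eval c x" using main[OF that] by linarith
      then have "1 * leading_part_eval c x \<le> real m * leading_part_eval c x"
        using m2 by (intro mult_right_mono) auto
      then show ?thesis using main[OF that] by linarith
    qed
    ultimately have "\<kappa> * (1 + norm x) ^ m \<le> G x \<bullet> x" using Euler[of x] B[of x] by linarith
    also have "\<dots> \<le> norm (G x) * norm x" by (rule norm_cauchy_schwarz)
    also have "\<dots> \<le> norm (G x) * (1 + norm x)" by (intro mult_left_mono) auto
    finally show ?thesis by (simp add: field_simps add_pos_nonneg)
  qed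
  show thesis by (rule that[OF m2 fo \<kappa> G_lower p_lower])
qed

text \<open>Along a sequence tending to infinity whose gradient directions converge to \<open>n\<close>, the increments
  of the polynomial by a fixed \<open>y\<close> diverge, with the sign of \<open>n \<bullet> y\<close>.\<close>

lemma expansion_increment_at_top:
  fixes p :: "'a::euclidean_space \<Rightarrow> real"
  assumes m: "2 \<le> m" and fo: "first_order p G m" and \<kappa>: "0 < \<kappa>"
    and G: "\<And>x. R \<le> norm x \<Longrightarrow> \<kappa> * ((1 + norm x) ^ m / (1 + norm x)) \<le> norm (G x)"
    and X: "filterlim X at_infinity sequentially"
    and dir: "(\<lambda>k. sgn (G (X k))) \<longlonglongrightarrow> n"
    and s: "s = 1 \<or> s = - 1" and pos: "0 < s * (n \<bullet> y)"
  shows "filterlim (\<lambda>k. s * (p (X k + y) - p (X k))) at_top sequentially"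
proof -
  obtain C where C: "\<And>x. \<bar>p (x + y) - p x - G x \<bullet> y\<bar> \<le> C * ((1 + norm x) ^ m / (1 + norm x)\<^sup>2)"
    using fo[unfolded first_order_def, rule_format, of "norm y"] by blast
  have C0: "0 \<le> C" using order_trans[OF abs_ge_zero C[of 0]] by simp
  define \<eta> where "\<eta> = s * (n \<bullet> y) / 2"
  have \<eta>: "0 < \<eta>" using pos by (simp add: \<eta>_def)
  have nX: "filterlim (\<lambda>k. norm (X k)) at_top sequentially"
    using X by (simp add: filterlim_at_infinity_conv_norm_at_top)
  have "(\<lambda>k. s * (sgn (G (X k)) \<bullet> y)) \<longlonglongrightarrow> s * (n \<bullet> y)"
    by (intro tendsto_intros dir)
  then have e1: "eventually (\<lambda>k. \<eta> < s * (sgn (G (X k)) \<bullet> y)) sequentially"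
    by (rule order_tendstoD) (use pos in \<open>simp add: \<eta>_def\<close>)
  have e2: "eventually (\<lambda>k. R \<le> norm (X k)) sequentially"
    using nX by (simp add: filterlim_at_top)
  have lb: "filterlim (\<lambda>k. \<kappa> * \<eta> * norm (X k) - C) at_top sequentially"
  proof -
    have "filterlim (\<lambda>k. \<kappa> * \<eta> * norm (X k)) at_top sequentially"
      using \<kappa> \<eta> by (intro filterlim_tendsto_pos_mult_at_top[OF tendsto_const _ nX]) auto
    from filterlim_tendsto_add_at_top[OF tendsto_const[of "- C"] this] show ?thesis by simp
  qed
  have e3: "eventually (\<lambda>k. 0 \<le> \<kappa> * \<eta> * norm (X k) - C) sequentially"
    by (rule lb[unfolded filterlim_at_top, rule_format])
  have "eventually (\<lambda>k. \<kappa> * \<eta> * norm (X k) - C \<le> s * (p (X k + y) - p (X k))) sequentially"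
    using e1 e2 e3
  proof eventually_elim
    case (elim k)
    define N where "N = 1 + norm (X k)"
    have N: "1 \<le> N" by (simp add: N_def)
    \<comment> \<open>The common factor of order m - 2. The gradient contributes at least \<kappa>
      \<eta> M N and the remainder at most C M; as \<open>M \<ge> 1\<close>, their difference
      dominates \<kappa> \<eta> |x| - C.\<close>
    define M where "M = N ^ m / N\<^sup>2"
    have "N\<^sup>2 \<le> N ^ m" using N m by (intro power_increasing) auto
    then have M: "1 \<le> M" using N by (simp add: M_def)
    have MN: "N ^ m / N = M * N" using N by (simp add: M_def power2_eq_square)
    have "s * (G (X k) \<bullet> y) = norm (G (X k)) * (s * (sgn (G (X k)) \<bullet> y))"
      by (cases "G (X k) = 0") (simp_all add: sgn_div_norm)
    also have "\<dots> \<ge> (\<kappa> * (M * N)) * \<eta>"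
      using G[OF elim(2)] elim(1) \<eta> \<kappa> M N unfolding N_def[symmetric] MN by (intro mult_mono) auto
    finally have 1: "(\<kappa> * (M * N)) * \<eta> \<le> s * (G (X k) \<bullet> y)" .
    have "\<bar>s * (p (X k + y) - p (X k) - G (X k) \<bullet> y)\<bar> \<le> C * M"
      using C[of "X k"] s by (auto simp: N_def M_def abs_mult)
    then have 2: "(\<kappa> * (M * N)) * \<eta> - C * M \<le> s * (p (X k + y) - p (X k))"
      using 1 by (simp add: right_diff_distrib abs_le_iff)
    have 3: "1 * (\<kappa> * \<eta> * norm (X k) - C) \<le> M * (\<kappa> * \<eta> * norm (X k) - C)"
      using M elim(3) by (intro mult_right_mono) auto
    have 4: "M * (\<kappa> * \<eta> * norm (X k) - C) \<le> (\<kappa> * (M * N)) * \<eta> - C * M"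
      using M \<kappa> \<eta> by (simp add: N_def algebra_simps)
    show ?case using order_trans[OF order_trans[OF 3 4] 2] by simp
  qed
  with lb show ?thesis by (rule filterlim_at_top_mono)
qed

section \<open>Slowly varying functions\<close>

lemma slowly_varying_ratio:
  fixes g :: "'a::real_normed_vector \<Rightarrow> real"
  assumes g: "slowly_varying g" "\<And>x. 0 < g x" and K: "0 < K" and a: "1 < a"
  shows "\<exists>R. \<forall>x y. R \<le> norm x \<longrightarrow> norm y \<le> K \<longrightarrow> g (x + y) \<le> a * g x"
proof -
  have "Limsup at_infinity (\<lambda>x. SUP y\<in>cball 0 K. ereal (g (x + y) / g x)) < ereal a"
    using g(1) K a by (simp add: slowly_varying_def)
  then have "eventually (\<lambda>x. (SUP y\<in>cball 0 K. ereal (g (x + y) / g x)) < ereal a) at_infinity"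
    by (rule Limsup_lessD)
  then obtain R where R: "\<And>x. R \<le> norm x \<Longrightarrow> (SUP y\<in>cball 0 K. ereal (g (x + y) / g x)) < ereal a"
    by (auto simp: eventually_at_infinity)
  have "g (x + y) \<le> a * g x" if "R \<le> norm x" "norm y \<le> K" for x y
  proof -
    have "ereal (g (x + y) / g x) \<le> (SUP y\<in>cball 0 K. ereal (g (x + y) / g x))"
      using that by (intro SUP_upper) simp
    also note R[OF that(1)]
    finally have "g (x + y) / g x < a" by simp
    then show ?thesis using g(2)[of x] by (simp add: field_simps)
  qed
  then show ?thesis by blast
qed

text \<open>Walking towards the origin in unit steps, each step outside a fixed ball costs a factor
  of at most \<open>exp 1\<close>, and on a slightly larger ball continuity bounds
  \<open>g\<close>.\<close>

lemma slowly_varying_subexponential: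
  fixes g :: "'a::euclidean_space \<Rightarrow> real"
  assumes g: "slowly_varying g" "\<And>x. 0 < g x" and cont: "continuous_on UNIV g"
  shows "\<exists>C>0. \<forall>x. g x \<le> C * exp (norm x)"
proof -
  obtain R0 where R0: "\<And>x y. R0 \<le> norm x \<Longrightarrow> norm y \<le> 1 \<Longrightarrow> g (x + y) \<le> exp 1 * g x"
    using slowly_varying_ratio[OF g, of 1 "exp 1"] by auto
  define R where "R = max R0 0"
  have "\<exists>z\<in>cball 0 (R + 1). \<forall>x\<in>cball 0 (R + 1). g x \<le> g z"
    by (rule continuous_attains_sup) (auto simp: R_def intro: continuous_on_subset[OF cont])
  then obtain z where "\<forall>x\<in>cball 0 (R + 1). g x \<le> g z" by blast
  then have z: "g x \<le> g z" if "norm x \<le> R + 1" for x using that by simp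
  have *: "g x \<le> g z * exp (real n)" if "norm x \<le> R + 1 + real n" for n x
    using that
  proof (induction n arbitrary: x)
    case 0 then show ?case using z by simp
  next
    case (Suc n)
    show ?case
    proof (cases "norm x \<le> R + 1 + real n")
      case True
      have "g z * exp (real n) \<le> g z * exp (real (Suc n))" using g(2)[of z] by simp
      with Suc.IH[OF True] show ?thesis by linarith
    next
      case False
      have nx: "1 < norm x" using False by (simp add: R_def)
      \<comment> \<open>The point on the same ray, one unit closer to the origin.\<close>
      define w where "w = (1 - 1 / norm x) *\<^sub>R x"
      have "norm w = \<bar>1 - 1 / norm x\<bar> * norm x" by (simp add: w_def)
      also have "\<dots> = (1 - 1 / norm x) * norm x" using nx by (subst abs_of_pos) (auto simp: divide_less_eq)
      also have "\<dots> = norm x - 1" using nx by (auto simp: left_diff_distrib)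
      finally have w: "norm w = norm x - 1" .
      have xw: "x = w + (1 / norm x) *\<^sub>R x" by (simp add: w_def algebra_simps)
      have "g (w + (1 / norm x) *\<^sub>R x) \<le> exp 1 * g w"
        using w False nx by (intro R0) (auto simp: R_def)
      also have "\<dots> \<le> exp 1 * (g z * exp (real n))"
        using Suc.prems w by (intro mult_left_mono Suc.IH) auto
      also have "\<dots> = g z * exp (real (Suc n))" by (simp add: exp_add)
      finally show ?thesis using xw by simp
    qed
  qed
  have "g x \<le> (g z * exp 1) * exp (norm x)" for x
  proof -
    have "norm x \<le> R + 1 + real (nat \<lceil>norm x\<rceil>)" by (simp add: R_def) linarith
    from *[OF this] have "g x \<le> g z * exp (real (nat \<lceil>norm x\<rceil>))" .
    also have "\<dots> \<le> g z * exp (norm x + 1)"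
    proof (rule mult_left_mono)
      have "real (nat \<lceil>norm x\<rceil>) \<le> norm x + 1" using norm_ge_zero[of x] by linarith
      then show "exp (real (nat \<lceil>norm x\<rceil>)) \<le> exp (norm x + 1)" by simp
    qed (use g(2)[of z] in simp)
    finally show ?thesis by (simp add: exp_add ac_simps)
  qed
  then show ?thesis using g(2)[of z] by (intro exI[of _ "g z * exp 1"]) auto
qed

section \<open>The drift condition\<close>

definition metro_weight :: "('a::euclidean_space \<Rightarrow> real) \<Rightarrow> 'a \<Rightarrow> real" where
  "metro_weight \<pi> x = 1 / sqrt (\<pi> x)"

text \<open>For \<open>V = \<pi>\<^sup>-\<^sup>1\<^sup>/\<^sup>2\<close> the quotient \<open>P V / V\<close> at \<open>x\<close> is the \<open>q\<close>-average over \<open>y\<close> of the following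
  function of the ratio \<open>t = \<pi>(x + y) / \<pi>(x)\<close>.\<close>

definition drift_factor :: "real \<Rightarrow> real" where
  "drift_factor t = min 1 t / sqrt t + (1 - min 1 t)"

text \<open>The first summand is the square root of \<open>t\<close> if t \<le> 1 and its reciprocal
  otherwise, hence at most 1. The resulting bound 2 supplies the dominating function
  \<open>2 * q\<close>.\<close>

lemma drift_factor_bounds:
  assumes "0 < t"
  shows "0 \<le> drift_factor t" "drift_factor t \<le> 2"
proof -
  have "min 1 t / sqrt t \<le> 1"
  proof (cases "t \<le> 1")
    case True
    then have "t / sqrt t = sqrt t" using assms by (simp add: real_div_sqrt)
    then show ?thesis using True by simp
  next
    case False then show ?thesis by simp
  qed
  moreover have "0 \<le> min 1 t / sqrt t" "0 \<le> min 1 t" "min 1 t \<le> 1" using assms by auto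
  ultimately show "0 \<le> drift_factor t" "drift_factor t \<le> 2" unfolding drift_factor_def by linarith+
qed

lemma drift_factor_at_0:
  assumes "\<And>k. 0 < f k" "f \<longlonglongrightarrow> 0"
  shows "(\<lambda>k. drift_factor (f k)) \<longlonglongrightarrow> 1"
proof -
  have "(\<lambda>k. sqrt (f k) + (1 - min 1 (f k))) \<longlonglongrightarrow> sqrt 0 + (1 - min 1 0)"
    by (intro tendsto_intros assms)
  moreover have "eventually (\<lambda>k. f k < 1) sequentially"
    using assms(2) by (rule order_tendstoD) simp
  then have "eventually (\<lambda>k. sqrt (f k) + (1 - min 1 (f k)) = drift_factor (f k)) sequentially"
    by eventually_elim (use assms(1) in \<open>simp add: drift_factor_def real_div_sqrt less_imp_le\<close>)
  ultimately show ?thesis by (simp add: Lim_transform_eventually)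
qed

lemma drift_factor_at_top:
  assumes "filterlim f at_top sequentially"
  shows "(\<lambda>k. drift_factor (f k)) \<longlonglongrightarrow> 0"
proof -
  have "filterlim (\<lambda>k. sqrt (f k)) at_top sequentially"
    by (rule filterlim_compose[OF sqrt_at_top assms])
  then have "(\<lambda>k. inverse (sqrt (f k))) \<longlonglongrightarrow> 0"
    by (rule tendsto_inverse_0_at_top)
  moreover have "eventually (\<lambda>k. 1 \<le> f k) sequentially"
    using assms by (simp add: filterlim_at_top)
  then have "eventually (\<lambda>k. inverse (sqrt (f k)) = drift_factor (f k)) sequentially"
    by eventually_elim (simp add: drift_factor_def inverse_eq_divide)
  ultimately show ?thesis by (rule Lim_transform_eventually)
qed

context srwm_chain
begin

lemma metro_weight_pos: "0 < metro_weight \<pi> x"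
  using \<pi>_pos by (simp add: metro_weight_def)

lemma metro_weight_cont: "continuous_on UNIV (metro_weight \<pi>)"
  unfolding metro_weight_def[abs_def] using \<pi>_pos
  by (intro continuous_intros \<pi>_cont) (auto simp: less_imp_neq[symmetric])

lemma metro_weight_meas [measurable]: "metro_weight \<pi> \<in> borel_measurable borel"
  by (rule borel_measurable_continuous_onI[OF metro_weight_cont])

lemma integrable_q: "integrable lborel q" "integral\<^sup>L lborel q = 1"
proof -
  have "has_bochner_integral lborel q 1"
    by (rule has_bochner_integral_nn_integral) (use q_nonneg nn_integral_q in auto)
  then show "integrable lborel q" "integral\<^sup>L lborel q = 1" by (auto simp: has_bochner_integral_iff)
qed

lemma integrable_drift_factor: "integrable lborel (\<lambda>y. drift_factor (\<pi> (x + y) / \<pi> x) * q y)"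
proof (rule Bochner_Integration.integrable_bound)
  show "integrable lborel (\<lambda>y. 2 * q y)" using integrable_q by simp
  show "(\<lambda>y. drift_factor (\<pi> (x + y) / \<pi> x) * q y) \<in> borel_measurable lborel"
    unfolding drift_factor_def by measurable
  have "\<bar>drift_factor (\<pi> (x + y) / \<pi> x) * q y\<bar> \<le> 2 * q y" for y
    using drift_factor_bounds[of "\<pi> (x + y) / \<pi> x"] \<pi>_pos q_nonneg[of y]
    by (simp add: abs_mult mult_right_mono)
  then show "AE y in lborel. norm (drift_factor (\<pi> (x + y) / \<pi> x) * q y) \<le> norm (2 * q y)"
    using q_nonneg by (simp add: abs_mult)
qed

lemma nn_integral_metro_weight:
  "(\<integral>\<^sup>+z. ennreal (metro_weight \<pi> z) \<partial>srwm \<pi> q x) =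
    ennreal (metro_weight \<pi> x * (\<integral>y. drift_factor (\<pi> (x + y) / \<pi> x) * q y \<partial>lborel))"
proof -
  let ?V = "metro_weight \<pi>" and ?t = "\<lambda>y. \<pi> (x + y) / \<pi> x"
  have t: "0 < ?t y" for y using \<pi>_pos by simp
  have [measurable]: "accept \<pi> x \<in> borel_measurable borel" unfolding accept_def[abs_def] by measurable
  have "(\<integral>\<^sup>+z. ennreal (?V z) \<partial>srwm \<pi> q x) =
      (\<integral>\<^sup>+y. ennreal (accept \<pi> x y * q y) * ennreal (?V (x + y)) \<partial>lborel) +
      (\<integral>\<^sup>+y. ennreal (?V x) * ennreal ((1 - accept \<pi> x y) * q y) \<partial>lborel)"
    by (subst nn_integral_srwm) (auto simp: nn_integral_cmult)
  also have "\<dots> = (\<integral>\<^sup>+y. ennreal (accept \<pi> x y * q y) * ennreal (?V (x + y)) +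
      ennreal (?V x) * ennreal ((1 - accept \<pi> x y) * q y) \<partial>lborel)"
    by (rule nn_integral_add[symmetric]) measurable
  also have "\<dots> = (\<integral>\<^sup>+y. ennreal (?V x * (drift_factor (?t y) * q y)) \<partial>lborel)"
  proof (rule nn_integral_cong)
    fix y
    have "?V (x + y) = ?V x / sqrt (?t y)"
      using \<pi>_pos by (simp add: metro_weight_def real_sqrt_divide less_imp_neq[symmetric])
    then have "?V x * (drift_factor (?t y) * q y) = accept \<pi> x y * q y * ?V (x + y) + ?V x * ((1 - accept \<pi> x y) * q y)"
      by (simp add: drift_factor_def accept_def algebra_simps)
    then show "ennreal (accept \<pi> x y * q y) * ennreal (?V (x + y)) + ennreal (?V x) * ennreal ((1 - accept \<pi> x y) * q y) =
        ennreal (?V x * (drift_factor (?t y) * q y))"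
      using accept_nonneg[of x y] accept_le_1[of x y] q_nonneg[of y] metro_weight_pos
      by (simp add: ennreal_mult'[symmetric] ennreal_plus[symmetric] less_imp_le del: ennreal_plus)
  qed
  also have "\<dots> = ennreal (\<integral>y. ?V x * (drift_factor (?t y) * q y) \<partial>lborel)"
    using integrable_drift_factor[of x] drift_factor_bounds(1)[OF t] q_nonneg metro_weight_pos
    by (intro nn_integral_eq_integral) (auto simp: less_imp_le)
  finally show ?thesis by simp
qed

text \<open>Reflection exchanges the two open half-spaces and preserves \<open>q\<close>; they are
  disjoint and share a total mass of 1.\<close>

lemma half_space_mass:
  assumes "n \<noteq> 0"
  shows "(\<integral>y. indicator {y. 0 < n \<bullet> y} y * q y \<partial>lborel) \<le> 1 / 2"
proof -
  have m[measurable]: "{y. 0 < n \<bullet> y} \<in> sets borel" "{y. n \<bullet> y < 0} \<in> sets borel"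
    by measurable
  have int: "integrable lborel (\<lambda>y. indicator A y * q y)" if [measurable]: "A \<in> sets borel" for A :: "'a set"
    by (rule Bochner_Integration.integrable_bound[OF integrable_q(1)])
      (auto simp: abs_mult split: split_indicator)
  have nn: "(\<integral>\<^sup>+y. ennreal (indicator A y * q y) \<partial>lborel) = ennreal (\<integral>y. indicator A y * q y \<partial>lborel)"
    if "A \<in> sets borel" for A :: "'a set"
    by (rule nn_integral_eq_integral[OF int[OF that]]) (use q_nonneg in auto)
  have "(\<integral>\<^sup>+y. ennreal (indicator {y. 0 < n \<bullet> y} (- y) * q (- y)) \<partial>lborel) =
      (\<integral>\<^sup>+y. ennreal (indicator {y. 0 < n \<bullet> y} y * q y) \<partial>lborel)"
    by (rule nn_integral_lborel_reflect) measurable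
  also have "(\<integral>\<^sup>+y. ennreal (indicator {y. 0 < n \<bullet> y} (- y) * q (- y)) \<partial>lborel) =
      (\<integral>\<^sup>+y. ennreal (indicator {y. n \<bullet> y < 0} y * q y) \<partial>lborel)"
    by (intro nn_integral_cong) (auto simp: q_sym split: split_indicator)
  finally have "(\<integral>y. indicator {y. n \<bullet> y < 0} y * q y \<partial>lborel) = (\<integral>y. indicator {y. 0 < n \<bullet> y} y * q y \<partial>lborel)"
    using q_nonneg by (simp add: nn integral_nonneg_AE)
  moreover have "(\<integral>y. indicator {y. n \<bullet> y < 0} y * q y \<partial>lborel) + (\<integral>y. indicator {y. 0 < n \<bullet> y} y * q y \<partial>lborel) =
      (\<integral>y. indicator {y. n \<bullet> y < 0} y * q y + indicator {y. 0 < n \<bullet> y} y * q y \<partial>lborel)"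
    by (rule Bochner_Integration.integral_add[OF int int, symmetric]) (rule m)+
  moreover have "\<dots> \<le> (\<integral>y. q y \<partial>lborel)"
    using int[OF m(1)] int[OF m(2)] integrable_q q_nonneg
    by (intro integral_mono Bochner_Integration.integrable_add) (auto split: split_indicator)
  ultimately show ?thesis using integrable_q by simp
qed

end

text \<open>If the drift factor stayed above \<open>3/4\<close> along a sequence tending to infinity, then along a
  subsequence the gradient directions of the polynomial converge to some \<open>n\<close>; proposals with
  \<open>n \<bullet> y < 0\<close> contribute \<open>0\<close> in the limit and those with \<open>n \<bullet> y > 0\<close> contribute \<open>1\<close>.\<close>

lemma drift_at_infinity:
  fixes \<pi> q g p :: "'a::euclidean_space \<Rightarrow> real"
  assumes chain: "srwm_chain \<pi> q" and Z: "0 < Z" and \<pi>: "\<And>x. \<pi> x = Z * (g x * exp (- p x))"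
    and g: "slowly_varying g" "\<And>x. 0 < g x"
    and m: "2 \<le> m" and fo: "first_order p G m" and \<kappa>: "0 < \<kappa>"
    and G: "\<And>x. R \<le> norm x \<Longrightarrow> \<kappa> * ((1 + norm x) ^ m / (1 + norm x)) \<le> norm (G x)"
  shows "\<exists>R. \<forall>x. R \<le> norm x \<longrightarrow> (\<integral>y. drift_factor (\<pi> (x + y) / \<pi> x) * q y \<partial>lborel) \<le> 3 / 4"
proof (rule ccontr)
  interpret srwm_chain \<pi> q by (rule chain)
  define I where "I x = (\<integral>y. drift_factor (\<pi> (x + y) / \<pi> x) * q y \<partial>lborel)" for x
  assume "\<not> ?thesis"
  then have "\<forall>k::nat. \<exists>x. real k \<le> norm x \<and> 3 / 4 < I x" unfolding I_def by (auto simp: not_le)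
  then obtain X0 where X0: "\<And>k::nat. real k \<le> norm (X0 k)" "\<And>k. 3 / 4 < I (X0 k)" by metis
  \<comment> \<open>Compactness of the ball and not of the sphere, because \<open>sgn 0 = 0\<close>.
    That the limit is nonzero follows from the gradient being nonzero far out.\<close>
  have "\<exists>n\<in>cball 0 1. \<exists>r :: nat \<Rightarrow> nat. strict_mono r \<and> ((\<lambda>k. sgn (G (X0 k))) \<circ> r) \<longlonglongrightarrow> n"
    by (rule compact_cball[unfolded compact_def, rule_format]) (simp add: norm_sgn)
  then obtain n r where r: "strict_mono (r :: nat \<Rightarrow> nat)" and n: "((\<lambda>k. sgn (G (X0 k))) \<circ> r) \<longlonglongrightarrow> n"
    by blast
  define X where "X k = X0 (r k)" for k
  have dir: "(\<lambda>k. sgn (G (X k))) \<longlonglongrightarrow> n" using n by (simp add: X_def o_def)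
  have "filterlim (\<lambda>k. norm (X k)) at_top sequentially"
  proof (rule filterlim_at_top_mono[OF filterlim_real_sequentially])
    have "real k \<le> norm (X k)" for k
      using X0(1)[of "r k"] seq_suble[OF r, of k] unfolding X_def by linarith
    then show "eventually (\<lambda>k. real k \<le> norm (X k)) sequentially" by simp
  qed
  then have Xinf: "filterlim X at_infinity sequentially"
    and Xev: "eventually (\<lambda>k. b \<le> norm (X k)) sequentially" for b
    by (auto simp: filterlim_at_infinity_conv_norm_at_top filterlim_at_top)
  have "n \<noteq> 0"
  proof
    assume "n = 0"
    have "(\<lambda>k. norm (sgn (G (X k)))) \<longlonglongrightarrow> norm n" by (intro tendsto_norm dir)
    moreover have "eventually (\<lambda>k. norm (sgn (G (X k))) = 1) sequentially"
      using Xev[of R]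
    proof eventually_elim
      case (elim k)
      have "0 < \<kappa> * ((1 + norm (X k)) ^ m / (1 + norm (X k)))"
        using \<kappa> by (intro mult_pos_pos divide_pos_pos zero_less_power) (auto simp: add_pos_nonneg)
      then have "G (X k) \<noteq> 0" using G[OF elim] by auto
      then show ?case by (simp add: norm_sgn)
    qed
    then have "(\<lambda>k. norm (sgn (G (X k)))) \<longlonglongrightarrow> 1" by (rule tendsto_eventually)
    ultimately have "norm n = 1" using LIMSEQ_unique by blast
    with \<open>n = 0\<close> show False by simp
  qed
  have ratio: "\<pi> (x + y) / \<pi> x = g (x + y) / g x * exp (- (p (x + y) - p x))" for x y
    using Z g(2)[of x] by (simp add: \<pi> exp_diff exp_minus field_simps)
  \<comment> \<open>The lower bound is the upper bound applied at \<open>X k + y\<close> with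
    increment \<open>- y\<close>, so that point must be far out as well. The radius
    \<open>norm y + 1\<close> is positive even for \<open>y = 0\<close>.\<close>
  have gr: "eventually (\<lambda>k. g (X k + y) \<le> 2 * g (X k) \<and> g (X k) \<le> 2 * g (X k + y)) sequentially" for y
  proof -
    obtain b where b: "\<And>x z. b \<le> norm x \<Longrightarrow> norm z \<le> norm y + 1 \<Longrightarrow> g (x + z) \<le> 2 * g x"
      using slowly_varying_ratio[OF g, of "norm y + 1" 2] by (auto simp: add_nonneg_pos)
    show ?thesis using Xev[of "\<bar>b\<bar> + norm y"]
    proof eventually_elim
      case (elim k)
      have "norm (X k) \<le> norm (X k + y) + norm y" using norm_triangle_ineq4[of "X k + y" y] by simp
      then have "b \<le> norm (X k)" "b \<le> norm (X k + y)"
        using elim norm_ge_zero[of y] abs_ge_self[of b] by linarith+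
      then show ?case using b[of "X k" y] b[of "X k + y" "- y"] by simp
    qed
  qed
  let ?t = "\<lambda>k y. \<pi> (X k + y) / \<pi> (X k)"
  have lim: "(\<lambda>k. drift_factor (?t k y) * q y) \<longlonglongrightarrow> indicator {y. 0 < n \<bullet> y} y * q y" if "n \<bullet> y \<noteq> 0" for y
  proof -
    have "(\<lambda>k. drift_factor (?t k y)) \<longlonglongrightarrow> indicator {y. 0 < n \<bullet> y} y"
    proof (cases "0 < n \<bullet> y")
      case True
      have "filterlim (\<lambda>k. 1 * (p (X k + y) - p (X k))) at_top sequentially"
        using True by (intro expansion_increment_at_top[OF m fo \<kappa> G Xinf dir]) auto
      then have "filterlim (\<lambda>k. - (p (X k + y) - p (X k))) at_bot sequentially"
        by (simp add: filterlim_uminus_at_bot)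
      then have e: "(\<lambda>k. exp (- (p (X k + y) - p (X k)))) \<longlonglongrightarrow> 0"
        by (rule filterlim_compose[OF exp_at_bot])
      have "(\<lambda>k. ?t k y) \<longlonglongrightarrow> 0"
      proof (rule tendsto_sandwich[OF _ _ tendsto_const])
        show "(\<lambda>k. 2 * exp (- (p (X k + y) - p (X k)))) \<longlonglongrightarrow> 0"
          using tendsto_mult_right_zero[OF e, of 2] by simp
        show "eventually (\<lambda>k. ?t k y \<le> 2 * exp (- (p (X k + y) - p (X k)))) sequentially"
          using gr[of y]
        proof eventually_elim
          case (elim k)
          have "g (X k + y) / g (X k) \<le> 2" using elim g(2)[of "X k"] by (simp add: field_simps)
          then show ?case unfolding ratio by (rule mult_right_mono) simp
        qed
        show "eventually (\<lambda>k. 0 \<le> ?t k y) sequentially" using \<pi>_pos by (simp add: less_imp_le)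
      qed
      then have "(\<lambda>k. drift_factor (?t k y)) \<longlonglongrightarrow> 1"
        using \<pi>_pos by (intro drift_factor_at_0) auto
      then show ?thesis using True by simp
    next
      case False
      then have "n \<bullet> y < 0" using that by simp
      then have "filterlim (\<lambda>k. - 1 * (p (X k + y) - p (X k))) at_top sequentially"
        by (intro expansion_increment_at_top[OF m fo \<kappa> G Xinf dir]) auto
      then have "filterlim (\<lambda>k. exp (- (p (X k + y) - p (X k)))) at_top sequentially"
        by (intro filterlim_compose[OF exp_at_top]) simp
      then have e: "filterlim (\<lambda>k. 1 / 2 * exp (- (p (X k + y) - p (X k)))) at_top sequentially"
        by (intro filterlim_tendsto_pos_mult_at_top[OF tendsto_const]) auto
      have "filterlim (\<lambda>k. ?t k y) at_top sequentially"
      proof (rule filterlim_at_top_mono[OF e])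
        show "eventually (\<lambda>k. 1 / 2 * exp (- (p (X k + y) - p (X k))) \<le> ?t k y) sequentially"
          using gr[of y]
        proof eventually_elim
          case (elim k)
          have "1 / 2 \<le> g (X k + y) / g (X k)" using elim g(2)[of "X k"] by (simp add: field_simps)
          then show ?case unfolding ratio by (rule mult_right_mono) simp
        qed
      qed
      then have "(\<lambda>k. drift_factor (?t k y)) \<longlonglongrightarrow> 0" by (rule drift_factor_at_top)
      then show ?thesis using False by simp
    qed
    then show ?thesis by (intro tendsto_intros)
  qed
  have "(\<lambda>k. I (X k)) \<longlonglongrightarrow> (\<integral>y. indicator {y. 0 < n \<bullet> y} y * q y \<partial>lborel)"
    unfolding I_def
  proof (rule integral_dominated_convergence)
    show "integrable lborel (\<lambda>y. 2 * q y)" using integrable_q by simp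
    have "negligible {y. n \<bullet> y = 0}" using \<open>n \<noteq> 0\<close> by (intro negligible_hyperplane) auto
    moreover have "{y. n \<bullet> y = 0} \<in> sets borel" by measurable
    \<comment> \<open>On this hyperplane the direction says nothing about the increment of
      \<open>p\<close>, but it is a null set.\<close>
    ultimately have "{y. n \<bullet> y = 0} \<in> null_sets lborel"
      by (simp add: negligible_iff_null_sets null_sets_completion_iff)
    then have "AE y in lborel. n \<bullet> y \<noteq> 0" by (auto dest: AE_not_in)
    then show "AE y in lborel. (\<lambda>k. drift_factor (?t k y) * q y) \<longlonglongrightarrow> indicator {y. 0 < n \<bullet> y} y * q y"
      by eventually_elim (rule lim)
    show "AE y in lborel. norm (drift_factor (?t k y) * q y) \<le> 2 * q y" for k
    proof (rule AE_I2)
      fix y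
      show "norm (drift_factor (?t k y) * q y) \<le> 2 * q y"
        using drift_factor_bounds[of "?t k y"] \<pi>_pos q_nonneg[of y]
        by (simp add: abs_mult mult_right_mono)
    qed
  qed (use integrable_drift_factor in \<open>auto intro: borel_measurable_integrable\<close>)
  moreover have "eventually (\<lambda>k. 3 / 4 \<le> I (X k)) sequentially"
    using X0(2) by (simp add: X_def less_imp_le)
  ultimately have "3 / 4 \<le> (\<integral>y. indicator {y. 0 < n \<bullet> y} y * q y \<partial>lborel)"
    by (rule tendsto_lowerbound) simp
  with half_space_mass[OF \<open>n \<noteq> 0\<close>] show False by simp
qed

section \<open>Positive definite square roots\<close>

lemma pos_def_inner_commute:
  assumes "pos_def A"
  shows "(A *v x) \<bullet> y = x \<bullet> (A *v y)"
proof -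
  have "(A *v x) \<bullet> y = (transpose A *v x) \<bullet> y" using assms by (simp add: pos_def_def)
  also have "\<dots> = x \<bullet> (A *v y)" by (simp add: transpose_matrix_vector dot_lmul_matrix)
  finally show ?thesis .
qed

lemma pos_def_coercive:
  fixes A :: "real ^ 'n ^ 'n"
  assumes "pos_def A"
  shows "\<exists>l>0. \<forall>x. l * (norm x)\<^sup>2 \<le> x \<bullet> (A *v x)"
proof -
  have "continuous_on (sphere 0 1) (\<lambda>x. x \<bullet> (A *v x))"
    by (intro continuous_intros matrix_vector_mult_linear_continuous_on)
  moreover have "sphere (0 :: real ^ 'n) 1 \<noteq> {}" by simp
  ultimately obtain a where a: "a \<in> sphere 0 1" "\<And>x. x \<in> sphere 0 1 \<Longrightarrow> a \<bullet> (A *v a) \<le> x \<bullet> (A *v x)"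
    using continuous_attains_inf[of "sphere 0 1" "\<lambda>x. x \<bullet> (A *v x)"] by auto
  have "a \<noteq> 0" using a(1) by auto
  then have pos: "0 < a \<bullet> (A *v a)" using assms by (simp add: pos_def_def)
  have "a \<bullet> (A *v a) * (norm x)\<^sup>2 \<le> x \<bullet> (A *v x)" for x
  proof (cases "x = 0")
    case False
    define y where "y = (1 / norm x) *\<^sub>R x"
    have "y \<in> sphere 0 1" using False by (simp add: y_def)
    then have "a \<bullet> (A *v a) \<le> y \<bullet> (A *v y)" by (rule a(2))
    also have "\<dots> = (x \<bullet> (A *v x)) / (norm x)\<^sup>2"
      by (simp add: y_def matrix_vector_mult_scaleR power2_eq_square)
    finally show ?thesis using False by (simp add: field_simps)
  qed simp
  then show ?thesis using pos by blast
qed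

text \<open>After scaling, \<open>S = 1 - X\<close> with \<open>\<parallel>X\<parallel> < 1\<close>, and \<open>1 - Y\<close> squares to \<open>S\<close> exactly when \<open>Y\<close> is
  a fixed point of the contraction \<open>Y \<mapsto> (X + Y\<^sup>2) / 2\<close>.\<close>

lemma pos_def_sqrt_exists:
  fixes S :: "real ^ 'n ^ 'n"
  assumes S: "pos_def S"
  shows "\<exists>B. pos_def B \<and> B ** B = S"
proof -
  obtain l where l: "l > 0" "\<And>x. l * (norm x)\<^sup>2 \<le> x \<bullet> (S *v x)"
    using pos_def_coercive[OF S] by blast
  obtain L0 where L0: "\<And>x. norm (S *v x) \<le> norm x * L0"
    using bounded_linear.bounded[OF matrix_vector_mul_bounded_linear[of S]] by blast
  define L where "L = max L0 l"
  have L: "L \<ge> l" "norm (S *v x) \<le> L * norm x" for x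
    using order_trans[OF L0[of x] mult_left_mono[of L0 L "norm x"]] by (auto simp: L_def mult.commute)
  \<comment> \<open>The norm of x - S x / c satisfies |x - S x / c|^2 \<le> (1 - 2 l / c + L^2 /
    c^2) |x|^2. The value c = L^2 / l minimizes the bracket and turns it into 1 - (l / L)^2, the
    square of \<rho>.\<close>
  define c where "c = L\<^sup>2 / l"
  have c: "c > 0" using l L by (auto simp: c_def)
  define \<rho> where "\<rho> = sqrt (1 - (l / L)\<^sup>2)"
  have lL: "0 < l / L" "l / L \<le> 1" using l L(1) by auto
  have \<rho>: "0 \<le> \<rho>" "\<rho> < 1" "\<rho>\<^sup>2 = 1 - (l / L)\<^sup>2"
    using lL by (auto simp: \<rho>_def power_le_one)
  define X :: "(real ^ 'n) \<Rightarrow>\<^sub>L (real ^ 'n)" where "X = Blinfun (\<lambda>x. x - (1 / c) *\<^sub>R (S *v x))"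
  have X: "blinfun_apply X x = x - (1 / c) *\<^sub>R (S *v x)" for x
    unfolding X_def
    by (subst bounded_linear_Blinfun_apply)
      (auto intro!: bounded_linear_sub bounded_linear_ident bounded_linear_const_scaleR matrix_vector_mul_bounded_linear)
  have nX: "norm X \<le> \<rho>"
  proof (rule norm_blinfun_bound)
    fix x
    have "(norm (blinfun_apply X x))\<^sup>2 = (norm x)\<^sup>2 - 2 / c * (x \<bullet> (S *v x)) + (norm (S *v x))\<^sup>2 / c\<^sup>2"
      unfolding power2_norm_eq_inner X
      by (simp add: inner_diff_left inner_diff_right inner_commute field_simps power2_eq_square)
    also have "\<dots> \<le> (norm x)\<^sup>2 - 2 / c * (l * (norm x)\<^sup>2) + (L * norm x)\<^sup>2 / c\<^sup>2"
      using l c L(2)[of x] by (intro add_mono diff_mono mult_left_mono divide_right_mono power_mono) auto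
    also have "\<dots> = (\<rho> * norm x)\<^sup>2"
    proof -
      have "2 / c * (l * (norm x)\<^sup>2) = 2 * (l / L)\<^sup>2 * (norm x)\<^sup>2"
        using l L(1) by (simp add: c_def power2_eq_square)
      moreover have "(L * norm x)\<^sup>2 / c\<^sup>2 = (l / L)\<^sup>2 * (norm x)\<^sup>2"
        using l L(1) by (simp add: c_def power2_eq_square)
      ultimately show ?thesis unfolding power_mult_distrib \<rho> by (simp add: algebra_simps)
    qed
    finally show "norm (blinfun_apply X x) \<le> \<rho> * norm x"
      by (rule power2_le_imp_le) (use \<rho> in auto)
  qed (use \<rho> in auto)
  \<comment> \<open>Self-adjointness is built into the domain of the fixed-point map, so the square
    root comes out symmetric. \<open>F\<close> preserves the ball because \<rho> + \<rho>^2 \<le> 2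
    \<rho>.\<close>
  define D where "D = {Y :: (real ^ 'n) \<Rightarrow>\<^sub>L (real ^ 'n). norm Y \<le> \<rho> \<and> (\<forall>x y. blinfun_apply Y x \<bullet> y = x \<bullet> blinfun_apply Y y)}"
  define F where "F Y = (1 / 2) *\<^sub>R (X + (Y o\<^sub>L Y))" for Y
  have Xsym: "blinfun_apply X x \<bullet> y = x \<bullet> blinfun_apply X y" for x y
    using pos_def_inner_commute[OF S, of x y] by (simp add: X algebra_simps)
  have ev: "continuous_on UNIV (\<lambda>Y :: (real ^ 'n) \<Rightarrow>\<^sub>L (real ^ 'n). blinfun_apply Y x)" for x
    by (rule linear_continuous_on[OF blinfun.bounded_linear_left])
  have "D = cball 0 \<rho> \<inter> (\<Inter>x y. {Y. blinfun_apply Y x \<bullet> y = x \<bullet> blinfun_apply Y y})"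
    by (auto simp: D_def)
  moreover have "closed {Y :: (real ^ 'n) \<Rightarrow>\<^sub>L (real ^ 'n). blinfun_apply Y x \<bullet> y = x \<bullet> blinfun_apply Y y}" for x y
    by (intro closed_Collect_eq continuous_on_inner ev continuous_on_const)
  ultimately have "closed D" by (auto intro!: closed_INT)
  note complete_eq_closed[THEN iffD2, OF this]
  moreover have "D \<noteq> {}"
    using \<rho> by (auto simp: D_def intro!: exI[of _ 0])
  moreover have "F ` D \<subseteq> D"
  proof safe
    fix Y assume Y: "Y \<in> D"
    have "norm (Y o\<^sub>L Y) \<le> \<rho> * \<rho>"
      using Y norm_blinfun_compose[of Y Y] mult_mono[of "norm Y" \<rho> "norm Y" \<rho>] \<rho> by (auto simp: D_def)
    also have "\<rho> * \<rho> \<le> \<rho>" using \<rho> by (simp add: mult_left_le)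
    finally have "norm (F Y) \<le> \<rho>"
      using norm_triangle_ineq[of X "Y o\<^sub>L Y"] nX by (simp add: F_def)
    then show "F Y \<in> D"
      using Y Xsym by (simp add: D_def F_def blinfun.add_left blinfun.scaleR_left inner_add_left inner_add_right)
  qed
  moreover have "dist (F Y) (F Z) \<le> \<rho> * dist Y Z" if "Y \<in> D" "Z \<in> D" for Y Z
  proof -
    \<comment> \<open>Noncommutative factorization Y^2 - Z^2 = Y (Y - Z) + (Y - Z) Z.\<close>
    have "F Y - F Z = (1 / 2) *\<^sub>R ((Y o\<^sub>L (Y - Z)) + ((Y - Z) o\<^sub>L Z))"
      by (rule blinfun_eqI) (simp add: F_def blinfun.add_left blinfun.scaleR_left blinfun.diff_left blinfun.diff_right algebra_simps)
    then have "dist (F Y) (F Z) = 1 / 2 * norm ((Y o\<^sub>L (Y - Z)) + ((Y - Z) o\<^sub>L Z))"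
      by (simp add: dist_norm)
    also have "\<dots> \<le> 1 / 2 * (norm Y * norm (Y - Z) + norm (Y - Z) * norm Z)"
      by (intro mult_left_mono order_trans[OF norm_triangle_ineq add_mono] norm_blinfun_compose) simp
    also have "\<dots> \<le> 1 / 2 * (\<rho> * norm (Y - Z) + norm (Y - Z) * \<rho>)"
      using that by (intro mult_left_mono add_mono mult_right_mono) (auto simp: D_def)
    finally show ?thesis by (simp add: dist_norm)
  qed
  ultimately obtain Y where Y: "Y \<in> D" "F Y = Y"
    using Banach_fix[of D \<rho> F] \<rho> by blast
  \<comment> \<open>\<open>W\<close> is the operator 1 - Y scaled back by \<open>sqrt c\<close>. The
    fixed-point equation Y^2 = 2 Y - X gives (1 - Y)^2 = 1 - X = S / c, and the norm bound \<rho> <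
    1 makes \<open>W\<close> positive.\<close>
  define W where "W x = sqrt c *\<^sub>R (x - blinfun_apply Y x)" for x
  have linW: "linear W"
    unfolding W_def by (intro linearI) (simp_all add: blinfun.add_right blinfun.scaleR_right algebra_simps)
  have WW: "W (W x) = S *v x" for x
  proof -
    have "blinfun_apply Y (blinfun_apply Y x) = 2 *\<^sub>R blinfun_apply Y x - blinfun_apply X x"
    proof -
      have "blinfun_apply (2 *\<^sub>R F Y) x = 2 *\<^sub>R blinfun_apply Y x" by (simp add: Y blinfun.scaleR_left)
      then show ?thesis by (simp add: F_def blinfun.add_left blinfun.scaleR_left algebra_simps)
    qed
    then have "x - blinfun_apply Y x - blinfun_apply Y (x - blinfun_apply Y x) = (1 / c) *\<^sub>R (S *v x)"
      by (simp add: X blinfun.diff_right scaleR_2)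
    moreover have "W (W x) = (sqrt c * sqrt c) *\<^sub>R (x - blinfun_apply Y x - blinfun_apply Y (x - blinfun_apply Y x))"
      unfolding W_def by (simp only: blinfun.scaleR_right scaleR_scaleR flip: scaleR_diff_right)
    ultimately show ?thesis using c by simp
  qed
  have Wpos: "0 < x \<bullet> W x" if "x \<noteq> 0" for x
  proof -
    have "norm Y \<le> \<rho>" using Y by (simp add: D_def)
    then have "norm (blinfun_apply Y x) \<le> \<rho> * norm x"
      using norm_blinfun[of Y x] mult_right_mono[of "norm Y" \<rho> "norm x"] by simp
    then have "x \<bullet> blinfun_apply Y x \<le> norm x * (\<rho> * norm x)"
      using norm_cauchy_schwarz[of x "blinfun_apply Y x"] mult_left_mono[of _ _ "norm x"] by (meson norm_ge_zero order_trans)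
    also have "\<dots> < norm x * norm x" using that \<rho> by simp
    finally have "0 < x \<bullet> (x - blinfun_apply Y x)" by (simp add: inner_diff_right flip: power2_norm_eq_inner power2_eq_square)
    then show ?thesis using c by (simp add: W_def)
  qed
  define B where "B = matrix W"
  have B: "B *v x = W x" for x
    unfolding B_def using linW by (simp add: matrix_works)
  have "x \<bullet> (transpose B *v y) = x \<bullet> (B *v y)" for x y
  proof -
    have "x \<bullet> (transpose B *v y) = (B *v x) \<bullet> y"
      using dot_lmul_matrix[of y B x] by (simp add: transpose_matrix_vector inner_commute)
    also have "\<dots> = x \<bullet> (B *v y)"
      using Y(1) by (simp add: B W_def D_def inner_diff_left inner_diff_right)
    finally show ?thesis .
  qed
  then have "transpose B *v y = B *v y" for y by (metis vector_eq_ldot)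
  then have "transpose B = B" by (simp add: matrix_eq)
  moreover have "B ** B = S"
    by (simp add: matrix_eq B WW flip: matrix_vector_mul_assoc)
  ultimately show ?thesis using Wpos B by (auto simp: pos_def_def)
qed

text \<open>With \<open>D = B - C\<close> and \<open>M = B + C\<close> one has \<open>M D + D M = 0\<close>, so the trace of the positive
  semidefinite matrix \<open>D M D\<close> vanishes.\<close>

lemma pos_def_sqrt_unique:
  fixes B C :: "real ^ 'n ^ 'n"
  assumes B: "pos_def B" and C: "pos_def C" and eq: "B ** B = C ** C"
  shows "B = C"
proof -
  define D M where "D = B - C" and "M = B + C"
  have sym: "transpose D = D"
    using B C by (simp add: D_def pos_def_def transpose_def vec_eq_iff)
  have "B *v (B *v x) = C *v (C *v x)" for x
    using eq by (simp add: matrix_vector_mul_assoc)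
  then have comm: "M *v (D *v x) = - (D *v (M *v x))" for x
    by (simp add: M_def D_def matrix_vector_mult_add_rdistrib matrix_vector_mult_diff_rdistrib
        matrix_vector_right_distrib matrix_vector_mult_diff_distrib)
  have "(M ** D) *v x = (0 - D ** M) *v x" for x
    unfolding matrix_vector_mult_diff_rdistrib matrix_vector_mul_assoc[symmetric] comm by simp
  then have anti: "M ** D = 0 - D ** M" by (simp only: matrix_eq) simp
  \<comment> \<open>Cyclicity of the trace turns the anticommutation into tr(DMD) = -
    tr(DMD).\<close>
  have "trace (D ** (M ** D)) = - trace (D ** (D ** M))"
    unfolding anti by (simp add: trace_def matrix_matrix_mult_def sum_negf)
  also have "trace (D ** (D ** M)) = trace (D ** (M ** D))"
    using trace_mul_sym[of D "D ** M"] by (simp add: matrix_mul_assoc)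
  finally have tr: "trace (D ** (M ** D)) = 0" by simp
  \<comment> \<open>A diagonal entry is the quadratic form of \<open>M\<close> at a column of
    \<open>D\<close>, hence nonnegative; since the entries sum to 0, positivity of \<open>M\<close>
    kills every column.\<close>
  have diag: "(D ** (M ** D)) $ i $ i = (D *v axis i 1) \<bullet> (M *v (D *v axis i 1))" for i
  proof -
    have "(D ** (M ** D)) $ i $ i = axis i 1 \<bullet> ((D ** (M ** D)) *v axis i 1)"
      by (simp add: inner_axis' matrix_vector_mult_basis column_def)
    also have "\<dots> = axis i 1 \<bullet> (D *v (M *v (D *v axis i 1)))"
      by (simp add: matrix_vector_mul_assoc)
    also have "\<dots> = (transpose D *v axis i 1) \<bullet> (M *v (D *v axis i 1))"
      by (simp add: transpose_matrix_vector dot_lmul_matrix)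
    finally show ?thesis by (simp add: sym)
  qed
  have M: "0 < x \<bullet> (M *v x)" if "x \<noteq> 0" for x
    using B C that by (simp add: M_def pos_def_def matrix_vector_mult_add_rdistrib inner_add_right add_pos_pos)
  then have M0: "0 \<le> x \<bullet> (M *v x)" for x by (cases "x = 0") (auto simp: less_imp_le)
  have "D *v axis i 1 = 0" for i
  proof -
    have "(D ** (M ** D)) $ i $ i = 0"
      using tr M0 unfolding trace_def by (subst (asm) sum_nonneg_eq_0_iff) (auto simp: diag)
    then show ?thesis using M[of "D *v axis i 1"] by (auto simp: diag)
  qed
  then have "D $ j $ i = 0" for i j
    by (metis matrix_vector_mult_basis column_def vec_lambda_beta zero_index)
  then show ?thesis by (simp add: D_def vec_eq_iff)
qed

lemma
  assumes "pos_def S"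
  shows pos_def_matrix_sqrt: "pos_def (matrix_sqrt S)"
    and matrix_sqrt_square: "matrix_sqrt S ** matrix_sqrt S = S"
proof -
  have "\<exists>!B. pos_def B \<and> B ** B = S"
    using pos_def_sqrt_exists[OF assms] pos_def_sqrt_unique by metis
  from theI'[OF this] show "pos_def (matrix_sqrt S)" "matrix_sqrt S ** matrix_sqrt S = S"
    by (auto simp: matrix_sqrt_def)
qed

section \<open>Linear changes of variables and elliptical densities\<close>

lemma pos_def_invertible:
  assumes "pos_def A"
  shows "invertible A"
proof -
  have "x = 0" if "A *v x = 0" for x
    using assms that by (force simp: pos_def_def)
  then show ?thesis
    by (simp add: invertible_left_inverse matrix_left_invertible_ker)
qed

lemma matrix_inv_mult:
  assumes "invertible A"
  shows "A ** matrix_inv A = mat 1" "matrix_inv A ** A = mat 1"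
proof -
  have "A ** matrix_inv A = mat 1 \<and> matrix_inv A ** A = mat 1"
    unfolding matrix_inv_def by (rule someI_ex) (use assms in \<open>simp add: invertible_def\<close>)
  then show "A ** matrix_inv A = mat 1" "matrix_inv A ** A = mat 1" by auto
qed

text \<open>The library has this only for index types of class \<open>wellorder\<close>.\<close>

lemma measure_matrix_image:
  fixes A :: "real ^ 'n ^ 'n"
  shows "\<forall>S\<in>lmeasurable. (*v) A ` S \<in> lmeasurable \<and> measure lebesgue ((*v) A ` S) = \<bar>det A\<bar> * measure lebesgue S" (is "?P A")
proof (rule induct_matrix_elementary_alt)
  fix A B :: "real ^ 'n ^ 'n"
  assume A: "?P A"
    and B: "?P B"
  have "(*v) (A ** B) ` S = (*v) A ` (*v) B ` S" for S
    by (auto simp: image_comp o_def matrix_vector_mul_assoc)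
  with A B show "?P (A ** B)"
    by (simp add: det_mul abs_mult)
next
  fix A :: "real ^ 'n ^ 'n" and i
  assume "row i A = 0"
  then have d: "det A = 0" by (rule det_zero_row)
  then have "\<not> invertible A" by (simp add: invertible_det_nz)
  then have "\<not> inj ((*v) A)"
    by (simp add: invertible_left_inverse matrix_left_invertible_injective)
  then have "negligible ((*v) A ` S)" for S
    by (intro negligible_linear_singular_image) auto
  then show "?P A"
    by (simp add: d negligible_imp_measurable negligible_imp_measure0)
next
  fix A :: "real ^ 'n ^ 'n"
  assume diag: "\<And>i j. i \<noteq> j \<Longrightarrow> A $ i $ j = 0"
  have "A *v x = (\<chi> k. A $ k $ k * x $ k)" for x
  proof -
    have "(\<Sum>j\<in>UNIV. A $ i $ j * x $ j) = A $ i $ i * x $ i" for i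
      using diag by (subst sum.remove[of _ i]) (auto intro!: sum.neutral)
    then show ?thesis by (simp add: matrix_vector_mult_def)
  qed
  then have eq: "(*v) A = (\<lambda>x. \<chi> k. A $ k $ k * x $ k)" by (simp add: fun_eq_iff)
  show "?P A"
    unfolding eq by (simp add: measurable_stretch measure_stretch det_diagonal[OF diag])
next
  fix m n :: 'n assume "m \<noteq> n"
  let ?\<tau> = "Transposition.transpose m n"
  let ?A = "(\<chi> i j. mat 1 $ i $ ?\<tau> j) :: real ^ 'n ^ 'n"
  have app: "?A *v x = (\<chi> i. x $ ?\<tau> i)" for x
  proof -
    have "(\<Sum>j\<in>UNIV. (mat 1 :: real ^ 'n ^ 'n) $ i $ ?\<tau> j * x $ j) = x $ ?\<tau> i" for i
    proof -
      have "(\<Sum>j\<in>UNIV. (mat 1 :: real ^ 'n ^ 'n) $ i $ ?\<tau> j * x $ j) = (\<Sum>j\<in>UNIV. if j = ?\<tau> i then x $ j else 0)"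
        by (intro sum.cong) (auto simp: mat_def)
      then show ?thesis by simp
    qed
    then show ?thesis by (simp add: matrix_vector_mult_def)
  qed
  \<comment> \<open>The coordinate swap is an involution, which fixes its determinant up to
    sign.\<close>
  have "?A ** ?A = mat 1"
    by (simp add: matrix_eq app vec_eq_iff flip: matrix_vector_mul_assoc)
  then have "det ?A * det ?A = 1" using det_mul[of ?A ?A] by simp
  then have d: "\<bar>det ?A\<bar> = 1"
    using abs_square_eq_1[of "det ?A"] by (simp add: power2_eq_square)
  have box: "measure lebesgue ((*v) ?A ` cbox a b) = 1 * measure lebesgue (cbox a b)" for a b
  proof (cases "cbox a b = {}")
    case False
    have img: "(*v) ?A ` cbox a b = cbox (?A *v a) (?A *v b)"
    proof safe
      fix x assume "x \<in> cbox a b" then show "?A *v x \<in> cbox (?A *v a) (?A *v b)"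
        by (simp add: app mem_box_cart)
    next
      fix x assume x: "x \<in> cbox (?A *v a) (?A *v b)"
      have "?A *v x \<in> cbox a b"
        unfolding mem_box_cart
      proof
        fix i show "a $ i \<le> (?A *v x) $ i \<and> (?A *v x) $ i \<le> b $ i"
          using x[unfolded mem_box_cart, rule_format, of "?\<tau> i"] by (simp add: app)
      qed
      moreover have "x = ?A *v (?A *v x)" by (simp add: app vec_eq_iff)
      ultimately show "x \<in> (*v) ?A ` cbox a b" by blast
    qed
    then have "cbox (?A *v a) (?A *v b) \<noteq> {}" using False by auto
    then show ?thesis
      using prod.permute[OF permutes_swap_id[of m UNIV n], of "\<lambda>i. b $ i - a $ i"]
      unfolding img by (simp add: content_cbox_cart False app o_def)
  qed simp
  show "?P ?A"
  proof
    fix S :: "(real ^ 'n) set" assume "S \<in> lmeasurable"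
    from measure_linear_sufficient[OF matrix_vector_mul_linear this box]
    show "(*v) ?A ` S \<in> lmeasurable \<and> measure lebesgue ((*v) ?A ` S) = \<bar>det ?A\<bar> * measure lebesgue S"
      unfolding d by metis
  qed
next
  fix m n :: 'n assume mn: "m \<noteq> n"
  let ?A = "(\<chi> i j. of_bool (i = m \<and> j = n \<or> i = j)) :: real ^ 'n ^ 'n"
  let ?h = "\<lambda>x :: real ^ 'n. \<chi> i. if i = m then x $ m + x $ n else x $ i"
  have app: "(*v) ?A = ?h"
  proof
    fix x :: "real ^ 'n"
    have "(\<Sum>j\<in>UNIV. of_bool (i = m \<and> j = n \<or> i = j) * x $ j) = (if i = m then x $ m + x $ n else x $ i)" for i
    proof -
      have "(\<Sum>j\<in>UNIV. of_bool (i = m \<and> j = n \<or> i = j) * x $ j) =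
          (\<Sum>j\<in>UNIV. (if j = i then x $ j else 0) + (if j = n then (if i = m then x $ j else 0) else 0))"
        using mn by (intro sum.cong) auto
      then show ?thesis by (simp add: sum.distrib)
    qed
    then show "?A *v x = ?h x" by (simp add: matrix_vector_mult_def)
  qed
  have lin: "linear ?h" unfolding app[symmetric] by (rule matrix_vector_mul_linear)
  have eq: "?A = (\<chi> k. if k = m then row m (mat 1) + 1 *s row n (mat 1) else row k (mat 1))"
    using mn by (auto simp: vec_eq_iff row_def mat_def)
  have "det ?A = det (mat 1 :: real ^ 'n ^ 'n)"
    unfolding eq by (rule det_row_operation[OF mn])
  then have d: "det ?A = 1" by simp
  have box: "measure lebesgue (?h ` cbox a b) = 1 * measure lebesgue (cbox a b)" for a b
  proof (cases "cbox a b = {}")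
    case False
    \<comment> \<open>\<open>measure_shear_interval\<close> asks for a nonnegative lower corner in
      coordinate \<open>n\<close>; translating by \<open>v\<close> moves it to 0. By linearity the
      image is translated by \<open>?h v\<close>, with no effect on its measure.\<close>
    define v where "v = axis n (- a $ n)"
    have v: "cbox (v + a) (v + b) = (+) v ` cbox a b" by (simp add: cbox_translation)
    have "?h ` cbox (v + a) (v + b) = (+) (?h v) ` ?h ` cbox a b"
      unfolding v image_comp o_def by (intro image_cong refl linear_add[OF lin])
    then have "measure lebesgue (?h ` cbox a b) = measure lebesgue (?h ` cbox (v + a) (v + b))"
      by (simp only: measure_translation)
    also have "\<dots> = measure lebesgue (cbox (v + a) (v + b))"
      using mn False by (intro measure_shear_interval) (auto simp: v v_def[symmetric], simp add: v_def)
    also have "\<dots> = measure lebesgue (cbox a b)"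
      unfolding v by (rule measure_translation)
    finally show ?thesis by simp
  qed simp
  show "?P ?A"
  proof
    fix S :: "(real ^ 'n) set" assume "S \<in> lmeasurable"
    from measure_linear_sufficient[OF lin this box]
    show "(*v) ?A ` S \<in> lmeasurable \<and> measure lebesgue ((*v) ?A ` S) = \<bar>det ?A\<bar> * measure lebesgue S"
      unfolding d app abs_one by metis
  qed
qed

text \<open>Boxes suffice: their preimages under \<open>T\<close> are their images under the
  inverse, whose determinant cancels the density.\<close>

lemma lborel_linear_transform:
  fixes T :: "real ^ 'n ^ 'n"
  assumes T: "invertible T"
  shows "lborel = density (distr lborel borel ((*v) T)) (\<lambda>_. ennreal \<bar>det T\<bar>)"
proof (rule lborel_eqI)
  fix l u :: "real ^ 'n" assume lu: "\<And>b. b \<in> Basis \<Longrightarrow> l \<bullet> b \<le> u \<bullet> b"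
  define R where "R = matrix_inv T"
  have R: "T ** R = mat 1" "R ** T = mat 1" unfolding R_def using matrix_inv_mult[OF T] by auto
  have TR: "T *v (R *v x) = x" "R *v (T *v x) = x" for x
    by (simp_all add: matrix_vector_mul_assoc R)
  have [measurable]: "(*v) T \<in> borel_measurable borel"
    by (intro borel_measurable_continuous_onI matrix_vector_mult_linear_continuous_on)
  have detR: "\<bar>det T\<bar> * \<bar>det R\<bar> = 1"
    using det_mul[of T R] R by (simp add: abs_mult[symmetric])
  have pre: "(*v) T -` box l u = (*v) R ` box l u"
    using TR by (auto simp: image_iff) (metis TR(2))
  have "measure lebesgue ((*v) R ` box l u) = \<bar>det R\<bar> * measure lebesgue (box l u)"
      "(*v) R ` box l u \<in> lmeasurable"
    using measure_matrix_image[of R] by auto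
  moreover have "(*v) R ` box l u \<in> sets borel"
    unfolding pre[symmetric] using measurable_sets[of "(*v) T" borel borel "box l u"] by simp
  moreover have "emeasure lborel X = ennreal (measure lebesgue X)" if "X \<in> lmeasurable" "X \<in> sets borel" for X :: "(real ^ 'n) set"
    using emeasure_eq_measure2[OF that(1)] that(2) by simp
  ultimately have "emeasure lborel ((*v) T -` box l u) = ennreal (\<bar>det R\<bar> * measure lebesgue (box l u))"
    unfolding pre by metis
  then have "emeasure (density (distr lborel borel ((*v) T)) (\<lambda>_. ennreal \<bar>det T\<bar>)) (box l u) =
      ennreal \<bar>det T\<bar> * ennreal (\<bar>det R\<bar> * measure lebesgue (box l u))"
    by (simp add: emeasure_density nn_integral_cmult_indicator emeasure_distr)
  also have "\<dots> = ennreal (measure lebesgue (box l u))"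
    using detR by (simp flip: ennreal_mult' mult.assoc)
  also have "\<dots> = ennreal (\<Prod>b\<in>Basis. (u - l) \<bullet> b)"
    using lu by (simp add: measure_lborel_box_eq)
  finally show "emeasure (density (distr lborel borel ((*v) T)) (\<lambda>_. ennreal \<bar>det T\<bar>)) (box l u) =
      ennreal (\<Prod>b\<in>Basis. (u - l) \<bullet> b)" .
qed simp

text \<open>The normalizing factor is the Jacobian of the substitution: det S is the square of the
  determinant of the root, so its power -1/2 is the absolute determinant of the inverse
  root.\<close>

lemma prob_density_elliptical:
  fixes S :: "real ^ 'n ^ 'n"
  assumes S: "pos_def S" and q0: "prob_density q0"
  shows "prob_density (\<lambda>x. det S powr (- 1 / 2) * q0 (matrix_inv (matrix_sqrt S) *v x))"
proof -
  define B T where "B = matrix_sqrt S" and "T = matrix_inv B"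
  have invB: "invertible B" unfolding B_def by (rule pos_def_invertible[OF pos_def_matrix_sqrt[OF S]])
  have TB: "T ** B = mat 1" "B ** T = mat 1" unfolding T_def using matrix_inv_mult[OF invB] by auto
  then have invT: "invertible T" unfolding invertible_def by blast
  have dT: "det T * det B = 1" using det_mul[of T B] TB by simp
  have dS: "det S = (det B)\<^sup>2"
    using det_mul[of B B] matrix_sqrt_square[OF S] by (simp add: B_def power2_eq_square)
  have "det S powr (- 1 / 2) = \<bar>det T\<bar>"
  proof -
    have nz: "det B \<noteq> 0" using dT by auto
    then have "det S powr (- 1 / 2) = inverse (sqrt ((det B)\<^sup>2))"
      unfolding dS by (simp add: powr_minus powr_half_sqrt)
    also have "\<dots> = \<bar>det T\<bar>" using dT nz by (simp add: field_simps flip: abs_mult)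
    finally show ?thesis .
  qed
  moreover have [measurable]: "q0 \<in> borel_measurable borel" and q00: "\<And>x. 0 \<le> q0 x"
    and q01: "(\<integral>\<^sup>+x. ennreal (q0 x) \<partial>lborel) = 1"
    using q0 by (auto simp: prob_density_def)
  moreover have [measurable]: "(*v) T \<in> borel_measurable borel"
    by (intro borel_measurable_continuous_onI matrix_vector_mult_linear_continuous_on)
  moreover have "(\<integral>\<^sup>+x. ennreal (\<bar>det T\<bar> * q0 (T *v x)) \<partial>lborel) = 1"
  proof -
    have "(\<integral>\<^sup>+x. ennreal (\<bar>det T\<bar> * q0 (T *v x)) \<partial>lborel) = (\<integral>\<^sup>+x. ennreal \<bar>det T\<bar> * ennreal (q0 (T *v x)) \<partial>lborel)"
      using q00 by (intro nn_integral_cong) (simp add: ennreal_mult)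
    also have "\<dots> = (\<integral>\<^sup>+x. ennreal \<bar>det T\<bar> * ennreal (q0 x) \<partial>distr lborel borel ((*v) T))"
      by (subst nn_integral_distr) auto
    also have "\<dots> = (\<integral>\<^sup>+x. ennreal (q0 x) \<partial>density (distr lborel borel ((*v) T)) (\<lambda>_. ennreal \<bar>det T\<bar>))"
      by (rule nn_integral_density[symmetric]) auto
    also have "\<dots> = 1" using q01 lborel_linear_transform[OF invT] by simp
    finally show ?thesis .
  qed
  ultimately show ?thesis
    unfolding prob_density_def B_def[symmetric] T_def[symmetric] by auto
qed

section \<open>Ergodicity\<close>

text \<open>For t > 1 the power is raised to an integer exponent k \<ge> s and compared with (1 + t
  / k)^k \<le> exp t. The \<open>Suc\<close> in \<open>k\<close> keeps the division legitimate when
  s = 0.\<close>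

lemma powr_le_exp:
  fixes s :: real
  assumes s: "0 \<le> s"
  shows "\<exists>D>0. \<forall>t\<ge>0. t powr s \<le> D * exp t"
proof -
  define k where "k = Suc (nat \<lceil>s\<rceil>)"
  have "t powr s \<le> (1 + real k ^ k) * exp t" if t: "0 \<le> t" for t :: real
  proof (cases "t \<le> 1")
    case True
    have "t powr s \<le> 1 * 1" using powr_le1[OF s, of t] t True by simp
    also have "\<dots> \<le> (1 + real k ^ k) * exp t" using t by (intro mult_mono) auto
    finally show ?thesis .
  next
    case False
    have "s \<le> real k" unfolding k_def by linarith
    then have "t powr s \<le> t powr real k"
      using False by (intro powr_mono) auto
    also have "\<dots> = t ^ k" using False by (simp add: powr_realpow)
    also have "\<dots> = real k ^ k * (t / real k) ^ k" by (simp add: power_divide k_def)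
    also have "\<dots> \<le> real k ^ k * (1 + t / real k) ^ k"
      using t by (intro mult_left_mono power_mono) auto
    also have "\<dots> \<le> real k ^ k * exp t"
      using t by (intro mult_left_mono exp_ge_one_plus_x_over_n_power_n) (auto simp: k_def)
    also have "\<dots> \<le> (1 + real k ^ k) * exp t" by (simp add: distrib_right)
    finally show ?thesis .
  qed
  then show ?thesis by (intro exI[of _ "1 + real k ^ k"]) (auto simp: add_pos_nonneg)
qed

lemma powr_times_geometric_tendsto_0:
  assumes "0 < \<rho>" "\<rho> < 1"
  shows "(\<lambda>n. real n powr s * \<rho> ^ n) \<longlonglongrightarrow> 0"
  using assms by real_asymp

lemma class_P_growth_and_drift:
  fixes \<pi> q :: "real ^ 'n \<Rightarrow> real"
  assumes \<pi>: "\<pi> \<in> class_P" and chain: "srwm_chain \<pi> q"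
  shows "\<exists>a>0. \<forall>x. a * exp (norm x) \<le> metro_weight \<pi> x"
    and "\<exists>R. \<forall>x. R \<le> norm x \<longrightarrow> (\<integral>y. drift_factor (\<pi> (x + y) / \<pi> x) * q y \<partial>lborel) \<le> 3 / 4"
proof -
  interpret srwm_chain \<pi> q by (rule chain)
  obtain Z g c where Z: "0 < Z" and eq: "\<And>x. \<pi> x = Z * (g x * exp (- poly_eval c x))"
    and g0: "\<And>x. 0 < g x" and g: "slowly_varying g" and fin: "finite (poly_support c)"
    and ev: "even (poly_order c)" and lead: "filterlim (leading_part_eval c) at_top at_infinity"
    using \<pi> unfolding class_P_def by blast
  obtain m G \<kappa> R where m: "2 \<le> m" and fo: "first_order (poly_eval c) G m" and \<kappa>: "0 < \<kappa>"
    and G: "\<And>x. R \<le> norm x \<Longrightarrow> \<kappa> * ((1 + norm x) ^ m / (1 + norm x)) \<le> norm (G x)"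
    and p: "\<And>x. R \<le> norm x \<Longrightarrow> \<kappa> * (1 + norm x) ^ m \<le> poly_eval c x"
    using polynomial_expansion[OF fin ev lead] by blast
  show "\<exists>R. \<forall>x. R \<le> norm x \<longrightarrow> (\<integral>y. drift_factor (\<pi> (x + y) / \<pi> x) * q y \<partial>lborel) \<le> 3 / 4"
    by (rule drift_at_infinity[OF chain Z eq g g0 m fo \<kappa> G])
  have pe: "continuous_on UNIV (poly_eval c)"
    unfolding poly_eval_def[abs_def] mon_def by (intro continuous_intros)
  \<comment> \<open>Continuity of \<open>g\<close> is recovered from that of the density and of the
    polynomial, as \<open>class_P\<close> does not assert it directly.\<close>
  have "g = (\<lambda>x. \<pi> x * exp (poly_eval c x) / Z)"
    using Z by (simp add: eq fun_eq_iff flip: exp_add)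
  then have "continuous_on UNIV g"
    using Z by (auto intro!: continuous_intros \<pi>_cont pe)
  then obtain C where C: "0 < C" "\<And>x. g x \<le> C * exp (norm x)"
    using slowly_varying_subexponential[OF g g0] by blast
  \<comment> \<open>Beyond \<open>R1\<close> the polynomial exceeds 3 |x|. One |x| pays for the
    growth of \<open>g\<close>; the remaining decay exp (-2 |x|) becomes growth exp |x| of the
    weight under the inverse square root.\<close>
  define R1 where "R1 = max R (3 / \<kappa>)"
  have far: "\<pi> x \<le> Z * C * exp (- 2 * norm x)" if "R1 \<le> norm x" for x
  proof -
    define N where "N = 1 + norm x"
    have N: "1 \<le> N" by (simp add: N_def)
    have "3 \<le> \<kappa> * N" using that \<kappa> by (simp add: R1_def N_def field_simps)
    then have "3 * N \<le> \<kappa> * N * N" using N by (intro mult_right_mono) auto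
    also have "\<dots> = \<kappa> * N ^ 2" by (simp add: power2_eq_square)
    also have "\<dots> \<le> \<kappa> * N ^ m" using N m \<kappa> by (intro mult_left_mono power_increasing) auto
    also have "\<dots> \<le> poly_eval c x" using that by (simp add: N_def p R1_def)
    finally have "3 * norm x \<le> poly_eval c x" by (simp add: N_def)
    then have "\<pi> x \<le> Z * ((C * exp (norm x)) * exp (- (3 * norm x)))"
      unfolding eq using Z C g0[of x] by (intro mult_left_mono mult_mono) (auto simp: less_imp_le)
    also have "\<dots> = Z * C * exp (- 2 * norm x)" by (simp flip: exp_add)
    finally show ?thesis .
  qed
  have "compact (\<pi> ` cball 0 R1)"
    by (intro compact_continuous_image continuous_on_subset[OF \<pi>_cont]) auto
  then have "bounded (\<pi> ` cball 0 R1)" by (rule compact_imp_bounded)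
  then obtain M where M': "\<forall>y\<in>\<pi> ` cball 0 R1. norm y \<le> M"
    unfolding bounded_iff by blast
  then have M: "\<pi> x \<le> M" if "norm x \<le> R1" for x
    using bspec[OF M' imageI[of x]] that by (simp add: abs_le_iff)
  define D where "D = Z * C + \<bar>M\<bar> * exp (2 * R1)"
  have D: "0 < D" using Z C by (simp add: D_def add_pos_nonneg)
  have "\<pi> x \<le> D * exp (- 2 * norm x)" for x
  proof (cases "R1 \<le> norm x")
    case True
    have "Z * C * exp (- 2 * norm x) \<le> D * exp (- 2 * norm x)" by (intro mult_right_mono) (auto simp: D_def)
    with far[OF True] show ?thesis by linarith
  next
    case False
    have "\<pi> x \<le> \<bar>M\<bar> * 1" using M[of x] False by simp
    also have "\<dots> \<le> \<bar>M\<bar> * (exp (2 * R1) * exp (- 2 * norm x))"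
      using False by (intro mult_left_mono) (auto simp flip: exp_add)
    also have "\<dots> \<le> D * exp (- 2 * norm x)" using Z C by (simp add: D_def distrib_right)
    finally show ?thesis .
  qed
  then have "sqrt (\<pi> x) \<le> sqrt D * exp (- norm x)" for x
  proof -
    have "sqrt (\<pi> x) \<le> sqrt (D * (exp (- norm x))\<^sup>2)"
      using \<open>\<And>x. \<pi> x \<le> D * exp (- 2 * norm x)\<close>[of x] by (simp add: power2_eq_square flip: exp_add)
    then show ?thesis by (simp add: real_sqrt_mult)
  qed
  then have "1 / sqrt D * exp (norm x) \<le> metro_weight \<pi> x" for x
    using \<pi>_pos[of x] D unfolding metro_weight_def
    by (simp add: field_simps exp_minus)
  then show "\<exists>a>0. \<forall>x. a * exp (norm x) \<le> metro_weight \<pi> x"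
    using D by (intro exI[of _ "1 / sqrt D"]) auto
qed

lemma class_P_geometric_convergence:
  fixes \<pi> q :: "real ^ 'n \<Rightarrow> real"
  assumes \<pi>: "\<pi> \<in> class_P" and chain: "srwm_chain \<pi> q"
  shows "\<exists>\<rho>>0. \<rho> < 1 \<and> (\<forall>x. \<exists>C. \<forall>n. \<forall>g. g \<in> borel_measurable borel \<longrightarrow> (\<forall>y. \<bar>g y\<bar> \<le> 1 + metro_weight \<pi> y) \<longrightarrow>
    \<bar>integral\<^sup>L (kernel_pow (srwm \<pi> q) n x) g - integral\<^sup>L (density lborel \<pi>) g\<bar> \<le> C * \<rho> ^ n)"
proof -
  interpret srwm_chain \<pi> q by (rule chain)
  let ?V = "metro_weight \<pi>"
  define I where "I x = (\<integral>y. drift_factor (\<pi> (x + y) / \<pi> x) * q y \<partial>lborel)" for x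
  obtain a where a: "0 < a" "\<And>x. a * exp (norm x) \<le> ?V x"
    using class_P_growth_and_drift(1)[OF \<pi> chain] by blast
  obtain R where R: "\<And>x. R \<le> norm x \<Longrightarrow> I x \<le> 3 / 4"
    using class_P_growth_and_drift(2)[OF \<pi> chain] unfolding I_def by blast
  have I2: "I x \<le> 2" for x
  proof -
    have "I x \<le> (\<integral>y. 2 * q y \<partial>lborel)"
      unfolding I_def using integrable_drift_factor integrable_q \<pi>_pos q_nonneg
      by (intro integral_mono mult_right_mono drift_factor_bounds) auto
    then show ?thesis using integrable_q by simp
  qed
  have "compact (?V ` cball 0 R)"
    by (intro compact_continuous_image continuous_on_subset[OF metro_weight_cont]) auto
  then have "bounded (?V ` cball 0 R)" by (rule compact_imp_bounded)
  then obtain M where M': "\<forall>y\<in>?V ` cball 0 R. norm y \<le> M"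
    unfolding bounded_iff by blast
  then have M: "?V x \<le> M" if "norm x \<le> R" for x
    using bspec[OF M' imageI[of x]] that by (simp add: abs_le_iff)
  \<comment> \<open>Inside the ball of radius \<open>R\<close> the drift factor is at most 2 and the
    weight at most |M|; the additional 1 makes \<open>K\<close> positive.\<close>
  define K where "K = 2 * \<bar>M\<bar> + 1"
  have drift: "(\<integral>\<^sup>+y. ennreal (?V y) \<partial>srwm \<pi> q x) \<le> ennreal (3 / 4 * ?V x + K)" for x
  proof -
    have "?V x * I x \<le> 3 / 4 * ?V x + K"
    proof (cases "R \<le> norm x")
      case True
      then have "?V x * I x \<le> ?V x * (3 / 4)"
        using metro_weight_pos[of x] by (intro mult_left_mono R) auto
      then show ?thesis by (simp add: K_def)
    next
      case False
      have "?V x * I x \<le> ?V x * 2" using metro_weight_pos[of x] I2 by (intro mult_left_mono) auto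
      also have "\<dots> \<le> K" using M[of x] False by (simp add: K_def)
      finally show ?thesis using metro_weight_pos[of x] by simp
    qed
    then show ?thesis unfolding nn_integral_metro_weight I_def[symmetric] by (rule ennreal_leI)
  qed
  show ?thesis
  proof (rule geometric_convergence[OF metro_weight_meas _ drift])
    fix r
    obtain n \<nu> where n: "n \<ge> 1" "sets \<nu> = sets borel" "emeasure \<nu> UNIV > 0"
      "\<forall>x A. norm x \<le> r / a \<longrightarrow> A \<in> sets borel \<longrightarrow> emeasure \<nu> A \<le> emeasure (kernel_pow (srwm \<pi> q) n x) A"
      using ball_minorization[of "r / a"] by blast
    \<comment> \<open>Sublevel sets of the weight are bounded by its exponential growth, so
      minorization on balls covers them.\<close>
    have "norm x \<le> r / a" if "?V x \<le> r" for x
    proof -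
      have "a * norm x \<le> a * exp (norm x)"
      proof (rule mult_left_mono)
        show "norm x \<le> exp (norm x)" using exp_ge_add_one_self[of "norm x"] by linarith
      qed (use a(1) in simp)
      then have "a * norm x \<le> r" using a(2)[of x] that by linarith
      then show ?thesis using a(1) by (simp add: field_simps)
    qed
    then show "\<exists>n\<ge>1. \<exists>\<nu>. sets \<nu> = sets borel \<and> emeasure \<nu> UNIV > 0 \<and>
        (\<forall>x A. ?V x \<le> r \<longrightarrow> A \<in> sets borel \<longrightarrow> emeasure \<nu> A \<le> emeasure (kernel_pow (srwm \<pi> q) n x) A)"
      using n by blast
  qed (use srwm_stationary metro_weight_pos in \<open>auto simp: K_def less_imp_le\<close>)
qed

lemma class_P_srwm_chain:
  fixes \<pi> q :: "real ^ 'n \<Rightarrow> real"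
  assumes "\<pi> \<in> class_P" "prob_density q" "\<And>y. q (- y) = q y"
  shows "srwm_chain \<pi> q"
proof
  have "\<exists>G :: real ^ 'n \<Rightarrow> real ^ 'n. \<forall>x. (\<pi> has_derivative (\<lambda>h. G x \<bullet> h)) (at x)"
    using assms(1) by (auto simp: class_P_def continuous_second_derivatives_def)
  then have "isCont \<pi> x" for x using has_derivative_continuous by blast
  then show "continuous_on UNIV \<pi>" by (simp add: continuous_at_imp_continuous_on)
qed (use assms in \<open>auto simp: class_P_def\<close>)

theorem theorem2p8:
  fixes \<pi> q q0 :: "real ^ 'n \<Rightarrow> real"
    and S :: "real ^ 'n ^ 'n"
    and p u :: real
    and k :: 'n
    and r :: "nat \<Rightarrow> real"
  assumes "\<pi> \<in> class_P"
    and "pos_def S"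
    and "prob_density q0"
    and "rotationally_invariant q0"
    and "integrable lborel (\<lambda>y. (y $ k)\<^sup>2 * q0 y)"
    and "\<And>x. q x = det S powr (- 1 / 2) * q0 (matrix_inv (matrix_sqrt S) *v x)"
    and "p > 1"
    and "integrable lborel (\<lambda>y. norm y powr p * q y)"
    and "1 \<le> u" and "u \<le> p"
    and "r \<sim>[sequentially] (\<lambda>n. real n powr (u - 1))"
  shows "fr_ergodic (srwm \<pi> q) (density lborel \<pi>) (power_weight (p - u)) r"
proof -
  \<comment> \<open>The matrix -1 is orthogonal, so rotational invariance contains evenness;
    \<open>q\<close> inherits it through a linear map.\<close>
  have q0_sym: "q0 (- x) = q0 x" for x
  proof -
    have neg: "(- mat 1 :: real ^ 'n ^ 'n) *v x = - x" for x
      by (simp add: vec_eq_iff matrix_vector_mult_def mat_def if_distrib if_distribR cong: if_cong)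
    have "transpose (- mat 1) = (- mat 1 :: real ^ 'n ^ 'n)" by (auto simp: transpose_def vec_eq_iff mat_def)
    moreover have "(- mat 1) ** (- mat 1) = (mat 1 :: real ^ 'n ^ 'n)"
      by (simp add: matrix_eq neg flip: matrix_vector_mul_assoc)
    ultimately have "orthogonal_matrix (- mat 1 :: real ^ 'n ^ 'n)"
      by (simp add: orthogonal_matrix)
    moreover note neg
    ultimately show ?thesis using assms(4) unfolding rotationally_invariant_def by metis
  qed
  have "q = (\<lambda>x. det S powr (- 1 / 2) * q0 (matrix_inv (matrix_sqrt S) *v x))"
    using assms(6) by (simp add: fun_eq_iff)
  then have qd: "prob_density q" using prob_density_elliptical[OF assms(2,3)] by simp
  have q_sym: "q (- y) = q y" for y
  proof -
    have "T *v (- y) = - (T *v y)" for T :: "real ^ 'n ^ 'n"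
      using linear_neg[OF matrix_vector_mul_linear] .
    then show ?thesis by (simp add: assms(6) q0_sym)
  qed
  have chain: "srwm_chain \<pi> q" by (rule class_P_srwm_chain[OF assms(1) qd q_sym])
  interpret srwm_chain \<pi> q by (rule chain)
  let ?V = "metro_weight \<pi>" and ?P = "kernel_pow (srwm \<pi> q)" and ?\<mu> = "density lborel \<pi>"
    and ?f = "power_weight (p - u) :: real ^ 'n \<Rightarrow> real"
  obtain \<rho> where \<rho>: "0 < \<rho>" "\<rho> < 1" and conv: "\<And>x. \<exists>C. \<forall>n. \<forall>g. g \<in> borel_measurable borel \<longrightarrow>
      (\<forall>y. \<bar>g y\<bar> \<le> 1 + ?V y) \<longrightarrow> \<bar>integral\<^sup>L (?P n x) g - integral\<^sup>L ?\<mu> g\<bar> \<le> C * \<rho> ^ n"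
    using class_P_geometric_convergence[OF assms(1) chain] by blast
  have tv: "(\<lambda>n. integral\<^sup>L (?P n x) g) \<longlonglongrightarrow> integral\<^sup>L ?\<mu> g"
    if gm: "g \<in> borel_measurable borel" and gb: "\<And>y. \<bar>g y\<bar> \<le> 1" for x and g :: "_ \<Rightarrow> real"
  proof -
    have "\<bar>g y\<bar> \<le> 1 + ?V y" for y using gb[of y] metro_weight_pos[of y] by linarith
    then obtain C where C: "\<And>n. \<bar>integral\<^sup>L (?P n x) g - integral\<^sup>L ?\<mu> g\<bar> \<le> C * \<rho> ^ n"
      using conv[of x] gm by blast
    have "(\<lambda>n. C * \<rho> ^ n) \<longlonglongrightarrow> 0"
      using \<rho> by (intro tendsto_mult_right_zero LIMSEQ_power_zero) auto
    then have "(\<lambda>n. integral\<^sup>L (?P n x) g - integral\<^sup>L ?\<mu> g) \<longlonglongrightarrow> 0"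
      by (rule Lim_null_comparison[rotated]) (use C in auto)
    then show ?thesis by (simp add: LIM_zero_iff)
  qed
  note erg = ergodic_of_convergence[OF srwm_stationary tv]
  have f1: "1 \<le> ?f x" for x by (simp add: power_weight_def)
  have f_meas: "?f \<in> borel_measurable borel"
    unfolding power_weight_def[abs_def] by (cases "p - u = 0") auto
  obtain a where a: "0 < a" "\<And>x. a * exp (norm x) \<le> ?V x"
    using class_P_growth_and_drift(1)[OF assms(1) chain] by blast
  obtain D0 where D0: "0 < D0" "\<And>t. 0 \<le> t \<Longrightarrow> t powr (p - u) \<le> D0 * exp t"
    using powr_le_exp[of "p - u"] assms(10) by auto
  \<comment> \<open>The 2 covers the constant term of \<open>power_weight\<close>, including
    exponent 0 where the weight equals 2; \<open>D0 / a\<close> covers the power through the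
    exponential growth of \<open>?V\<close>.\<close>
  define D where "D = 2 + D0 / a"
  have D: "0 < D" using D0 a by (simp add: D_def add_pos_pos)
  have fV: "?f x \<le> D * (1 + ?V x)" for x
  proof -
    have "norm x powr (p - u) \<le> D0 / a * (a * exp (norm x))"
      using D0(2)[of "norm x"] a(1) by simp
    also have "\<dots> \<le> D0 / a * ?V x" using a D0 by (intro mult_left_mono) auto
    finally have 1: "norm x powr (p - u) \<le> D0 / a * ?V x" .
    have "0 \<le> ?V x" "0 \<le> D0 / a" using metro_weight_pos[of x] a D0 by (auto simp: less_imp_le)
    moreover from this have "0 \<le> D0 / a * ?V x" by (rule mult_nonneg_nonneg[rotated])
    ultimately show ?thesis using 1 by (auto simp: power_weight_def D_def algebra_simps)
  qed
  have "(\<lambda>n. ereal (r n) * f_norm_diff ?f (?P n x) ?\<mu>) \<longlonglongrightarrow> 0" for x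
  proof -
    obtain C where C: "\<And>n g. g \<in> borel_measurable borel \<Longrightarrow> (\<forall>y. \<bar>g y\<bar> \<le> 1 + ?V y) \<Longrightarrow>
        \<bar>integral\<^sup>L (?P n x) g - integral\<^sup>L ?\<mu> g\<bar> \<le> C * \<rho> ^ n"
      using conv[of x] by blast
    have up: "f_norm_diff ?f (?P n x) ?\<mu> \<le> ereal (D * (C * \<rho> ^ n))" for n
      unfolding f_norm_diff_def
    proof (rule SUP_least)
      fix g assume g: "g \<in> {g. integrable (?P n x) g \<and> integrable ?\<mu> g \<and> (\<forall>y. \<bar>g y\<bar> \<le> ?f y)}"
      have "g \<in> borel_measurable (?P n x)" using g by (auto intro: borel_measurable_integrable)
      then have [measurable]: "g \<in> borel_measurable borel"
        by (subst (asm) measurable_cong_sets[OF sets_kernel_pow refl])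
      have "\<bar>g y / D\<bar> \<le> 1 + ?V y" for y
      proof -
        have "\<bar>g y\<bar> \<le> D * (1 + ?V y)" using g fV[of y] by (auto intro: order_trans)
        then show ?thesis using D by (simp add: field_simps)
      qed
      then have "\<bar>integral\<^sup>L (?P n x) (\<lambda>y. g y / D) - integral\<^sup>L ?\<mu> (\<lambda>y. g y / D)\<bar> \<le> C * \<rho> ^ n"
        by (intro C) auto
      then have "\<bar>integral\<^sup>L (?P n x) g - integral\<^sup>L ?\<mu> g\<bar> / D \<le> C * \<rho> ^ n"
        using D by (simp flip: diff_divide_distrib)
      then show "ereal \<bar>integral\<^sup>L (?P n x) g - integral\<^sup>L ?\<mu> g\<bar> \<le> ereal (D * (C * \<rho> ^ n))"
        using D by (simp add: field_simps)
    qed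
    have low: "0 \<le> f_norm_diff ?f (?P n x) ?\<mu>" for n
      unfolding f_norm_diff_def
      by (rule SUP_upper2[of "\<lambda>_. 0"]) (use f1 in \<open>auto intro: order_trans[OF zero_le_one]\<close>)
    have "r \<in> O(\<lambda>n. real n powr (u - 1))"
      using assms(11) by (rule asymp_equiv_imp_bigo)
    then obtain c where c: "0 < c" "eventually (\<lambda>n. norm (r n) \<le> c * norm (real n powr (u - 1))) sequentially"
      by (rule landau_o.bigE)
    have "(\<lambda>n. (c * D * C) * (real n powr (u - 1) * \<rho> ^ n)) \<longlonglongrightarrow> 0"
      by (intro tendsto_mult_right_zero powr_times_geometric_tendsto_0 \<rho>)
    then have z: "(\<lambda>n. ereal ((c * D * C) * (real n powr (u - 1) * \<rho> ^ n))) \<longlonglongrightarrow> 0"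
      by (simp add: zero_ereal_def)
    \<comment> \<open>A two-sided bound, because the asymptotics of \<open>r\<close> leave the signs
      of its early values open. The norm difference is finite and nonnegative, so the product of
      extended reals is a real product.\<close>
    have bnd: "- ereal ((c * D * C) * (real n powr (u - 1) * \<rho> ^ n)) \<le> ereal (r n) * f_norm_diff ?f (?P n x) ?\<mu> \<and>
        ereal (r n) * f_norm_diff ?f (?P n x) ?\<mu> \<le> ereal ((c * D * C) * (real n powr (u - 1) * \<rho> ^ n))"
      if "norm (r n) \<le> c * norm (real n powr (u - 1))" for n
    proof -
      obtain v where v: "f_norm_diff ?f (?P n x) ?\<mu> = ereal v" "0 \<le> v" "v \<le> D * (C * \<rho> ^ n)"
        using low[of n] up[of n] by (cases "f_norm_diff ?f (?P n x) ?\<mu>") auto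
      have "\<bar>r n * v\<bar> \<le> (c * real n powr (u - 1)) * (D * (C * \<rho> ^ n))"
        unfolding abs_mult using that v c by (intro mult_mono) auto
      then have "\<bar>r n * v\<bar> \<le> (c * D * C) * (real n powr (u - 1) * \<rho> ^ n)" by (simp add: ac_simps)
      then have "- ((c * D * C) * (real n powr (u - 1) * \<rho> ^ n)) \<le> r n * v"
          "r n * v \<le> (c * D * C) * (real n powr (u - 1) * \<rho> ^ n)"
        by linarith+
      then show ?thesis unfolding v(1) by simp
    qed
    show ?thesis
    proof (rule tendsto_sandwich[OF _ _ _ z])
      show "(\<lambda>n. - ereal ((c * D * C) * (real n powr (u - 1) * \<rho> ^ n))) \<longlonglongrightarrow> 0"
        using tendsto_uminus_ereal[OF z] by simp
    qed (use c(2) in \<open>eventually_elim, use bnd in blast\<close>)+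
  qed
  then show ?thesis
    unfolding fr_ergodic_def using erg srwm_stationary f_meas f1 by blast
qed

end
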